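(* Consider the decentralized finite-sum variational inequality of the context, where each $F_m$ is $L$-Lipschitz and $\mu$-strongly monotone ($\mu>0$) and for each $m$ the collection $\{F_{m,i}\}_{i=1}^n$ is $\overline L$-average Lipschitz, over a sequence of time-varying $B$-connected graphs $\mathcal G(t)$ with gossip matrices $\mathbf W(t)$ satisfying the time-varying network assumption of the context. Let $T\ge B$ be such that the contraction property $$\|\mathbf W_T(t)v-v\|^2\le(1-\chi(T)^{-1})\|v\|^2\quad\text{for all }t\text{ and all }v\in\mathbb R^M\text{ with }\textstyle\sum_mv_m=0$$ holds with a number $\chi(T)\ge1$. Let $\{\mathbf z^k\}$ be the sequence generated by Algorithm 2 (described in the context) with this $T$, batch size $b\in\{1,\dots,n\}$, probability $p\in(0,1)$ and parameters satisfying $$\omega=p\le\tfrac1{16},\quad\theta=\tfrac12,\quad\beta=5\gamma,\quad\nu=\tfrac\mu4,\quad\tau=\min\Big\{\tfrac{\mu}{32L\chi(T)},\tfrac{\mu\sqrt{bp}}{32\overline L}\Big\},$$ $$\eta_z=\min\Big\{\tfrac1{8L\chi(T)},\tfrac1{32\eta_y},\tfrac{\sqrt{\alpha b\omega}}{8\overline L}\Big\},\quad\eta_y=\min\Big\{\tfrac1{4\gamma},\tfrac{\nu}{8\tau}\Big\},\quad\eta_x=\min\Big\{\tfrac1{900\chi(T)\gamma},\tfrac{\nu}{36\tau\chi^2(T)}\Big\},$$ $$\gamma=\min\Big\{\tfrac{\mu}{16L^2},\tfrac{b\omega}{24\overline L^2\eta_z}\Big\},\quad\alpha=\max\Big\{1-\tfrac{p\eta_z\nu}{p+\eta_z\nu},\,1-\eta_y\gamma,\,1-\eta_x\gamma,\,1-\tfrac{\mu\eta_z}8,\,1-\tau,\,1-\tfrac1{4\chi(T)}\Big\}.$$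 Then, given $\varepsilon>0$, the number of iterations sufficient for $\mathbb E[\|\mathbf z^k-\mathbf z^*\|^2]\le\varepsilon$ is $$\mathcal O\left(\left[\chi^2(T)+\frac1p+\chi(T)\frac L\mu+\frac1{\sqrt{bp}}\frac{\overline L}\mu\right]\log\frac1\varepsilon\right).$$ That is, there are an absolute constant $C>0$ and a constant $C_0>0$ depending on the problem, the parameters and the initial point but not on $\varepsilon$ or $k$, such that $\mathbb E[\|\mathbf z^k-\mathbf z^*\|^2]\le\varepsilon$ for every integer $k\ge0$ with $k\ge C\big[\chi^2(T)+\frac1p+\chi(T)\frac L\mu+\frac1{\sqrt{bp}}\frac{\overline L}\mu\big]\log\frac{C_0}\varepsilon$.
   Context: **Problem.** $F_m=\frac1n\sum_{i=1}^nF_{m,i}$ with $F_{m,i}:\mathbb R^d\to\mathbb R^d$, $m=1,\dots,M$, and $g:\mathbb R^d\to\mathbb R\cup\{+\infty\}$ is proper, lower semicontinuous and convex. Find $z^*\in\mathbb R^d$ with $\langle\sum_mF_m(z^* ),z-z^*\rangle+g(z)-g(z^* )\ge0$ for all $z\in\mathbb R^d$. Lifted form: for $\mathbf z=(z_1,\dots,z_M)\in(\mathbb R^d)^M$ (Euclidean norm) put $\mathbf F(\mathbf z)=(F_1(z_1),\dots,F_M(z_M))$, $\mathbf g(\mathbf z)=\frac1M\sum_mg(z_m)$, $\mathcal L=\{\mathbf z: z_1=\dots=z_M\}$; find $\mathbf z^*\in\mathcal L$ with $\langle\mathbf F(\mathbf z^* ),\mathbf z-\mathbf z^*\rangle+\mathbf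 g(\mathbf z)-\mathbf g(\mathbf z^* )\ge0$ for all $\mathbf z\in\mathcal L$; thus $\mathbf z^*=(z^*,\dots,z^* )$. **Regularity.** $L$-Lipschitz: $\|F_m(u)-F_m(v)\|\le L\|u-v\|$. $\overline L$-average Lipschitz: $\frac1n\sum_{i}\|F_{m,i}(u)-F_{m,i}(v)\|^2\le\overline L^2\|u-v\|^2$. $\mu$-strongly monotone: $\langle F_m(u)-F_m(v),u-v\rangle\ge\mu\|u-v\|^2$. All hold for all $u,v\in\mathbb R^d$. **Time-varying network assumption.** At each time $t$ the network is a directed graph $\mathcal G(t)=(\{1,\dots,M\},\mathcal E(t))$. The sequence is $B$-connected: for every $t$ the graph with edge set $\bigcup_{\tau=t}^{t+B-1}\mathcal E(\tau)$ is connected. For an integer $T\ge1$ put $\mathbf W_T(t)=\mathbf I_M-\prod_{\tau=t}^{t+T-1}(\mathbf I_M-\mathbf W(\tau))$ (factors applied in chronological order). The gossip matrices $\mathbf W(t)\in\mathbb R^{M\times M}$ satisfy: (1) $w_{i,j}(t)=0$ whenever $i\ne j$ and $(i,j)\notin\mathcal E(t)$; (2) $\ker\mathbf W(t)$ contains the all-ones vector; (3) the range of $\mathbf W(t)$ is contained in $\{v\in\mathbb R^M:\sum_mv_m=0\}$; (4) there is $\chi\ge1$ with $\|\mathbf W_B(t)v-v\|^2\le(1-\chi^{-1})\|v\|^2$ for all $t$ and all $v\in\mathbb R^M$ with $\sum_mv_m=0$. **Algorithm 2.** Parameters: stepsizes $\eta_z,\eta_y,\eta_x,\theta>0$, momentums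 $\alpha,\gamma,\omega,\tau$, parameters $\nu,\beta$, batch size $b$, probability $p$, integer $T$. Initialization: $\mathbf z^0=\mathbf w^0\in(\mathrm{dom}\,g)^M$, $\mathbf y^0\in(\mathbb R^d)^M$, $\mathbf x^0\in\mathcal L^\perp$, $\mathbf z^{-1}=\mathbf z^0$, $\mathbf w^{-1}=\mathbf w^0$, $\mathbf y_f^0=\mathbf y^{-1}=\mathbf y^0$, $\mathbf x_f^0=\mathbf x^{-1}=\mathbf x^0$, $m^0=0\in(\mathbb R^d)^M$. For $k=0,1,2,\dots$: each worker $m$ samples indices $j^k_{m,1},\dots,j^k_{m,b}$ and $j^{k+1/2}_{m,1},\dots,j^{k+1/2}_{m,b}$, all independent and uniform on $\{1,\dots,n\}$ (independent of the past and across workers). For $l=1,\dots,b$ let $\mathbf F_l^{k}(\mathbf z)=(F_{1,j^k_{1,l}}(z_1),\dots,F_{M,j^k_{M,l}}(z_M))$ and define $\mathbf F_l^{k+1/2}$ analogously. Write $\mathbf A_k=\mathbf W_T(Tk)\otimes\mathbf I_d$. Then - $\delta^k=\frac1b\sum_{l=1}^b\big(\mathbf F^k_l(\mathbf z^k)-\mathbf F^k_l(\mathbf w^{k-1})+\alpha[\mathbf F^k_l(\mathbf z^k)-\mathbf F^k_l(\mathbf z^{k-1})]\big)+\mathbf F(\mathbf w^{k-1})$; - $\Delta_z^k=\delta^k-\nu\mathbf z^k-\mathbf y^k-\alpha(\mathbf y^k-\mathbf y^{k-1})$; - $\mathbf z^{k+1}=\mathrm{prox}_{\eta_z\mathbf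 g}(\mathbf z^k+\omega(\mathbf w^k-\mathbf z^k)-\eta_z\Delta_z^k)$, where $\mathrm{prox}_{\eta\mathbf g}(\mathbf v)=\arg\min_{\mathbf u}\{\eta\mathbf g(\mathbf u)+\frac12\|\mathbf u-\mathbf v\|^2\}$; - $\mathbf y_c^k=\tau\mathbf y^k+(1-\tau)\mathbf y_f^k$ and $\mathbf x_c^k=\tau\mathbf x^k+(1-\tau)\mathbf x_f^k$; - $\Delta_y^k=\nu^{-1}(\mathbf y_c^k+\mathbf x_c^k)+\mathbf z^{k+1}+\gamma(\mathbf y^k+\mathbf x^k+\nu\mathbf z^k)$; - $\delta^{k+1/2}=\frac1b\sum_{l=1}^b\big(\mathbf F^{k+1/2}_l(\mathbf z^{k+1})-\mathbf F^{k+1/2}_l(\mathbf w^k)\big)+\mathbf F(\mathbf w^k)$; - $\Delta_x^k=\nu^{-1}(\mathbf y_c^k+\mathbf x_c^k)+\beta(\mathbf x^k+\delta^{k+1/2})$; - $\mathbf y^{k+1}=\mathbf y^k-\eta_y\Delta_y^k$; - $\mathbf x^{k+1}=\mathbf x^k-\mathbf A_k(\eta_x\Delta_x^k+m^k)$; - $m^{k+1}=\eta_x\Delta_x^k+m^k-\mathbf A_k(\eta_x\Delta_x^k+m^k)$; - $\mathbf y_f^{k+1}=\mathbf y_c^k+\tau(\mathbf y^{k+1}-\mathbf y^k)$ and $\mathbf x_f^{k+1}=\mathbf x_c^k-\theta\mathbf A_k(\mathbf y_c^k+\mathbf x_c^k)$; - $\mathbf w^{k+1}=\mathbf z^k$ with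 probability $p$ and $\mathbf w^{k+1}=\mathbf w^k$ with probability $1-p$ (independent of everything else). *)

theory Defs
  imports
    "HOL-Probability.Probability"
    "Jordan_Normal_Form.Matrix"
    "Graph_Theory.Digraph_Component"
begin

section \<open>Euclidean spaces of varying dimension\<close>

text \<open>
  The dimension \<open>d\<close> and the number of workers \<open>M\<close> are numbers, not types, because the constant in
  the theorem is to be independent of both. All \<open>\<real>\<^sup>d\<close> are therefore realised as subspaces of one
  inner product space, the finitely supported sequences; the coefficients are taken from an arbitrary
  inner product space, so that \<open>(\<real>\<^sup>d)\<^sup>M\<close> with its Euclidean norm is obtained by iteration.
  (The library type of finitely supported functions carries the \<open>\<ell>\<^sup>1\<close> norm and cannot be used.)
\<close>

typedef (overloaded) 'a fvec = "{x :: nat \<Rightarrow> 'a :: real_inner. finite {i. x i \<noteq> 0}}"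
  morphisms coord Abs_fvec
  by (rule exI[of _ "\<lambda>_. 0"]) simp

setup_lifting type_definition_fvec

lemma finite_coord [simp]: "finite {i. coord x i \<noteq> 0}"
  using coord[of x] by simp

lemma fvec_eqI: "(\<And>i. coord x i = coord y i) \<Longrightarrow> x = y"
  by (metis coord_inject ext)

instantiation fvec :: (real_inner) real_vector
begin

lift_definition zero_fvec :: "'a fvec" is "\<lambda>_. 0" by simp

lift_definition plus_fvec :: "'a fvec \<Rightarrow> 'a fvec \<Rightarrow> 'a fvec" is "\<lambda>x y i. x i + y i"
proof -
  fix x y :: "nat \<Rightarrow> 'a"
  assume "finite {i. x i \<noteq> 0}" "finite {i. y i \<noteq> 0}"
  then show "finite {i. x i + y i \<noteq> 0}"
    by (rule_tac finite_subset[of _ "{i. x i \<noteq> 0} \<union> {i. y i \<noteq> 0}"]) auto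
qed

lift_definition uminus_fvec :: "'a fvec \<Rightarrow> 'a fvec" is "\<lambda>x i. - x i" by simp

lift_definition minus_fvec :: "'a fvec \<Rightarrow> 'a fvec \<Rightarrow> 'a fvec" is "\<lambda>x y i. x i - y i"
proof -
  fix x y :: "nat \<Rightarrow> 'a"
  assume "finite {i. x i \<noteq> 0}" "finite {i. y i \<noteq> 0}"
  then show "finite {i. x i - y i \<noteq> 0}"
    by (rule_tac finite_subset[of _ "{i. x i \<noteq> 0} \<union> {i. y i \<noteq> 0}"]) auto
qed

lift_definition scaleR_fvec :: "real \<Rightarrow> 'a fvec \<Rightarrow> 'a fvec" is "\<lambda>c x i. c *\<^sub>R x i"
  by (rule finite_subset) auto

instance
  by standard (transfer; simp add: algebra_simps)+

end

lemmas coord_simps [simp] =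
  zero_fvec.rep_eq plus_fvec.rep_eq uminus_fvec.rep_eq minus_fvec.rep_eq scaleR_fvec.rep_eq

instantiation fvec :: (real_inner) real_inner
begin

definition inner_fvec :: "'a fvec \<Rightarrow> 'a fvec \<Rightarrow> real" where
  "inner_fvec x y = (\<Sum>i | coord x i \<noteq> 0 \<and> coord y i \<noteq> 0. inner (coord x i) (coord y i))"

definition norm_fvec :: "'a fvec \<Rightarrow> real" where
  "norm_fvec x = sqrt (inner x x)"

definition dist_fvec :: "'a fvec \<Rightarrow> 'a fvec \<Rightarrow> real" where
  "dist_fvec x y = norm (x - y)"

definition sgn_fvec :: "'a fvec \<Rightarrow> 'a fvec" where
  "sgn_fvec x = x /\<^sub>R norm x"

definition uniformity_fvec :: "('a fvec \<times> 'a fvec) filter" where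
  "uniformity_fvec = (INF e\<in>{0<..}. principal {(x, y). dist x y < e})"

definition open_fvec :: "'a fvec set \<Rightarrow> bool" where
  "open_fvec U \<longleftrightarrow> (\<forall>x\<in>U. eventually (\<lambda>(x', y). x' = x \<longrightarrow> y \<in> U) uniformity)"

lemma inner_fvec_superset:
  assumes "finite S" "{i. coord x i \<noteq> 0 \<and> coord y i \<noteq> 0} \<subseteq> S"
  shows "inner x y = (\<Sum>i\<in>S. inner (coord x i) (coord y i))"
  unfolding inner_fvec_def using assms by (intro sum.mono_neutral_left) auto

instance
proof
  fix x y z :: "'a fvec" and r :: real
  let ?S = "{i. coord x i \<noteq> 0} \<union> {i. coord y i \<noteq> 0} \<union> {i. coord z i \<noteq> 0}"
  have S: "finite ?S" by simp
  show "dist x y = norm (x - y)" by (rule dist_fvec_def)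
  show "sgn x = x /\<^sub>R norm x" by (rule sgn_fvec_def)
  show "norm x = sqrt (inner x x)" by (rule norm_fvec_def)
  show "inner x y = inner y x"
    by (simp add: inner_fvec_def inner_commute conj_commute)
  show "inner (x + y) z = inner x z + inner y z"
    by (subst (1 2 3) inner_fvec_superset[OF S]) (auto simp: inner_add_left sum.distrib)
  show "inner (r *\<^sub>R x) y = r * inner x y"
    by (subst (1 2) inner_fvec_superset[OF S]) (auto simp: sum_distrib_left)
  show "0 \<le> inner x x"
    by (auto simp: inner_fvec_def intro: sum_nonneg)
  show "inner x x = 0 \<longleftrightarrow> x = 0"
  proof
    assume "inner x x = 0"
    then have "\<forall>i\<in>{i. coord x i \<noteq> 0}. inner (coord x i) (coord x i) = 0"
      by (subst sum_nonneg_eq_0_iff[symmetric]) (auto simp: inner_fvec_def)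
    then show "x = 0" by (intro fvec_eqI) auto
  qed (simp add: inner_fvec_def)
qed (rule uniformity_fvec_def open_fvec_def)+

end

definition Rn :: "nat \<Rightarrow> real fvec set" where
  "Rn d = {x. \<forall>i\<ge>d. coord x i = 0}"

definition Rtup :: "nat \<Rightarrow> nat \<Rightarrow> real fvec fvec set" where
  "Rtup M d = {z. (\<forall>m<M. coord z m \<in> Rn d) \<and> (\<forall>m\<ge>M. coord z m = 0)}"

lemma inner_Rn:
  assumes "x \<in> Rn d" "y \<in> Rn d"
  shows "inner x y = (\<Sum>i<d. coord x i * coord y i)"
proof -
  have "{i. coord x i \<noteq> 0 \<and> coord y i \<noteq> 0} \<subseteq> {..<d}"
    using assms by (auto simp: Rn_def not_le[symmetric])
  then show ?thesis by (subst inner_fvec_superset) auto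
qed

lemma inner_Rtup:
  assumes "x \<in> Rtup M d" "y \<in> Rtup M d"
  shows "inner x y = (\<Sum>m<M. inner (coord x m) (coord y m))"
proof -
  have "{i. coord x i \<noteq> 0 \<and> coord y i \<noteq> 0} \<subseteq> {..<M}"
    using assms by (auto simp: Rtup_def not_le[symmetric])
  then show ?thesis by (subst inner_fvec_superset) auto
qed

definition tup :: "nat \<Rightarrow> (nat \<Rightarrow> 'a) \<Rightarrow> 'a :: real_inner fvec" where
  "tup M f = Abs_fvec (\<lambda>m. if m < M then f m else 0)"

lemma coord_tup [simp]: "coord (tup M f) m = (if m < M then f m else 0)"
  unfolding tup_def by (subst Abs_fvec_inverse) auto

definition consensus :: "nat \<Rightarrow> nat \<Rightarrow> real fvec fvec set" where
  "consensus M d = {z \<in> Rtup M d. \<forall>i<M. \<forall>j<M. coord z i = coord z j}"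

text \<open>
  For an \<open>M \<times> M\<close> matrix \<open>A\<close>, \<open>mat_act A\<close> is \<open>v \<mapsto> A v\<close> on \<open>\<real>\<^sup>M\<close> (coefficients in \<open>\<real>\<close>) and
  \<open>z \<mapsto> (A \<otimes> I\<^sub>d) z\<close> on \<open>(\<real>\<^sup>d)\<^sup>M\<close> (coefficients in \<open>\<real>\<^sup>d\<close>).
\<close>

definition mat_act :: "real mat \<Rightarrow> 'a :: real_inner fvec \<Rightarrow> 'a fvec" where
  "mat_act A z = tup (dim_row A) (\<lambda>i. \<Sum>j<dim_col A. A $$ (i, j) *\<^sub>R coord z j)"


section \<open>The variational inequality\<close>

definition proper_on :: "'a set \<Rightarrow> ('a \<Rightarrow> ereal) \<Rightarrow> bool" where
  "proper_on S g \<longleftrightarrow> (\<forall>x\<in>S. g x \<noteq> -\<infinity>) \<and> (\<exists>x\<in>S. g x < \<infinity>)"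

definition lsc_on :: "'a :: topological_space set \<Rightarrow> ('a \<Rightarrow> ereal) \<Rightarrow> bool" where
  "lsc_on S g \<longleftrightarrow> (\<forall>x\<in>S. g x \<le> Liminf (at x within S) g)"

definition ereal_convex_on :: "'a :: real_vector set \<Rightarrow> ('a \<Rightarrow> ereal) \<Rightarrow> bool" where
  "ereal_convex_on S g \<longleftrightarrow> (\<forall>x\<in>S. \<forall>y\<in>S. \<forall>t\<in>{0<..<1}.
     g ((1 - t) *\<^sub>R x + t *\<^sub>R y) \<le> ereal (1 - t) * g x + ereal t * g y)"

text \<open>
  Workers are numbered \<open>0, \<dots>, M - 1\<close> and the summands of each operator \<open>0, \<dots>, n - 1\<close>;
  \<open>F m i\<close> is the \<open>i\<close>-th summand of worker \<open>m\<close>.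
\<close>

definition mean_op ::
    "nat \<Rightarrow> (nat \<Rightarrow> nat \<Rightarrow> real fvec \<Rightarrow> real fvec) \<Rightarrow> nat \<Rightarrow> real fvec \<Rightarrow> real fvec" where
  "mean_op n F m x = (1 / real n) *\<^sub>R (\<Sum>i<n. F m i x)"

definition lift_op :: "nat \<Rightarrow> (nat \<Rightarrow> real fvec \<Rightarrow> real fvec) \<Rightarrow> real fvec fvec \<Rightarrow> real fvec fvec" where
  "lift_op M G z = tup M (\<lambda>m. G m (coord z m))"

definition lift_reg :: "nat \<Rightarrow> (real fvec \<Rightarrow> ereal) \<Rightarrow> real fvec fvec \<Rightarrow> ereal" where
  "lift_reg M g z = ereal (1 / real M) * (\<Sum>m<M. g (coord z m))"

definition average_lipschitz ::
    "nat \<Rightarrow> real \<Rightarrow> 'a :: real_normed_vector set \<Rightarrow> (nat \<Rightarrow> 'a \<Rightarrow> 'a) \<Rightarrow> bool" where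
  "average_lipschitz n L S f \<longleftrightarrow> (\<forall>u\<in>S. \<forall>v\<in>S.
     (1 / real n) * (\<Sum>i<n. (norm (f i u - f i v))\<^sup>2) \<le> L\<^sup>2 * (norm (u - v))\<^sup>2)"

definition strongly_monotone :: "real \<Rightarrow> 'a :: real_inner set \<Rightarrow> ('a \<Rightarrow> 'a) \<Rightarrow> bool" where
  "strongly_monotone \<mu> S f \<longleftrightarrow> (\<forall>u\<in>S. \<forall>v\<in>S. inner (f u - f v) (u - v) \<ge> \<mu> * (norm (u - v))\<^sup>2)"

definition vi_solution :: "'a :: real_inner set \<Rightarrow> ('a \<Rightarrow> 'a) \<Rightarrow> ('a \<Rightarrow> ereal) \<Rightarrow> 'a \<Rightarrow> bool" where
  "vi_solution S G h x \<longleftrightarrow> x \<in> S \<and> (\<forall>z\<in>S. 0 \<le> ereal (inner (G x) (z - x)) + h z - h x)"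


section \<open>The time-varying network\<close>

definition B_connected :: "nat \<Rightarrow> nat \<Rightarrow> (nat \<Rightarrow> (nat \<times> nat) set) \<Rightarrow> bool" where
  "B_connected M B E \<longleftrightarrow>
     (\<forall>t. Digraph_Component.connected
            (with_proj \<lparr>pverts = {..<M}, parcs = (\<Union>s\<in>{t..<t + B}. E s)\<rparr>))"

text \<open>
  \<open>mix M W t T\<close> is \<open>(I - W(t + T - 1)) \<cdots> (I - W(t))\<close>: applied to a vector, the factor of time \<open>t\<close>
  acts first.
\<close>

primrec mix :: "nat \<Rightarrow> (nat \<Rightarrow> real mat) \<Rightarrow> nat \<Rightarrow> nat \<Rightarrow> real mat" where
  "mix M W t 0 = 1\<^sub>m M"
| "mix M W t (Suc T) = (1\<^sub>m M - W (t + T)) * mix M W t T"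

definition multi_gossip :: "nat \<Rightarrow> (nat \<Rightarrow> real mat) \<Rightarrow> nat \<Rightarrow> nat \<Rightarrow> real mat" where
  "multi_gossip M W T t = 1\<^sub>m M - mix M W t T"

definition contraction :: "nat \<Rightarrow> (nat \<Rightarrow> real mat) \<Rightarrow> nat \<Rightarrow> real \<Rightarrow> bool" where
  "contraction M W T chi \<longleftrightarrow> (\<forall>t. \<forall>v\<in>Rn M. (\<Sum>m<M. coord v m) = 0 \<longrightarrow>
     (norm (mat_act (multi_gossip M W T t) v - v))\<^sup>2 \<le> (1 - inverse chi) * (norm v)\<^sup>2)"

definition time_varying_network ::
    "nat \<Rightarrow> nat \<Rightarrow> (nat \<Rightarrow> (nat \<times> nat) set) \<Rightarrow> (nat \<Rightarrow> real mat) \<Rightarrow> bool" where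
  "time_varying_network M B E W \<longleftrightarrow>
     B \<ge> 1 \<and> (\<forall>t. E t \<subseteq> {..<M} \<times> {..<M}) \<and> B_connected M B E \<and>
     (\<forall>t. W t \<in> carrier_mat M M) \<and>
     (\<forall>t. \<forall>i<M. \<forall>j<M. i \<noteq> j \<and> (i, j) \<notin> E t \<longrightarrow> W t $$ (i, j) = 0) \<and>
     (\<forall>t. mat_act (W t) (tup M (\<lambda>_. 1 :: real)) = 0) \<and>
     (\<forall>t. \<forall>v\<in>Rn M. (\<Sum>m<M. coord (mat_act (W t) v) m) = 0) \<and>
     (\<exists>chi\<ge>1. contraction M W B chi)"


section \<open>The algorithm\<close>

record alg_params =
  p_eta_z :: real
  p_eta_y :: real
  p_eta_x :: real
  p_theta :: real
  p_alpha :: real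
  p_gamma :: real
  p_omega :: real
  p_tau :: real
  p_nu :: real
  p_beta :: real
  p_batch :: nat
  p_prob :: real
  p_period :: nat

text \<open>The fields ending in \<open>prev\<close> hold the iterate of index \<open>k - 1\<close>.\<close>

record alg_state =
  s_z :: "real fvec fvec"
  s_z_prev :: "real fvec fvec"
  s_w :: "real fvec fvec"
  s_w_prev :: "real fvec fvec"
  s_y :: "real fvec fvec"
  s_y_prev :: "real fvec fvec"
  s_y_f :: "real fvec fvec"
  s_x :: "real fvec fvec"
  s_x_f :: "real fvec fvec"
  s_m :: "real fvec fvec"

definition init_state ::
    "real fvec fvec \<Rightarrow> real fvec fvec \<Rightarrow> real fvec fvec \<Rightarrow> alg_state" where
  "init_state z y x =
     \<lparr>s_z = z, s_z_prev = z, s_w = z, s_w_prev = z, s_y = y, s_y_prev = y, s_y_f = y,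
      s_x = x, s_x_f = x, s_m = 0\<rparr>"

definition prox :: "'a :: real_normed_vector set \<Rightarrow> real \<Rightarrow> ('a \<Rightarrow> ereal) \<Rightarrow> 'a \<Rightarrow> 'a" where
  "prox S \<eta> h v = arg_min_on (\<lambda>u. ereal \<eta> * h u + ereal (1 / 2 * (norm (u - v))\<^sup>2)) S"

text \<open>
  \<open>J (m, l)\<close> and \<open>J' (m, l)\<close> are the indices drawn by worker \<open>m\<close> for \<open>\<delta>\<^sup>k\<close> and \<open>\<delta>\<^sup>k\<^sup>+\<^sup>1\<^sup>/\<^sup>2\<close>;
  \<open>c\<close> tells whether \<open>w\<close> is reset.
\<close>

definition alg_update ::
    "nat \<Rightarrow> nat \<Rightarrow> nat \<Rightarrow> (nat \<Rightarrow> nat \<Rightarrow> real fvec \<Rightarrow> real fvec) \<Rightarrow> (real fvec \<Rightarrow> ereal) \<Rightarrow>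
     (nat \<Rightarrow> real mat) \<Rightarrow> alg_params \<Rightarrow> nat \<Rightarrow>
     (nat \<times> nat \<Rightarrow> nat) \<Rightarrow> (nat \<times> nat \<Rightarrow> nat) \<Rightarrow> bool \<Rightarrow> alg_state \<Rightarrow> alg_state" where
  "alg_update d M n F g W P k J J' c s =
    (let \<eta>z = p_eta_z P; \<eta>y = p_eta_y P; \<eta>x = p_eta_x P; \<theta> = p_theta P; \<alpha> = p_alpha P;
         \<gamma> = p_gamma P; \<omega> = p_omega P; \<tau> = p_tau P; \<nu> = p_nu P; \<beta> = p_beta P;
         b = p_batch P; T = p_period P;
         z = s_z s; z_prev = s_z_prev s; w = s_w s; w_prev = s_w_prev s;
         y = s_y s; y_prev = s_y_prev s; y_f = s_y_f s; x = s_x s; x_f = s_x_f s; mm = s_m s;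
         A = mat_act (multi_gossip M W T (T * k));
         FF = lift_op M (mean_op n F);
         Fs = (\<lambda>l. lift_op M (\<lambda>m. F m (J (m, l))));
         Fs' = (\<lambda>l. lift_op M (\<lambda>m. F m (J' (m, l))));
         \<delta> = (1 / real b) *\<^sub>R (\<Sum>l<b. Fs l z - Fs l w_prev + \<alpha> *\<^sub>R (Fs l z - Fs l z_prev)) + FF w_prev;
         \<Delta>z = \<delta> - \<nu> *\<^sub>R z - y - \<alpha> *\<^sub>R (y - y_prev);
         z_new = prox (Rtup M d) \<eta>z (lift_reg M g) (z + \<omega> *\<^sub>R (w - z) - \<eta>z *\<^sub>R \<Delta>z);
         y_c = \<tau> *\<^sub>R y + (1 - \<tau>) *\<^sub>R y_f;
         x_c = \<tau> *\<^sub>R x + (1 - \<tau>) *\<^sub>R x_f;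
         \<Delta>y = inverse \<nu> *\<^sub>R (y_c + x_c) + z_new + \<gamma> *\<^sub>R (y + x + \<nu> *\<^sub>R z);
         \<delta>' = (1 / real b) *\<^sub>R (\<Sum>l<b. Fs' l z_new - Fs' l w) + FF w;
         \<Delta>x = inverse \<nu> *\<^sub>R (y_c + x_c) + \<beta> *\<^sub>R (x + \<delta>');
         y_new = y - \<eta>y *\<^sub>R \<Delta>y
     in \<lparr>s_z = z_new, s_z_prev = z,
         s_w = (if c then z else w), s_w_prev = w,
         s_y = y_new, s_y_prev = y, s_y_f = y_c + \<tau> *\<^sub>R (y_new - y),
         s_x = x - A (\<eta>x *\<^sub>R \<Delta>x + mm), s_x_f = x_c - \<theta> *\<^sub>R A (y_c + x_c),
         s_m = \<eta>x *\<^sub>R \<Delta>x + mm - A (\<eta>x *\<^sub>R \<Delta>x + mm)\<rparr>)"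

definition batch_pmf :: "nat \<Rightarrow> nat \<Rightarrow> nat \<Rightarrow> (nat \<times> nat \<Rightarrow> nat) pmf" where
  "batch_pmf M n b = Pi_pmf ({..<M} \<times> {..<b}) 0 (\<lambda>_. pmf_of_set {..<n})"

text \<open>The distribution of the state after \<open>k\<close> iterations from the state \<open>s0\<close>.\<close>

primrec alg_pmf ::
    "nat \<Rightarrow> nat \<Rightarrow> nat \<Rightarrow> (nat \<Rightarrow> nat \<Rightarrow> real fvec \<Rightarrow> real fvec) \<Rightarrow> (real fvec \<Rightarrow> ereal) \<Rightarrow>
     (nat \<Rightarrow> real mat) \<Rightarrow> alg_params \<Rightarrow> alg_state \<Rightarrow> nat \<Rightarrow> alg_state pmf" where
  "alg_pmf d M n F g W P s0 0 = return_pmf s0"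
| "alg_pmf d M n F g W P s0 (Suc k) =
     do {
       s \<leftarrow> alg_pmf d M n F g W P s0 k;
       J \<leftarrow> batch_pmf M n (p_batch P);
       J' \<leftarrow> batch_pmf M n (p_batch P);
       c \<leftarrow> bernoulli_pmf (p_prob P);
       return_pmf (alg_update d M n F g W P k J J' c s)
     }"

end

theory Submission
  imports Defs
begin

text \<open>
  Write \<open>P\<close> for the projection onto \<open>\<L>\<^sup>\<bottom>\<close>. The variational inequality on the consensus subspace gives the
  subgradient \<open>P F(z\<^sup>*) - F(z\<^sup>*)\<close> of the lifted \<open>g\<close> at \<open>z\<^sup>*\<close>, so that \<open>z\<^sup>*\<close>, \<open>x\<^sup>* = - P F(z\<^sup>*)\<close> and
  \<open>y\<^sup>* = - \<nu> z\<^sup>* - x\<^sup>*\<close> form a fixed point of the deterministic algorithm. The primal step is a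
  variance-reduced optimistic step, the pair \<open>(y, x)\<close> performs an accelerated step for
  \<open>\<parallel>y + x\<parallel>\<^sup>2 / (2 \<nu>)\<close> in which the gossip matrix replaces \<open>P\<close>, and the error feedback is absorbed by
  working with \<open>x - P m\<close>, for which one step is an exact gradient step. Adding the inequalities of the three
  steps, the coupling terms cancel and a potential that dominates \<open>\<parallel>z\<^sup>k - z\<^sup>*\<parallel>\<^sup>2\<close> contracts in expectation by the
  factor \<open>\<alpha>\<close>; the parameters are chosen so that \<open>1 / (1 - \<alpha>)\<close> is at most \<open>900\<close> times the claimed complexity.
\<close>

section \<open>One step of the algorithm\<close>

text \<open>The gossip matrices are not assumed symmetric; what is used of them is the contraction
  on vectors of sum zero, and it acts twice. Expanded as a square it bounds
  \<open>inner u (A t u)\<close> from below, which replaces descent along the exact projection;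
  applied directly it shrinks the error memory. One step has three independent sources of
  randomness: two batches and the reset of \<open>w\<close>. The one-step inequality is pathwise,
  with one error bracket for each source, and each bracket has nonpositive mean. The first batch is
  paid by reserves that the previous step left in the potential (squares of
  \<open>z - w_prev\<close> and \<open>z - z_prev\<close>), the second by half of the square of
  \<open>w - z_new\<close>, and the reset balances exactly. The potential contains products of
  indefinite sign, so its lower bound is a separate fact. Another obstacle is that
  \<open>prox\<close> merely chooses a minimiser: one has to exist before the primal step says
  anything. The affine lower bound needed for existence comes from the variational inequality
  itself.\<close>

lemma young:
  fixes a b :: "'a::real_inner"
  assumes "c > 0"
  shows "2 * inner a b \<le> c * (norm a)\<^sup>2 + (norm b)\<^sup>2 / c"
proof -
  have "(norm (c *\<^sub>R a - b))\<^sup>2 = c\<^sup>2 * (norm a)\<^sup>2 + (norm b)\<^sup>2 - 2 * c * inner a b"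
    by (simp only: power2_norm_eq_inner)
      (simp add: inner_simps inner_commute[of b a] power2_eq_square algebra_simps)
  then have "0 \<le> (c\<^sup>2 * (norm a)\<^sup>2 + (norm b)\<^sup>2 - 2 * c * inner a b) / c"
    using assms by (metis divide_nonneg_pos zero_le_power2)
  then show ?thesis using assms by (simp add: field_simps power2_eq_square)
qed

lemma norm_add_sq_le:
  fixes a b :: "'a::real_inner"
  shows "(norm (a + b))\<^sup>2 \<le> 2 * (norm a)\<^sup>2 + 2 * (norm b)\<^sup>2"
  using young[of 1 a b] by (simp add: power2_norm_eq_inner inner_simps inner_commute[of b a])

lemma norm_diff_sq_le:
  fixes a b :: "'a::real_inner"
  shows "(norm (a - b))\<^sup>2 \<le> 2 * (norm a)\<^sup>2 + 2 * (norm b)\<^sup>2"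
  using norm_add_sq_le[of a "- b"] by simp

lemma abs_inner_le_mult:
  fixes a b :: "'a::real_inner"
  assumes "norm a \<le> L * c" "c \<ge> 0" "L \<ge> 0"
  shows "2 * \<bar>inner a b\<bar> \<le> L * (c\<^sup>2 + (norm b)\<^sup>2)"
proof -
  have "2 * \<bar>inner a b\<bar> \<le> 2 * (norm a * norm b)"
    using Cauchy_Schwarz_ineq2[of a b] by simp
  also have "\<dots> \<le> 2 * (L * c * norm b)"
    using assms by (intro mult_left_mono mult_right_mono) auto
  also have "\<dots> = L * (2 * c * norm b)" by simp
  also have "\<dots> \<le> L * (c\<^sup>2 + (norm b)\<^sup>2)"
    using assms(3) sum_squares_bound[of c "norm b"] by (intro mult_left_mono) auto
  finally show ?thesis .
qed

text \<open>
  In the lemmas on a single step all variables are deviations from the fixed point. A prime marks the next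
  iterate, a trailing \<open>p\<close> the previous one; \<open>f\<close>, \<open>fp\<close> and \<open>f'\<close> are the corresponding values of \<open>F\<close>.
\<close>

lemma primal_step:
  fixes Z :: "'a::real_inner"
  assumes prox: "0 \<le> inner (Z + \<omega> *\<^sub>R (W - Z) - e *\<^sub>R D - Z') Z'"
    and D: "D = f + \<alpha> *\<^sub>R (f - fp) + \<xi> - \<nu> *\<^sub>R Z - Y - \<alpha> *\<^sub>R (Y - Yp)"
    and mono: "\<mu> * (norm Z')\<^sup>2 \<le> inner f' Z'"
    and lip: "norm (f' - f) \<le> L * norm (Z' - Z)" "norm (f - fp) \<le> L * norm (Z - Zp)"
    and par: "e > 0" "h > 0" "0 \<le> \<alpha>" "\<alpha> \<le> 1" "0 \<le> \<omega>" "\<omega> \<le> 1/16" "L > 0" "e * L \<le> 1/8"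
      "32 * e * h \<le> 1" "\<nu> = \<mu> / 4" "0 < \<mu>" "\<mu> \<le> L"
  shows "(1/e + 5 * \<mu> / 4) * (norm Z')\<^sup>2 - 2 * inner (f' - f) Z' + 2 * inner (Y' - Y) Z' - 2 * inner Y' Z'
      + 3 / (8 * e) * (norm (Z' - Z))\<^sup>2 + \<omega> / e * (norm (W - Z'))\<^sup>2
    \<le> (1 - \<omega>) / e * (norm Z)\<^sup>2 + \<omega> / e * (norm W)\<^sup>2 - 2 * \<alpha> * inner (f - fp) Z
      + 2 * \<alpha> * inner (Y - Yp) Z + \<alpha> / (8 * e) * (norm (Z - Zp))\<^sup>2
      + \<alpha> / (4 * h) * (norm (Y - Yp))\<^sup>2 + 4 * e * (norm \<xi>)\<^sup>2 - 2 * inner \<xi> Z"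
proof -
  define i where "i = 1 / e"
  have i: "i > 0" using par by (simp add: i_def)
  have Li: "L \<le> i / 8" using par(1,8) by (simp add: i_def field_simps)
  have hi: "8 * e \<le> 1 / (4 * h)" using par(1,2,9) by (simp add: field_simps)
  have id1: "2 * inner (Z + \<omega> *\<^sub>R (W - Z) - e *\<^sub>R D - Z') Z' =
     (1 - \<omega>) * (norm Z)\<^sup>2 - (norm Z')\<^sup>2 + \<omega> * (norm W)\<^sup>2 - (1 - \<omega>) * (norm (Z' - Z))\<^sup>2
      - \<omega> * (norm (W - Z'))\<^sup>2 - e * (2 * inner D Z')"
    by (simp add: power2_norm_eq_inner inner_simps inner_commute[of Z' Z] inner_commute[of Z' W]
        inner_commute[of Z W] algebra_simps)
  have "0 \<le> i * (2 * inner (Z + \<omega> *\<^sub>R (W - Z) - e *\<^sub>R D - Z') Z')"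
    using prox i by simp
  then have "0 \<le> i * ((1 - \<omega>) * (norm Z)\<^sup>2 - (norm Z')\<^sup>2 + \<omega> * (norm W)\<^sup>2 - (1 - \<omega>) * (norm (Z' - Z))\<^sup>2
      - \<omega> * (norm (W - Z'))\<^sup>2) - i * (e * (2 * inner D Z'))"
    unfolding id1 by (simp only: right_diff_distrib)
  moreover have ie: "i * (e * (2 * inner D Z')) = 2 * inner D Z'"
    using par(1) by (simp add: i_def)
  ultimately have "0 \<le> i * ((1 - \<omega>) * (norm Z)\<^sup>2 - (norm Z')\<^sup>2 + \<omega> * (norm W)\<^sup>2 - (1 - \<omega>) * (norm (Z' - Z))\<^sup>2
      - \<omega> * (norm (W - Z'))\<^sup>2) - 2 * inner D Z'"
    by (simp only: ie)
  then have 1: "0 \<le> (1 - \<omega>) * i * (norm Z)\<^sup>2 - i * (norm Z')\<^sup>2 + \<omega> * i * (norm W)\<^sup>2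
      - (1 - \<omega>) * (i * (norm (Z' - Z))\<^sup>2) - \<omega> * i * (norm (W - Z'))\<^sup>2 - 2 * inner D Z'"
    by (simp add: algebra_simps)
  \<comment> \<open>The extrapolated differences are tested at the old point \<open>Z\<close>, where
    they reproduce \<alpha> times products already in the potential; the remainder against
    \<open>Z' - Z\<close> is left to Young's inequality. The new differences are tested at
    \<open>Z'\<close>, ready for the next step.\<close>
  have id2: "2 * inner D Z' = 2 * inner f' Z' - 2 * inner (f' - f) Z' + 2 * \<alpha> * inner (f - fp) Z
      + \<alpha> * (2 * inner (f - fp) (Z' - Z)) + 2 * inner \<xi> Z + 2 * inner \<xi> (Z' - Z) - 2 * \<nu> * (norm Z')\<^sup>2
      + \<nu> * (2 * inner (Z' - Z) Z') - 2 * inner Y' Z' + 2 * inner (Y' - Y) Z'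
      - 2 * \<alpha> * inner (Y - Yp) Z - \<alpha> * (2 * inner (Y - Yp) (Z' - Z))"
    unfolding D by (simp add: power2_norm_eq_inner inner_simps algebra_simps)
  have y1: "- (2 * inner (f - fp) (Z' - Z)) \<le> i / 8 * ((norm (Z - Zp))\<^sup>2 + (norm (Z' - Z))\<^sup>2)"
  proof -
    have "2 * \<bar>inner (f - fp) (Z' - Z)\<bar> \<le> L * ((norm (Z - Zp))\<^sup>2 + (norm (Z' - Z))\<^sup>2)"
      using par by (intro abs_inner_le_mult lip(2)) auto
    also have "\<dots> \<le> i / 8 * ((norm (Z - Zp))\<^sup>2 + (norm (Z' - Z))\<^sup>2)"
      using Li by (intro mult_right_mono) auto
    finally show ?thesis by linarith
  qed
  have y1': "- (\<alpha> * (2 * inner (f - fp) (Z' - Z))) \<le> \<alpha> * i / 8 * (norm (Z - Zp))\<^sup>2 + i / 8 * (norm (Z' - Z))\<^sup>2"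
  proof -
    have "- (\<alpha> * (2 * inner (f - fp) (Z' - Z))) \<le> \<alpha> * (i / 8 * ((norm (Z - Zp))\<^sup>2 + (norm (Z' - Z))\<^sup>2))"
      using mult_left_mono[OF y1 par(3)] by simp
    also have "\<dots> = \<alpha> * i / 8 * (norm (Z - Zp))\<^sup>2 + \<alpha> * (i / 8 * (norm (Z' - Z))\<^sup>2)"
      by (simp add: algebra_simps)
    also have "\<alpha> * (i / 8 * (norm (Z' - Z))\<^sup>2) \<le> i / 8 * (norm (Z' - Z))\<^sup>2"
      using par(4) i by (intro mult_left_le_one_le) (auto simp: par(3))
    finally show ?thesis by simp
  qed
  have y2: "\<alpha> * (2 * inner (Y - Yp) (Z' - Z)) \<le> \<alpha> / (4 * h) * (norm (Y - Yp))\<^sup>2 + i / 8 * (norm (Z' - Z))\<^sup>2"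
  proof -
    have "2 * inner (Y - Yp) (Z' - Z) \<le> 8 * e * (norm (Y - Yp))\<^sup>2 + (norm (Z' - Z))\<^sup>2 / (8 * e)"
      using par by (intro young) auto
    also have "8 * e * (norm (Y - Yp))\<^sup>2 \<le> 1 / (4 * h) * (norm (Y - Yp))\<^sup>2"
      by (intro mult_right_mono hi) auto
    finally have "\<alpha> * (2 * inner (Y - Yp) (Z' - Z)) \<le> \<alpha> * (1 / (4 * h) * (norm (Y - Yp))\<^sup>2 + (norm (Z' - Z))\<^sup>2 / (8 * e))"
      using par(3) by (intro mult_left_mono) auto
    also have "\<dots> = \<alpha> / (4 * h) * (norm (Y - Yp))\<^sup>2 + \<alpha> * (i / 8 * (norm (Z' - Z))\<^sup>2)"
      by (simp add: algebra_simps i_def)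
    also have "\<alpha> * (i / 8 * (norm (Z' - Z))\<^sup>2) \<le> i / 8 * (norm (Z' - Z))\<^sup>2"
      using par(4) i by (intro mult_left_le_one_le) (auto simp: par(3))
    finally show ?thesis by simp
  qed
  have y3: "- (2 * inner \<xi> (Z' - Z)) \<le> 4 * e * (norm \<xi>)\<^sup>2 + i / 4 * (norm (Z' - Z))\<^sup>2"
    using young[of "4 * e" "- \<xi>" "Z' - Z"] par(1) by (simp add: i_def)
  have y4: "- (\<nu> * (2 * inner (Z' - Z) Z')) \<le> \<mu> / 4 * (norm Z')\<^sup>2 + i / 32 * (norm (Z' - Z))\<^sup>2"
  proof -
    have "- (2 * inner (Z' - Z) Z') \<le> (norm (Z' - Z))\<^sup>2 + (norm Z')\<^sup>2"
      using young[of 1 "Z - Z'" Z'] by (simp add: inner_simps norm_minus_commute)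
    then have "\<nu> * - (2 * inner (Z' - Z) Z') \<le> \<nu> * ((norm (Z' - Z))\<^sup>2 + (norm Z')\<^sup>2)"
      using par by (intro mult_left_mono) auto
    moreover have "\<nu> * (norm (Z' - Z))\<^sup>2 \<le> i / 32 * (norm (Z' - Z))\<^sup>2"
      using par Li by (intro mult_right_mono) auto
    moreover have "\<nu> * (norm Z')\<^sup>2 = \<mu> / 4 * (norm Z')\<^sup>2" using par(10) by simp
    ultimately show ?thesis by (simp only: distrib_left mult_minus_right)
  qed
  have y5: "15 / 16 * (i * (norm (Z' - Z))\<^sup>2) \<le> (1 - \<omega>) * (i * (norm (Z' - Z))\<^sup>2)"
    using par(6) i by (intro mult_right_mono) auto
  have n2: "2 * \<nu> * (norm Z')\<^sup>2 = \<mu> / 2 * (norm Z')\<^sup>2" using par by simp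
  have nn: "0 \<le> i * (norm (Z' - Z))\<^sup>2" using i by simp
  \<comment> \<open>Budget for the square of \<open>Z' - Z\<close> in units of \<open>i\<close>:
    15/16 available, 1/8 + 1/8 + 1/4 + 1/32 spent, so 3/8 remains. For the square of
    \<open>Z'\<close>: monotonicity gives \<open>2 * \<mu>\<close>, and subtracting
    \<open>\<mu> / 2\<close> and \<open>\<mu> / 4\<close> leaves
    \<open>5 * \<mu> / 4\<close>.\<close>
  have "(i + 5 * \<mu> / 4) * (norm Z')\<^sup>2 - 2 * inner (f' - f) Z' + 2 * inner (Y' - Y) Z' - 2 * inner Y' Z'
      + 3 / 8 * i * (norm (Z' - Z))\<^sup>2 + \<omega> * i * (norm (W - Z'))\<^sup>2
    \<le> (1 - \<omega>) * i * (norm Z)\<^sup>2 + \<omega> * i * (norm W)\<^sup>2 - 2 * \<alpha> * inner (f - fp) Z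
      + 2 * \<alpha> * inner (Y - Yp) Z + \<alpha> * i / 8 * (norm (Z - Zp))\<^sup>2
      + \<alpha> / (4 * h) * (norm (Y - Yp))\<^sup>2 + 4 * e * (norm \<xi>)\<^sup>2 - 2 * inner \<xi> Z"
    using 1 id2 y1' y2 y3 y4 y5 mono n2 nn by (simp only: distrib_right distrib_left)
  then show ?thesis by (simp add: i_def field_simps)
qed

text \<open>The damping term with \<gamma> produces the decay of \<open>Y\<close>. The products with
  \<open>U\<close> and \<open>Z'\<close> are kept exact because the accelerated and the primal step
  contain them with the opposite sign; the squares of \<open>X\<close> and \<open>Z\<close> on the
  right are debts settled by \<open>gossip_step\<close> and by the strong monotonicity.\<close>

lemma dual_step:
  fixes Y :: "'a::real_inner"
  assumes Y': "Y' = Y - h *\<^sub>R (inverse \<nu> *\<^sub>R U + Z' + \<gamma> *\<^sub>R (Y + X + \<nu> *\<^sub>R Z))"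
    and par: "h > 0" "\<gamma> > 0" "4 * h * \<gamma> \<le> 1"
  shows "1 / h * (norm Y')\<^sup>2 + 3 / (4 * h) * (norm (Y' - Y))\<^sup>2
    \<le> (1 / h - \<gamma>) * (norm Y)\<^sup>2 - 2 / \<nu> * inner U Y' - 2 * inner Z' Y' + 2 * \<gamma> * (norm X)\<^sup>2
      + 4 * \<gamma> * \<nu>\<^sup>2 * (norm Z)\<^sup>2"
proof -
  define i where "i = 1 / h"
  have i: "i > 0" using par by (simp add: i_def)
  have gi: "\<gamma> \<le> i / 4" using par by (simp add: i_def field_simps)
  have d: "i *\<^sub>R (Y' - Y) = - (inverse \<nu> *\<^sub>R U + Z' + \<gamma> *\<^sub>R (Y + X + \<nu> *\<^sub>R Z))"
    unfolding Y' i_def using par by simp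
  have "i * (norm Y')\<^sup>2 = i * (norm Y)\<^sup>2 + 2 * inner (i *\<^sub>R (Y' - Y)) Y' - i * (norm (Y' - Y))\<^sup>2"
    by (simp add: power2_norm_eq_inner inner_simps inner_commute[of Y' Y] algebra_simps)
  also have "2 * inner (i *\<^sub>R (Y' - Y)) Y' =
     - (2 / \<nu> * inner U Y') - 2 * inner Z' Y' - \<gamma> * (2 * inner Y Y') - \<gamma> * (2 * inner X Y') - \<gamma> * (2 * inner (\<nu> *\<^sub>R Z) Y')"
    unfolding d by (simp add: inner_simps algebra_simps divide_inverse)
  also have "2 * inner Y Y' = (norm Y)\<^sup>2 + (norm Y')\<^sup>2 - (norm (Y' - Y))\<^sup>2"
    by (simp add: power2_norm_eq_inner inner_simps inner_commute[of Y' Y])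
  finally have 1: "i * (norm Y')\<^sup>2 = i * (norm Y)\<^sup>2 + (- (2 / \<nu> * inner U Y') - 2 * inner Z' Y'
      - \<gamma> * ((norm Y)\<^sup>2 + (norm Y')\<^sup>2 - (norm (Y' - Y))\<^sup>2) - \<gamma> * (2 * inner X Y')
      - \<gamma> * (2 * inner (\<nu> *\<^sub>R Z) Y')) - i * (norm (Y' - Y))\<^sup>2" .
  have "- (2 * inner X Y') \<le> 2 * (norm X)\<^sup>2 + (norm Y')\<^sup>2 / 2"
    using young[of 2 "- X" Y'] by simp
  then have 2: "\<gamma> * - (2 * inner X Y') \<le> \<gamma> * (2 * (norm X)\<^sup>2 + (norm Y')\<^sup>2 / 2)"
    using par by (intro mult_left_mono) auto
  have "- (2 * inner (\<nu> *\<^sub>R Z) Y') \<le> 4 * (\<nu>\<^sup>2 * (norm Z)\<^sup>2) + (norm Y')\<^sup>2 / 4"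
    using young[of 4 "- (\<nu> *\<^sub>R Z)" Y'] by (simp add: power_mult_distrib)
  then have 3: "\<gamma> * - (2 * inner (\<nu> *\<^sub>R Z) Y') \<le> \<gamma> * (4 * (\<nu>\<^sup>2 * (norm Z)\<^sup>2) + (norm Y')\<^sup>2 / 4)"
    using par by (intro mult_left_mono) auto
  have 4: "\<gamma> * (norm (Y' - Y))\<^sup>2 \<le> i / 4 * (norm (Y' - Y))\<^sup>2"
    by (intro mult_right_mono gi) auto
  have 5: "0 \<le> \<gamma> * (norm Y')\<^sup>2" using par by simp
  have "i * (norm Y')\<^sup>2 + 3 / 4 * i * (norm (Y' - Y))\<^sup>2
    \<le> (i - \<gamma>) * (norm Y)\<^sup>2 - 2 / \<nu> * inner U Y' - 2 * inner Z' Y' + 2 * \<gamma> * (norm X)\<^sup>2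
      + 4 * \<gamma> * \<nu>\<^sup>2 * (norm Z)\<^sup>2"
    using 1 2 3 4 5 by (simp add: algebra_simps)
  then show ?thesis by (simp add: i_def field_simps)
qed

text \<open>
  \<open>U\<close> is \<open>y\<^sub>c + x\<^sub>c\<close>, \<open>V\<close> is \<open>y\<^sub>f + x\<^sub>f\<close>, \<open>G\<close> is the gossiped vector \<open>A U\<close> and \<open>PU\<close> the projection of \<open>U\<close>. With
  the step \<open>\<theta> = 1/2\<close> the term \<open>\<parallel>G\<parallel>\<^sup>2 / 4\<close> is left over; it absorbs the product of \<open>G\<close> with \<open>Y' - Y\<close>, which
  Young's inequality against the gain in \<open>\<parallel>PU\<parallel>\<^sup>2\<close> could only bound with an additional factor \<open>chi\<close>.
\<close>

lemma accelerated_step: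
  fixes U :: "'a::real_inner"
  assumes U: "U = \<tau> *\<^sub>R (Y + X) + (1 - \<tau>) *\<^sub>R V"
    and V': "V' = U + \<tau> *\<^sub>R (Y' - Y) - (1/2) *\<^sub>R G"
    and G: "s / 2 * (norm PU)\<^sup>2 + (norm G)\<^sup>2 / 2 \<le> inner U G"
    and par: "0 < \<tau>" "\<tau> \<le> 1" "\<nu> > 0"
  shows "1 / (\<nu> * \<tau>) * (norm V')\<^sup>2 + s / (2 * \<nu> * \<tau>) * (norm PU)\<^sup>2
    \<le> (1 - \<tau>) / (\<nu> * \<tau>) * (norm V)\<^sup>2 + 2 * \<tau> / \<nu> * (norm (Y' - Y))\<^sup>2 + 2 / \<nu> * inner U Y' + 2 / \<nu> * inner U X"
proof -
  have e1: "(norm V')\<^sup>2 = (norm U)\<^sup>2 - inner U G + (norm G)\<^sup>2 / 4 + 2 * \<tau> * inner U (Y' - Y)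
     - inner G (\<tau> *\<^sub>R (Y' - Y)) + \<tau>\<^sup>2 * (norm (Y' - Y))\<^sup>2"
    unfolding V' by (simp only: power2_norm_eq_inner) (simp add: inner_simps inner_commute[of Y' U]
        inner_commute[of Y U] inner_commute[of Y' G] inner_commute[of Y G] inner_commute[of G U]
        inner_commute[of Y' Y] power2_eq_square algebra_simps)
  have "- inner G (\<tau> *\<^sub>R (Y' - Y)) \<le> (norm G)\<^sup>2 / 4 + \<tau>\<^sup>2 * (norm (Y' - Y))\<^sup>2"
    using young[of "1/2" "- G" "\<tau> *\<^sub>R (Y' - Y)"] by (simp add: power_mult_distrib)
  with e1 G have 1: "(norm V')\<^sup>2 + s / 2 * (norm PU)\<^sup>2 \<le> (norm U)\<^sup>2 + 2 * \<tau> * inner U (Y' - Y) + 2 * \<tau>\<^sup>2 * (norm (Y' - Y))\<^sup>2"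
    by simp
  \<comment> \<open>Pairing the definition of \<open>U\<close> with \<open>U\<close> itself replaces
    the product with \<open>Y\<close> by one with \<open>X\<close>, which \<open>gossip_step\<close>
    cancels, and turns the square of \<open>U\<close> into \<open>(1 - \<tau>)\<close> times that of
    \<open>V\<close>.\<close>
  have e2: "\<tau> * inner U (Y + X) = (norm U)\<^sup>2 - (1 - \<tau>) * inner U V"
    using arg_cong[OF U, of "inner U"] by (simp add: power2_norm_eq_inner inner_simps)
  have "2 * inner U V \<le> (norm U)\<^sup>2 + (norm V)\<^sup>2" using young[of 1 U V] by simp
  then have "(1 - \<tau>) * (2 * inner U V) \<le> (1 - \<tau>) * ((norm U)\<^sup>2 + (norm V)\<^sup>2)"
    using par by (intro mult_left_mono) auto
  moreover have "0 \<le> \<tau> * (norm U)\<^sup>2" using par by simp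
  ultimately have "(norm V')\<^sup>2 + s / 2 * (norm PU)\<^sup>2 \<le> (1 - \<tau>) * (norm V)\<^sup>2 + 2 * \<tau> * inner U Y' + 2 * \<tau> * inner U X
      + 2 * \<tau>\<^sup>2 * (norm (Y' - Y))\<^sup>2"
    using 1 e2 by (simp add: inner_simps algebra_simps)
  then have "1 / (\<nu> * \<tau>) * ((norm V')\<^sup>2 + s / 2 * (norm PU)\<^sup>2) \<le> 1 / (\<nu> * \<tau>) * ((1 - \<tau>) * (norm V)\<^sup>2 + 2 * \<tau> * inner U Y' + 2 * \<tau> * inner U X
      + 2 * \<tau>\<^sup>2 * (norm (Y' - Y))\<^sup>2)"
    using par by (intro mult_left_mono) auto
  also have "\<dots> = (1 - \<tau>) / (\<nu> * \<tau>) * (norm V)\<^sup>2 + 2 * \<tau> / \<nu> * (norm (Y' - Y))\<^sup>2 + 2 / \<nu> * inner U Y' + 2 / \<nu> * inner U X"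
    using par by (simp add: field_simps power2_eq_square)
  finally show ?thesis by (simp add: algebra_simps)
qed

text \<open>
  \<open>n = P m\<close> is the projected error memory and \<open>G\<close> the projection of \<open>\<Delta>\<^sub>x\<close>: the corrected iterate
  \<open>X - n\<close> performs an exact gradient step, while the memory itself is only contracted.
\<close>

lemma gossip_step:
  fixes X :: "'a::real_inner"
  assumes G: "G = inverse \<nu> *\<^sub>R Q + (5 * \<gamma>) *\<^sub>R (X + \<Phi> + \<xi>)"
    and X'': "X'' = X - n - \<eta> *\<^sub>R G"
    and n': "(norm n')\<^sup>2 \<le> (1 - inverse chi) * (norm (\<eta> *\<^sub>R G + n))\<^sup>2"
    and \<Phi>: "(norm \<Phi>)\<^sup>2 \<le> L\<^sup>2 * z"
    and par: "\<eta> > 0" "\<gamma> > 0" "chi \<ge> 1" "900 * chi * \<gamma> * \<eta> \<le> 1" "36 * \<tau> * chi\<^sup>2 * \<eta> \<le> \<nu>" "\<nu> > 0" "\<tau> > 0"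
      "16 * L\<^sup>2 * \<gamma> \<le> \<mu>" "\<mu> \<ge> 0" "z \<ge> 0"
  shows "1 / \<eta> * (norm X'')\<^sup>2 + 2 / \<eta> * (norm n')\<^sup>2
    \<le> (1 / \<eta> - \<gamma>) * (norm (X - n))\<^sup>2 + 2 / \<eta> * (1 - 1 / (4 * chi)) * (norm n)\<^sup>2 - 2 / \<nu> * inner Q X
      + inverse chi / (2 * \<nu> * \<tau>) * (norm Q)\<^sup>2 - 2 * \<gamma> * (norm X)\<^sup>2 + \<mu> / 2 * z
      + 6 / 5 * \<gamma> * (norm \<xi>)\<^sup>2 - 10 * \<gamma> * inner \<xi> X"
proof -
  define i where "i = 1 / \<eta>"
  define s where "s = inverse chi"
  have i: "i > 0" and s: "s > 0" "s \<le> 1" "s * chi = 1"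
    using par(1,3) by (auto simp: i_def s_def inverse_le_1_iff)
  have gi: "\<gamma> \<le> s * i / 900" using par(1,3,4) by (simp add: i_def s_def field_simps)
  have ie: "i * (\<eta> * x) = x" for x using par(1) by (simp add: i_def)
  have X1: "i * (norm X'')\<^sup>2 = i * (norm (X - n))\<^sup>2 - 2 * inner G X + 2 * inner G n + \<eta> * (norm G)\<^sup>2"
  proof -
    have "(norm X'')\<^sup>2 = (norm (X - n))\<^sup>2 - \<eta> * (2 * inner G (X - n)) + \<eta> * (\<eta> * (norm G)\<^sup>2)"
      unfolding X'' by (simp only: power2_norm_eq_inner)
        (simp add: inner_simps inner_commute[of X G] inner_commute[of n G] algebra_simps)
    then have "i * (norm X'')\<^sup>2 = i * (norm (X - n))\<^sup>2 - i * (\<eta> * (2 * inner G (X - n))) + i * (\<eta> * (\<eta> * (norm G)\<^sup>2))"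
      by (simp only: right_diff_distrib distrib_left)
    then show ?thesis by (simp only: ie) (simp add: inner_simps)
  qed
  have X2: "2 * inner G n \<le> 5 / 2 * chi * \<eta> * (norm G)\<^sup>2 + 2 / 5 * (s * i) * (norm n)\<^sup>2"
  proof -
    have c: "5 / 2 * chi * \<eta> > 0" using par(1,3) by simp
    have eq: "(norm n)\<^sup>2 / (5 / 2 * chi * \<eta>) = 2 / 5 * (s * i) * (norm n)\<^sup>2"
      by (simp add: i_def s_def field_simps)
    show ?thesis using young[OF c, of G n] unfolding eq .
  qed
  \<comment> \<open>The Young weight \<open>2 * chi\<close> spends half of the contraction rate
    \<open>s\<close>: the memory still decays by \<open>1 - s / 2\<close>, at a price of order
    \<open>chi\<close> on the gradient.\<close>
  have X3: "2 * i * (norm n')\<^sup>2 \<le> 2 * i * (1 - s / 2) * (norm n)\<^sup>2 + (4 * chi - 2) * \<eta> * (norm G)\<^sup>2"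
  proof -
    have "(norm (\<eta> *\<^sub>R G + n))\<^sup>2 = \<eta>\<^sup>2 * (norm G)\<^sup>2 + (norm n)\<^sup>2 + 2 * inner (\<eta> *\<^sub>R G) n"
      by (simp only: power2_norm_eq_inner) (simp add: inner_simps inner_commute[of n G] power2_eq_square algebra_simps)
    also have "2 * inner (\<eta> *\<^sub>R G) n \<le> 2 * chi * (\<eta>\<^sup>2 * (norm G)\<^sup>2) + s / 2 * (norm n)\<^sup>2"
    proof -
      have c: "2 * chi > 0" using par(3) by simp
      have eq: "(norm n)\<^sup>2 / (2 * chi) = s / 2 * (norm n)\<^sup>2"
        by (simp add: s_def field_simps)
      show ?thesis
        using young[OF c, of "\<eta> *\<^sub>R G" n] unfolding eq by (simp add: power_mult_distrib)
    qed
    finally have "(norm (\<eta> *\<^sub>R G + n))\<^sup>2 \<le> (1 + 2 * chi) * (\<eta>\<^sup>2 * (norm G)\<^sup>2) + (1 + s / 2) * (norm n)\<^sup>2"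
      by (simp add: algebra_simps)
    then have "(norm n')\<^sup>2 \<le> (1 - s) * ((1 + 2 * chi) * (\<eta>\<^sup>2 * (norm G)\<^sup>2) + (1 + s / 2) * (norm n)\<^sup>2)"
      using s by (intro order_trans[OF n'[folded s_def]] mult_left_mono) auto
    also have "\<dots> = ((1 - s) * (1 + 2 * chi)) * (\<eta>\<^sup>2 * (norm G)\<^sup>2) + ((1 - s) * (1 + s / 2)) * (norm n)\<^sup>2"
      by (simp add: algebra_simps)
    also have "\<dots> \<le> (2 * chi - 1) * (\<eta>\<^sup>2 * (norm G)\<^sup>2) + (1 - s / 2) * (norm n)\<^sup>2"
    proof (intro add_mono mult_right_mono)
      show "(1 - s) * (1 + 2 * chi) \<le> 2 * chi - 1" using s by (simp add: algebra_simps)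
      show "(1 - s) * (1 + s / 2) \<le> 1 - s / 2" using s by (simp add: algebra_simps)
    qed auto
    finally have "2 * i * (norm n')\<^sup>2 \<le> 2 * i * ((2 * chi - 1) * (\<eta>\<^sup>2 * (norm G)\<^sup>2) + (1 - s / 2) * (norm n)\<^sup>2)"
      using i by (intro mult_left_mono) auto
    also have "\<dots> = 2 * i * (1 - s / 2) * (norm n)\<^sup>2 + 2 * ((2 * chi - 1) * (i * (\<eta> * (\<eta> * (norm G)\<^sup>2))))"
      by (simp add: algebra_simps power2_eq_square)
    also have "\<dots> = 2 * i * (1 - s / 2) * (norm n)\<^sup>2 + (4 * chi - 2) * \<eta> * (norm G)\<^sup>2"
      by (simp only: ie) (simp add: algebra_simps)
    finally show ?thesis .
  qed
  \<comment> \<open>Both bounds on \<eta> act here: the one with 36 keeps the \<open>Q\<close> part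
    below the gain of \<open>accelerated_step\<close>, the one with 900 gives 7 * 150 / 900 < 6/5.
    The factor \<open>7 * chi\<close> covers 1 from \<open>X1\<close>, \<open>5/2 * chi\<close> from
    \<open>X2\<close> and \<open>4 * chi - 2\<close> from \<open>X3\<close>.\<close>
  have G2: "7 * chi * \<eta> * (norm G)\<^sup>2 \<le> s / (2 * \<nu> * \<tau>) * (norm Q)\<^sup>2
      + 6 / 5 * \<gamma> * ((norm X)\<^sup>2 + (norm \<Phi>)\<^sup>2 + (norm \<xi>)\<^sup>2)"
  proof -
    have "(norm (X + \<Phi> + \<xi>))\<^sup>2 \<le> 3 * ((norm X)\<^sup>2 + (norm \<Phi>)\<^sup>2 + (norm \<xi>)\<^sup>2)"
      using young[of 1 X \<Phi>] young[of 1 X \<xi>] young[of 1 \<Phi> \<xi>]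
      by (simp only: power2_norm_eq_inner)
        (simp add: inner_simps inner_commute[of \<Phi> X] inner_commute[of \<xi> X] inner_commute[of \<xi> \<Phi>])
    then have "25 * \<gamma>\<^sup>2 * (norm (X + \<Phi> + \<xi>))\<^sup>2 \<le> 25 * \<gamma>\<^sup>2 * (3 * ((norm X)\<^sup>2 + (norm \<Phi>)\<^sup>2 + (norm \<xi>)\<^sup>2))"
      by (intro mult_left_mono) auto
    moreover have "(norm G)\<^sup>2 \<le> 2 * ((inverse \<nu>)\<^sup>2 * (norm Q)\<^sup>2) + 2 * (25 * \<gamma>\<^sup>2 * (norm (X + \<Phi> + \<xi>))\<^sup>2)"
      using norm_add_sq_le[of "inverse \<nu> *\<^sub>R Q" "(5 * \<gamma>) *\<^sub>R (X + \<Phi> + \<xi>)"] par(6)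
      by (simp add: G power_mult_distrib)
    ultimately have "(norm G)\<^sup>2 \<le> 2 * (inverse \<nu>)\<^sup>2 * (norm Q)\<^sup>2 + 150 * \<gamma>\<^sup>2 * ((norm X)\<^sup>2 + (norm \<Phi>)\<^sup>2 + (norm \<xi>)\<^sup>2)"
      by (simp add: algebra_simps)
    then have "7 * chi * \<eta> * (norm G)\<^sup>2 \<le> 7 * chi * \<eta> * (2 * (inverse \<nu>)\<^sup>2 * (norm Q)\<^sup>2 + 150 * \<gamma>\<^sup>2 * ((norm X)\<^sup>2 + (norm \<Phi>)\<^sup>2 + (norm \<xi>)\<^sup>2))"
      using par by (intro mult_left_mono) auto
    also have "\<dots> = (14 * chi * \<eta> * (inverse \<nu>)\<^sup>2) * (norm Q)\<^sup>2 + (1050 * chi * \<eta> * \<gamma>\<^sup>2) * ((norm X)\<^sup>2 + (norm \<Phi>)\<^sup>2 + (norm \<xi>)\<^sup>2)"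
      by (simp add: algebra_simps)
    also have "\<dots> \<le> s / (2 * \<nu> * \<tau>) * (norm Q)\<^sup>2 + 6 / 5 * \<gamma> * ((norm X)\<^sup>2 + (norm \<Phi>)\<^sup>2 + (norm \<xi>)\<^sup>2)"
    proof (intro add_mono mult_right_mono)
      have "28 * \<tau> * chi\<^sup>2 * \<eta> \<le> 36 * \<tau> * chi\<^sup>2 * \<eta>" using par by (intro mult_right_mono) auto
      then have "28 * \<tau> * chi\<^sup>2 * \<eta> \<le> \<nu>" using par by linarith
      then show "14 * chi * \<eta> * (inverse \<nu>)\<^sup>2 \<le> s / (2 * \<nu> * \<tau>)"
        using par by (simp add: s_def field_simps power2_eq_square)
      have "(900 * chi * \<gamma> * \<eta>) * \<gamma> \<le> 1 * \<gamma>" using par by (intro mult_right_mono) auto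
      then show "1050 * chi * \<eta> * \<gamma>\<^sup>2 \<le> 6 / 5 * \<gamma>" using par(2) by (simp add: power2_eq_square algebra_simps)
    qed auto
    finally show ?thesis .
  qed
  have G3: "2 * inner G X = 2 / \<nu> * inner Q X + 10 * \<gamma> * (norm X)\<^sup>2 + 5 * \<gamma> * (2 * inner \<Phi> X) + 10 * \<gamma> * inner \<xi> X"
    by (simp add: G inner_simps power2_norm_eq_inner divide_inverse algebra_simps)
  have "- (2 * inner \<Phi> X) \<le> 5 / 4 * (norm \<Phi>)\<^sup>2 + 4 / 5 * (norm X)\<^sup>2"
    using young[of "5/4" "- \<Phi>" X] by simp
  then have G4: "5 * \<gamma> * - (2 * inner \<Phi> X) \<le> 5 * \<gamma> * (5 / 4 * (norm \<Phi>)\<^sup>2 + 4 / 5 * (norm X)\<^sup>2)"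
    using par by (intro mult_left_mono) auto
  have "\<gamma> * (norm \<Phi>)\<^sup>2 \<le> \<gamma> * (L\<^sup>2 * z)" using \<Phi> par by (intro mult_left_mono) auto
  also have "\<dots> = (16 * L\<^sup>2 * \<gamma>) * z / 16" by simp
  also have "\<dots> \<le> \<mu> * z / 16" using par by (intro divide_right_mono mult_right_mono) auto
  finally have G5: "\<gamma> * (norm \<Phi>)\<^sup>2 \<le> \<mu> / 16 * z" by simp
  have G6: "(6 * chi + chi / 2 - 1) * (\<eta> * (norm G)\<^sup>2) \<le> 7 * chi * (\<eta> * (norm G)\<^sup>2)"
    using par by (intro mult_right_mono) auto
  have "\<gamma> * (norm (X - n))\<^sup>2 \<le> \<gamma> * (2 * (norm X)\<^sup>2 + 2 * (norm n)\<^sup>2)"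
    using par norm_diff_sq_le by (intro mult_left_mono) auto
  then have G7: "\<gamma> * (norm (X - n))\<^sup>2 \<le> 2 * (\<gamma> * (norm X)\<^sup>2) + 2 * (\<gamma> * (norm n)\<^sup>2)"
    by (simp add: algebra_simps)
  have G8: "\<gamma> * (norm n)\<^sup>2 \<le> s * i / 900 * (norm n)\<^sup>2" by (intro mult_right_mono gi) auto
  have G9: "0 \<le> s * (i * (norm n)\<^sup>2)" "0 \<le> \<gamma> * (norm X)\<^sup>2" using s i par by auto
  have p: "0 \<le> \<mu> * z" using par by simp
  \<comment> \<open>Coefficients of \<open>\<gamma> * (norm X)\<^sup>2\<close>: -10 from
    \<open>G3\<close>, 4 from \<open>G4\<close>, 6/5 from \<open>G2\<close>, 2 from
    \<open>G7\<close>, in total below -2. The decay \<open>s * i\<close> of \<open>n\<close> loses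
    2/5 and 2/900 of itself and keeps more than 1/2. For \<Phi>, (25/4 + 6/5) / 16 < 1/2.\<close>
  have "i * (norm X'')\<^sup>2 + 2 * i * (norm n')\<^sup>2
    \<le> (i - \<gamma>) * (norm (X - n))\<^sup>2 + 2 * i * (1 - s / 4) * (norm n)\<^sup>2 - 2 / \<nu> * inner Q X
      + s / (2 * \<nu> * \<tau>) * (norm Q)\<^sup>2 - 2 * \<gamma> * (norm X)\<^sup>2 + \<mu> / 2 * z
      + 6 / 5 * \<gamma> * (norm \<xi>)\<^sup>2 - 10 * \<gamma> * inner \<xi> X"
    using X1 X2 X3 G2 G3 G4 G5 G6 G7 G8 G9 p by (simp add: algebra_simps)
  then show ?thesis by (simp add: i_def s_def field_simps)
qed

section \<open>Step sizes and the contraction factor\<close>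

text \<open>The prescriptions are circular: \<open>\<eta>z\<close> involves \<open>\<eta>y\<close>
  and \<alpha>, \<open>\<eta>y\<close> involves \<gamma>, and both \<gamma> and \<alpha> involve
  \<open>\<eta>z\<close>. They are therefore equations between given positive numbers, used through
  the bounds they imply and never solved.\<close>

locale step_sizes =
  fixes L L' \<mu> chi p \<eta>z \<eta>y \<eta>x \<alpha> \<gamma> \<tau> :: real and b :: nat
  assumes mu: "0 < \<mu>" "\<mu> \<le> L" "\<mu> \<le> L'"
    and chi: "1 \<le> chi" and b: "1 \<le> b" and p: "0 < p" "p \<le> 1 / 16"
    and eta: "0 < \<eta>z" "0 < \<eta>y" "0 < \<eta>x"
    and tau_eq: "\<tau> = min (\<mu> / (32 * L * chi)) (\<mu> * sqrt (real b * p) / (32 * L'))"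
    and etaz_eq: "\<eta>z = Min {1 / (8 * L * chi), 1 / (32 * \<eta>y), sqrt (\<alpha> * real b * p) / (8 * L')}"
    and etay_eq: "\<eta>y = min (1 / (4 * \<gamma>)) (\<mu> / 4 / (8 * \<tau>))"
    and etax_eq: "\<eta>x = min (1 / (900 * chi * \<gamma>)) (\<mu> / 4 / (36 * \<tau> * chi\<^sup>2))"
    and gamma_eq: "\<gamma> = min (\<mu> / (16 * L\<^sup>2)) (real b * p / (24 * L'\<^sup>2 * \<eta>z))"
    and alpha_eq: "\<alpha> = Max {1 - p * \<eta>z * (\<mu> / 4) / (p + \<eta>z * (\<mu> / 4)), 1 - \<eta>y * \<gamma>, 1 - \<eta>x * \<gamma>,
             1 - \<mu> * \<eta>z / 8, 1 - \<tau>, 1 - 1 / (4 * chi)}"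
begin

lemma L_pos: "0 < L" "0 < L'" using mu by auto

lemma bp_pos: "0 < real b * p" using b p by simp

lemma tau_pos: "0 < \<tau>" unfolding tau_eq using mu L_pos chi bp_pos by simp

lemma tau_le_1: "\<tau> \<le> 1"
proof -
  have "\<mu> * 1 \<le> L * (32 * chi)" using mu chi by (intro mult_mono) auto
  then have "\<mu> / (32 * L * chi) \<le> 1" using L_pos chi by (simp add: field_simps)
  then show ?thesis unfolding tau_eq by linarith
qed

lemma gamma_pos: "0 < \<gamma>"
  unfolding gamma_eq using mu L_pos eta bp_pos by simp

lemma gamma_le: "16 * L\<^sup>2 * \<gamma> \<le> \<mu>" "24 * L'\<^sup>2 * \<eta>z * \<gamma> \<le> real b * p"
proof -
  have "\<gamma> \<le> \<mu> / (16 * L\<^sup>2)" "\<gamma> \<le> real b * p / (24 * L'\<^sup>2 * \<eta>z)"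
    by (auto simp: gamma_eq)
  then show "16 * L\<^sup>2 * \<gamma> \<le> \<mu>" "24 * L'\<^sup>2 * \<eta>z * \<gamma> \<le> real b * p"
    using L_pos eta by (simp_all add: pos_le_divide_eq mult.commute)
qed

lemma etay_le: "4 * \<eta>y * \<gamma> \<le> 1" "32 * \<tau> * \<eta>y \<le> \<mu>"
proof -
  have "\<eta>y \<le> 1 / (4 * \<gamma>)" "\<eta>y \<le> \<mu> / 4 / (8 * \<tau>)"
    by (subst etay_eq, rule min.cobounded1) (subst etay_eq, rule min.cobounded2)
  then show "4 * \<eta>y * \<gamma> \<le> 1" "32 * \<tau> * \<eta>y \<le> \<mu>"
    using gamma_pos tau_pos by (simp_all add: field_simps)
qed

lemma etax_le: "900 * chi * \<gamma> * \<eta>x \<le> 1" "36 * \<tau> * chi\<^sup>2 * \<eta>x \<le> \<mu> / 4"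
proof -
  have "\<eta>x \<le> 1 / (900 * chi * \<gamma>)" "\<eta>x \<le> \<mu> / 4 / (36 * \<tau> * chi\<^sup>2)"
    by (subst etax_eq, rule min.cobounded1) (subst etax_eq, rule min.cobounded2)
  then show "900 * chi * \<gamma> * \<eta>x \<le> 1" "36 * \<tau> * chi\<^sup>2 * \<eta>x \<le> \<mu> / 4"
    using gamma_pos tau_pos chi by (simp_all add: field_simps)
qed

lemma alpha_ge:
  "1 - p * \<eta>z * (\<mu> / 4) / (p + \<eta>z * (\<mu> / 4)) \<le> \<alpha>" "1 - \<eta>y * \<gamma> \<le> \<alpha>" "1 - \<eta>x * \<gamma> \<le> \<alpha>"
  "1 - \<mu> * \<eta>z / 8 \<le> \<alpha>" "1 - \<tau> \<le> \<alpha>" "1 - 1 / (4 * chi) \<le> \<alpha>"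
  unfolding alpha_eq by (intro Max_ge; simp)+

lemma alpha_lt_1: "\<alpha> < 1"
  unfolding alpha_eq using mu eta gamma_pos tau_pos chi p by (simp add: add_pos_pos)

lemma alpha_ge_34: "3 / 4 \<le> \<alpha>"
proof -
  have "1 / (4 * chi) \<le> 1 / 4" using chi by (simp add: field_simps)
  then show ?thesis using alpha_ge(6) by linarith
qed

lemma etaz_le: "\<eta>z * L \<le> 1 / 8" "32 * \<eta>z * \<eta>y \<le> 1" "\<eta>z \<le> sqrt (\<alpha> * real b * p) / (8 * L')"
   "64 * \<eta>z\<^sup>2 * L'\<^sup>2 \<le> \<alpha> * real b * p"
proof -
  have 1: "\<eta>z \<le> 1 / (8 * L * chi)" by (subst etaz_eq, rule Min_le) auto
  have 2: "\<eta>z \<le> 1 / (32 * \<eta>y)" by (subst etaz_eq, rule Min_le) auto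
  show 3: "\<eta>z \<le> sqrt (\<alpha> * real b * p) / (8 * L')" by (subst etaz_eq, rule Min_le) auto
  have "\<eta>z * (8 * L) * 1 \<le> \<eta>z * (8 * L) * chi" using chi L_pos eta by (intro mult_left_mono) auto
  also have "\<dots> \<le> 1" using 1 chi L_pos by (simp add: field_simps)
  finally show "\<eta>z * L \<le> 1 / 8" by simp
  show "32 * \<eta>z * \<eta>y \<le> 1" using 2 eta by (simp add: field_simps)
  have "8 * \<eta>z * L' \<le> sqrt (\<alpha> * real b * p)" using 3 L_pos by (simp add: field_simps)
  then have "(8 * \<eta>z * L')\<^sup>2 \<le> (sqrt (\<alpha> * real b * p))\<^sup>2"
    using L_pos eta by (intro power_mono) auto
  also have "\<dots> = \<alpha> * real b * p"
    using alpha_ge_34 p by (intro real_sqrt_pow2) auto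
  finally show "64 * \<eta>z\<^sup>2 * L'\<^sup>2 \<le> \<alpha> * real b * p" by (simp add: power_mult_distrib)
qed

text \<open>When the second bound on \<open>\<eta>y\<close> or \<open>\<eta>x\<close> is active, its
  product with \<gamma> is governed by \<open>\<mu> * \<gamma> / \<tau>\<close>. The two arguments
  of the minimum match the two branches of \<gamma>: in the first, \<open>\<mu> * \<gamma>\<close>
  equals \<open>2 * \<mu> * chi / L\<close> times the first bound on \<tau>; in the second, the cap
  of \<open>\<eta>z\<close> by \<open>L'\<close> makes it at least 32/3 times the second
  bound.\<close>

lemma mu_gamma_ge: "min (2 * \<mu> * chi / L) (32 / 3) * \<tau> \<le> \<mu> * \<gamma>"
proof (cases "\<gamma> = \<mu> / (16 * L\<^sup>2)")
  case True
  have "min (2 * \<mu> * chi / L) (32 / 3) * \<tau> \<le> 2 * \<mu> * chi / L * (\<mu> / (32 * L * chi))"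
    using tau_pos mu chi L_pos by (intro mult_mono) (auto simp: tau_eq)
  also have "\<dots> = \<mu> * \<gamma>" using L_pos chi by (simp add: True power2_eq_square)
  finally show ?thesis .
next
  case False
  then have g: "\<gamma> = real b * p / (24 * L'\<^sup>2 * \<eta>z)" by (metis gamma_eq min_def)
  define q where "q = sqrt (real b * p)"
  have q: "q > 0" "q * q = real b * p" using bp_pos by (auto simp: q_def)
  have "\<alpha> * real b * p \<le> real b * p" 
    using mult_right_mono[of \<alpha> 1 "real b * p"] alpha_lt_1 bp_pos by (simp add: mult.assoc)
  then have "sqrt (\<alpha> * real b * p) \<le> q" by (simp add: q_def)
  then have ez: "8 * L' * \<eta>z \<le> q" using etaz_le(3) L_pos by (simp add: field_simps)
  have "min (2 * \<mu> * chi / L) (32 / 3) * \<tau> \<le> 32 / 3 * (\<mu> * q / (32 * L'))"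
    using tau_pos mu chi L_pos by (intro mult_mono) (auto simp: tau_eq q_def)
  also have "\<dots> \<le> \<mu> * \<gamma>"
    using ez q L_pos eta mu unfolding g q(2)[symmetric] by (simp add: field_simps power2_eq_square)
  finally show ?thesis .
qed

definition complexity :: real where
  "complexity = chi\<^sup>2 + 1 / p + chi * (L / \<mu>) + 1 / sqrt (real b * p) * (L' / \<mu>)"

lemma complexity_ge:
  "chi\<^sup>2 \<le> complexity" "chi \<le> complexity" "1 \<le> complexity" "1 / p \<le> complexity"
  "chi * L / \<mu> \<le> complexity" "L / \<mu> \<le> complexity" "L' / (\<mu> * sqrt (real b * p)) \<le> complexity"
proof -
  have n: "0 \<le> chi\<^sup>2" "0 \<le> 1 / p" "0 \<le> chi * (L / \<mu>)" "0 \<le> 1 / sqrt (real b * p) * (L' / \<mu>)"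
    using chi p L_pos mu bp_pos by auto
  have c: "chi \<le> chi\<^sup>2" using chi by (simp add: power2_eq_square)
  have l: "L / \<mu> \<le> chi * (L / \<mu>)" using chi L_pos mu by (simp add: field_simps)
  have e: "chi * L / \<mu> = chi * (L / \<mu>)" "L' / (\<mu> * sqrt (real b * p)) = 1 / sqrt (real b * p) * (L' / \<mu>)"
    by simp_all
  show "chi\<^sup>2 \<le> complexity" "chi \<le> complexity" "1 \<le> complexity" "1 / p \<le> complexity"
    "chi * L / \<mu> \<le> complexity" "L / \<mu> \<le> complexity" "L' / (\<mu> * sqrt (real b * p)) \<le> complexity"
    unfolding complexity_def e using n c l chi by linarith+
qed

text \<open>The two claims share a proof because of the branch
  \<open>\<eta>z = 1 / (32 * \<eta>y)\<close>: there the cap of \<open>\<eta>y\<close> by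
  \<open>\<mu> / (32 * \<tau>)\<close> reduces the first claim to the second.\<close>

lemma etaz_inverse: "1 / (\<mu> * \<eta>z) \<le> 32 * complexity" and tau_inverse: "1 / \<tau> \<le> 32 * complexity"
proof -
  let ?q = "sqrt (real b * p)"
  have q: "?q > 0" using bp_pos by simp
  have "\<tau> = \<mu> / (32 * L * chi) \<or> \<tau> = \<mu> * ?q / (32 * L')" by (simp add: tau_eq min_def)
  then show t: "1 / \<tau> \<le> 32 * complexity"
  proof
    assume "\<tau> = \<mu> / (32 * L * chi)"
    then have "1 / \<tau> = 32 * (chi * L / \<mu>)" by simp
    then show ?thesis using complexity_ge(5) by linarith
  next
    assume "\<tau> = \<mu> * ?q / (32 * L')"
    then have "1 / \<tau> = 32 * (L' / (\<mu> * ?q))" by simp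
    then show ?thesis using complexity_ge(7) by linarith
  qed
  have "\<eta>z \<in> {1 / (8 * L * chi), 1 / (32 * \<eta>y), sqrt (\<alpha> * real b * p) / (8 * L')}"
    by (subst etaz_eq, rule Min_in) auto
  then consider "\<eta>z = 1 / (8 * L * chi)" | "\<eta>z = 1 / (32 * \<eta>y)" | "\<eta>z = sqrt (\<alpha> * real b * p) / (8 * L')"
    by auto
  then show "1 / (\<mu> * \<eta>z) \<le> 32 * complexity"
  proof cases
    case 1
    then have "1 / (\<mu> * \<eta>z) = 8 * (chi * L / \<mu>)" by simp
    then show ?thesis using complexity_ge(5) complexity_ge(3) by linarith
  next
    case 2
    have "32 * \<eta>y / \<mu> \<le> 1 / \<tau>" using etay_le(2) tau_pos mu by (simp add: field_simps)
    moreover have "1 / (\<mu> * \<eta>z) = 32 * \<eta>y / \<mu>" using 2 by simp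
    ultimately show ?thesis using t by simp
  next
    case 3
    \<comment> \<open>The \<alpha> under the root is harmless: the last entry of its maximum makes
      it at least 3/4, and the crude bound 1/4 on the root already gives the constant 8 * 4 =
      32.\<close>
    have "(1 / 4 :: real) = sqrt ((1 / 4)\<^sup>2)" by simp
    also have "\<dots> \<le> sqrt \<alpha>" using alpha_ge_34 by (intro real_sqrt_le_mono) (simp add: power2_eq_square)
    finally have "1 / 4 * ?q \<le> sqrt \<alpha> * ?q" using q by (intro mult_right_mono) auto
    also have "\<dots> = sqrt (\<alpha> * real b * p)" by (simp add: real_sqrt_mult)
    finally have "?q / 4 / (8 * L') \<le> \<eta>z" unfolding 3 using L_pos by (intro divide_right_mono) auto
    then have "1 / (\<mu> * \<eta>z) \<le> 1 / (\<mu> * (?q / 4 / (8 * L')))"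
      using mu q L_pos eta by (intro divide_left_mono mult_left_mono mult_pos_pos) auto
    also have "\<dots> = 32 * (L' / (\<mu> * ?q))" by simp
    finally show ?thesis using complexity_ge(7) by linarith
  qed
qed

text \<open>Each entry of the maximum is compared separately. The constant 900 is forced by
  \<open>\<eta>x = 1 / (900 * chi * \<gamma>)\<close>; every other case costs at most 256, reached
  by the entry with \<open>\<mu> * \<eta>z / 8\<close>.\<close>

lemma rate: "1 / (1 - \<alpha>) \<le> 900 * complexity"
proof -
  define K where "K = complexity"
  have K: "K \<ge> 1" using complexity_ge(3) by (simp add: K_def)
  have inv: "1 / x \<le> 900 * K \<Longrightarrow> 0 < x \<Longrightarrow> 1 / (900 * K) \<le> x" for x
    using K by (simp add: field_simps)
  define m where "m = min (2 * \<mu> * chi / L) (32 / 3)"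
  have m0: "m > 0" using mu chi L_pos by (simp add: m_def)
  have m: "m * \<tau> \<le> \<mu> * \<gamma>" using mu_gamma_ge by (simp add: m_def)
  have minv: "1 / m = L / (2 * \<mu> * chi) \<or> 1 / m = 3 / 32" by (simp add: m_def min_def)
  have "1 / (900 * K) \<le> p * \<eta>z * (\<mu> / 4) / (p + \<eta>z * (\<mu> / 4))"
  proof (rule inv)
    have "1 / (p * \<eta>z * (\<mu> / 4) / (p + \<eta>z * (\<mu> / 4))) = 4 * (1 / (\<mu> * \<eta>z)) + 1 / p"
      using mu eta p by (simp add: field_simps)
    then show "1 / (p * \<eta>z * (\<mu> / 4) / (p + \<eta>z * (\<mu> / 4))) \<le> 900 * K"
      using etaz_inverse complexity_ge(4) K by (simp add: K_def)
  qed (use mu eta p in \<open>simp add: add_pos_pos\<close>)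
  moreover have "1 / (900 * K) \<le> \<eta>y * \<gamma>"
  proof (rule inv)
    have "\<eta>y = 1 / (4 * \<gamma>) \<or> \<eta>y = \<mu> / 4 / (8 * \<tau>)" by (metis etay_eq min_def)
    then show "1 / (\<eta>y * \<gamma>) \<le> 900 * K"
    proof
      assume "\<eta>y = 1 / (4 * \<gamma>)"
      then show ?thesis using gamma_pos K by simp
    next
      assume e: "\<eta>y = \<mu> / 4 / (8 * \<tau>)"
      have "1 / (\<eta>y * \<gamma>) = 32 * \<tau> / (\<mu> * \<gamma>)" using e by simp
      also have "\<dots> \<le> 32 * (1 / m)" using m m0 mu gamma_pos by (simp add: field_simps)
      also have "\<dots> \<le> 900 * K" using minv
      proof
        assume "1 / m = L / (2 * \<mu> * chi)"
        also have "\<dots> \<le> L / \<mu>" using mu chi L_pos by (simp add: field_simps)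
        also have "\<dots> \<le> K" using complexity_ge(6) by (simp add: K_def)
        finally show ?thesis using K by simp
      qed (use K in simp)
      finally show ?thesis .
    qed
  qed (use eta gamma_pos in simp)
  moreover have "1 / (900 * K) \<le> \<eta>x * \<gamma>"
  proof (rule inv)
    have "\<eta>x = 1 / (900 * chi * \<gamma>) \<or> \<eta>x = \<mu> / 4 / (36 * \<tau> * chi\<^sup>2)" by (metis etax_eq min_def)
    then show "1 / (\<eta>x * \<gamma>) \<le> 900 * K"
    proof
      assume "\<eta>x = 1 / (900 * chi * \<gamma>)"
      then show ?thesis using gamma_pos complexity_ge(2) by (simp add: K_def)
    next
      assume e: "\<eta>x = \<mu> / 4 / (36 * \<tau> * chi\<^sup>2)"
      have "1 / (\<eta>x * \<gamma>) = 144 * chi\<^sup>2 * (\<tau> / (\<mu> * \<gamma>))" using e by simp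
      also have "\<dots> \<le> 144 * chi\<^sup>2 * (1 / m)"
        using m m0 mu gamma_pos by (intro mult_left_mono) (simp_all add: field_simps)
      also have "\<dots> \<le> 900 * K" using minv
      proof
        assume "1 / m = L / (2 * \<mu> * chi)"
        then have "144 * chi\<^sup>2 * (1 / m) = 72 * (chi * L / \<mu>)" using chi by (simp add: power2_eq_square)
        also have "\<dots> \<le> 72 * K" using complexity_ge(5) by (simp add: K_def)
        finally show ?thesis using K by linarith
      next
        assume "1 / m = 3 / 32"
        have "144 * chi\<^sup>2 * (1 / m) = 27 / 2 * chi\<^sup>2" by (subst \<open>1 / m = 3 / 32\<close>) simp
        also have "\<dots> \<le> 27 / 2 * K" using complexity_ge(1) by (simp add: K_def)
        finally show ?thesis using K by linarith
      qed
      finally show ?thesis .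
    qed
  qed (use eta gamma_pos in simp)
  moreover have "1 / (900 * K) \<le> \<mu> * \<eta>z / 8"
  proof (rule inv)
    have "1 / (\<mu> * \<eta>z / 8) = 8 * (1 / (\<mu> * \<eta>z))" by simp
    then show "1 / (\<mu> * \<eta>z / 8) \<le> 900 * K" using etaz_inverse K by (simp add: K_def)
  qed (use mu eta in simp)
  moreover have "1 / (900 * K) \<le> \<tau>"
    using tau_inverse tau_pos K by (intro inv) (auto simp: K_def)
  moreover have "1 / (900 * K) \<le> 1 / (4 * chi)"
    using complexity_ge(2) chi by (intro inv) (auto simp: K_def)
  ultimately have "\<alpha> \<le> 1 - 1 / (900 * K)"
    unfolding alpha_eq by (intro Max.boundedI) (auto simp del: divide_le_eq_1)
  then have "1 / (900 * K) \<le> 1 - \<alpha>" by simp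
  then show ?thesis using K alpha_lt_1 by (simp add: K_def field_simps)
qed

end

section \<open>The potential and its pathwise one-step inequality\<close>

context step_sizes
begin

text \<open>
  The weight of \<open>\<parallel>w\<^sup>k - z\<^sup>*\<parallel>\<^sup>2\<close>, for which resetting \<open>w\<close> with probability \<open>p\<close> costs exactly \<open>\<nu>\<close> in the
  coefficient of \<open>\<parallel>z\<^sup>k - z\<^sup>*\<parallel>\<^sup>2\<close>; this is the origin of the first argument of the maximum defining \<open>\<alpha>\<close>.
\<close>

definition lam :: real where "lam = 1 + \<eta>z * (\<mu> / 4) / p"

text \<open>The two inner products are those left over by the extrapolation with \<alpha>. The
  squares of \<open>Z - Zp\<close> and \<open>Y - Yp\<close> compensate their sign and pay for
  Young's inequality; the square of \<open>Z - Wp\<close> and part of that of \<open>Z - Zp\<close>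
  are reserves against the variance of the next first batch. \<open>Xh\<close> stands for the
  corrected iterate \<open>X - n\<close>.\<close>

definition potential ::
    "'a::real_inner \<Rightarrow> 'a \<Rightarrow> 'a \<Rightarrow> 'a \<Rightarrow> 'a \<Rightarrow> 'a \<Rightarrow> 'a \<Rightarrow> 'a \<Rightarrow> 'a \<Rightarrow> 'a \<Rightarrow> 'a \<Rightarrow> real" where
  "potential Z Zp f fp W Wp Y Yp V Xh n =
     (1 / \<eta>z + \<mu> / 2) * (norm Z)\<^sup>2 + 1 / (4 * \<eta>z) * (norm (Z - Zp))\<^sup>2 - 2 * inner (f - fp) Z
     + 2 * inner (Y - Yp) Z + p / (2 * \<eta>z) * (norm (Z - Wp))\<^sup>2 + lam / \<eta>z * (norm W)\<^sup>2
     + 1 / \<eta>y * (norm Y)\<^sup>2 + 1 / (4 * \<eta>y) * (norm (Y - Yp))\<^sup>2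
     + 1 / \<eta>x * (norm Xh)\<^sup>2 + 2 / \<eta>x * (norm n)\<^sup>2 + 1 / (\<mu> / 4 * \<tau>) * (norm V)\<^sup>2"

lemma lam_pos: "0 < lam" using mu eta p by (simp add: lam_def add_pos_pos)

text \<open>Each indefinite product is absorbed by the square of the corresponding difference and
  \<open>1 / (8 * \<eta>z)\<close> of the square of \<open>Z\<close>, by
  \<open>\<eta>z * L \<le> 1 / 8\<close> and \<open>32 * \<eta>z * \<eta>y \<le> 1\<close>
  respectively.\<close>

lemma potential_ge:
  assumes lip: "norm (f - fp) \<le> L * norm (Z - Zp)"
  shows "1 / (2 * \<eta>z) * (norm Z)\<^sup>2 \<le> potential Z Zp f fp W Wp Y Yp V Xh n"
proof -
  have "2 * \<bar>inner (f - fp) Z\<bar> \<le> L * ((norm (Z - Zp))\<^sup>2 + (norm Z)\<^sup>2)"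
    using L_pos by (intro abs_inner_le_mult lip) auto
  also have "\<dots> \<le> 1 / (8 * \<eta>z) * ((norm (Z - Zp))\<^sup>2 + (norm Z)\<^sup>2)"
    using etaz_le(1) eta by (intro mult_right_mono) (auto simp: field_simps)
  finally have 1: "2 * inner (f - fp) Z \<le> 1 / (8 * \<eta>z) * (norm (Z - Zp))\<^sup>2 + 1 / (8 * \<eta>z) * (norm Z)\<^sup>2"
    unfolding distrib_left by linarith
  have c: "1 / (4 * \<eta>y) > 0" using eta by simp
  have "- (2 * inner (Y - Yp) Z) \<le> 1 / (4 * \<eta>y) * (norm (Y - Yp))\<^sup>2 + 4 * \<eta>y * (norm Z)\<^sup>2"
    using young[OF c, of "- (Y - Yp)" Z] eta
    by (simp only: norm_minus_cancel inner_minus_left) (simp add: mult.commute)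
  also have "4 * \<eta>y * (norm Z)\<^sup>2 \<le> 1 / (8 * \<eta>z) * (norm Z)\<^sup>2"
    using etaz_le(2) eta by (intro mult_right_mono) (simp_all add: field_simps)
  finally have 2: "- (2 * inner (Y - Yp) Z) \<le> 1 / (4 * \<eta>y) * (norm (Y - Yp))\<^sup>2 + 1 / (8 * \<eta>z) * (norm Z)\<^sup>2"
    by simp
  have 3: "1 / (8 * \<eta>z) * (norm (Z - Zp))\<^sup>2 \<le> 1 / (4 * \<eta>z) * (norm (Z - Zp))\<^sup>2"
    using eta by (intro mult_right_mono) (auto simp: field_simps)
  have 4: "1 / (2 * \<eta>z) * (norm Z)\<^sup>2 + 1 / (8 * \<eta>z) * (norm Z)\<^sup>2 + 1 / (8 * \<eta>z) * (norm Z)\<^sup>2 \<le> (1 / \<eta>z + \<mu> / 2) * (norm Z)\<^sup>2"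
  proof -
    have "1 / (2 * \<eta>z) * (norm Z)\<^sup>2 + 1 / (8 * \<eta>z) * (norm Z)\<^sup>2 + 1 / (8 * \<eta>z) * (norm Z)\<^sup>2
      = (1 / (2 * \<eta>z) + 1 / (8 * \<eta>z) + 1 / (8 * \<eta>z)) * (norm Z)\<^sup>2"
      by (simp only: distrib_right)
    also have "\<dots> \<le> (1 / \<eta>z + \<mu> / 2) * (norm Z)\<^sup>2"
      using eta mu by (intro mult_right_mono) (simp_all add: field_simps add_nonneg_nonneg)
    finally show ?thesis .
  qed
  have 5: "0 \<le> p / (2 * \<eta>z) * (norm (Z - Wp))\<^sup>2" "0 \<le> lam / \<eta>z * (norm W)\<^sup>2" "0 \<le> 1 / \<eta>y * (norm Y)\<^sup>2"
    "0 \<le> 1 / \<eta>x * (norm Xh)\<^sup>2" "0 \<le> 2 / \<eta>x * (norm n)\<^sup>2" "0 \<le> 1 / (\<mu> / 4 * \<tau>) * (norm V)\<^sup>2"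
    using eta p lam_pos tau_pos mu by (auto intro!: mult_nonneg_nonneg divide_nonneg_nonneg)
  show ?thesis unfolding potential_def using 1 2 3 4 5 by linarith
qed

text \<open>These are the coefficients of the squares in the sum of the four step inequalities.
  Lines two to seven compare them with \<alpha> times their weights in \<open>potential\<close>,
  each using one entry of the maximum defining \<alpha>. The first line accounts for the
  \<open>\<mu> / 2\<close> spent on \<Phi>, the last for the \<open>Y' - Y\<close> term of the
  accelerated step.\<close>

lemma coefficients:
  "1 / \<eta>z + \<mu> / 2 \<le> 1 / \<eta>z + 5 * \<mu> / 4 - \<mu> / 2"
  "(1 - p) / \<eta>z + 4 * \<gamma> * (\<mu> / 4)\<^sup>2 + lam / \<eta>z * p \<le> \<alpha> * (1 / \<eta>z + \<mu> / 2)"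
  "p / \<eta>z + lam / \<eta>z * (1 - p) \<le> \<alpha> * (lam / \<eta>z)"
  "1 / \<eta>y - \<gamma> \<le> \<alpha> * (1 / \<eta>y)"
  "1 / \<eta>x - \<gamma> \<le> \<alpha> * (1 / \<eta>x)"
  "2 / \<eta>x * (1 - 1 / (4 * chi)) \<le> \<alpha> * (2 / \<eta>x)"
  "(1 - \<tau>) / (\<mu> / 4 * \<tau>) \<le> \<alpha> * (1 / (\<mu> / 4 * \<tau>))"
  "1 / (4 * \<eta>y) + 2 * \<tau> / (\<mu> / 4) \<le> 3 / (4 * \<eta>y)"
proof -
  show "1 / \<eta>z + \<mu> / 2 \<le> 1 / \<eta>z + 5 * \<mu> / 4 - \<mu> / 2" using mu by simp
  have "\<mu> * \<mu> \<le> L * L" using mu by (intro mult_mono) auto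
  then have "16 * (\<mu> * \<mu>) * \<gamma> \<le> 16 * L\<^sup>2 * \<gamma>" using gamma_pos by (intro mult_right_mono) (auto simp: power2_eq_square)
  also have "\<dots> \<le> \<mu>" by (rule gamma_le)
  finally have g: "4 * \<gamma> * (\<mu> / 4)\<^sup>2 \<le> \<mu> / 64" by (simp add: power2_eq_square mult_ac)
  have "\<mu> * \<eta>z \<le> L * \<eta>z" using mu eta by (intro mult_right_mono) auto
  then have me: "\<mu> * \<eta>z \<le> 1 / 8" using etaz_le(1) by (simp add: mult.commute)
  have "(1 - p) / \<eta>z + 4 * \<gamma> * (\<mu> / 4)\<^sup>2 + lam / \<eta>z * p = 1 / \<eta>z + \<mu> / 4 + 4 * \<gamma> * (\<mu> / 4)\<^sup>2"
    using eta p by (simp add: lam_def field_simps)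
  also have "\<dots> \<le> 1 / \<eta>z + \<mu> / 4 + \<mu> / 64" using g by simp
  also have "\<dots> \<le> (1 - \<mu> * \<eta>z / 8) * (1 / \<eta>z + \<mu> / 2)"
  proof -
    have "(1 - \<mu> * \<eta>z / 8) * (1 / \<eta>z + \<mu> / 2) = 1 / \<eta>z + \<mu> / 2 - \<mu> / 8 - \<mu> * (\<mu> * \<eta>z) / 16"
      using eta by (simp add: field_simps)
    moreover have "\<mu> * (\<mu> * \<eta>z) \<le> \<mu> * (1 / 8)" using me mu by (intro mult_left_mono) auto
    ultimately show ?thesis using mu by linarith
  qed
  also have "\<dots> \<le> \<alpha> * (1 / \<eta>z + \<mu> / 2)"
    using alpha_ge(4) eta mu by (intro mult_right_mono) (auto intro: add_nonneg_nonneg)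
  finally show "(1 - p) / \<eta>z + 4 * \<gamma> * (\<mu> / 4)\<^sup>2 + lam / \<eta>z * p \<le> \<alpha> * (1 / \<eta>z + \<mu> / 2)" .
  have s: "p + \<eta>z * (\<mu> / 4) > 0" using mu eta p by (simp add: add_pos_pos)
  have "p / \<eta>z + lam / \<eta>z * (1 - p) = (lam - \<eta>z * (\<mu> / 4)) / \<eta>z"
    using eta p by (simp add: lam_def field_simps)
  also have "lam - \<eta>z * (\<mu> / 4) = (1 - p * \<eta>z * (\<mu> / 4) / (p + \<eta>z * (\<mu> / 4))) * lam"
  proof -
    have l: "lam = (p + \<eta>z * (\<mu> / 4)) / p" using p by (simp add: lam_def add_divide_distrib)
    have "p * \<eta>z * (\<mu> / 4) / (p + \<eta>z * (\<mu> / 4)) * lam = \<eta>z * (\<mu> / 4)"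
    proof -
      have "p * x / q * (q / p) = x" if "0 < q" for x q using that p by simp
      from this[OF s, of "\<eta>z * (\<mu> / 4)"] show ?thesis unfolding l by (simp only: mult.assoc)
    qed
    then show ?thesis by (simp add: left_diff_distrib)
  qed
  also have "\<dots> / \<eta>z \<le> \<alpha> * lam / \<eta>z"
    using alpha_ge(1) lam_pos eta by (intro divide_right_mono mult_right_mono) auto
  finally show "p / \<eta>z + lam / \<eta>z * (1 - p) \<le> \<alpha> * (lam / \<eta>z)" by simp
  show "1 / \<eta>y - \<gamma> \<le> \<alpha> * (1 / \<eta>y)"
    using mult_right_mono[OF alpha_ge(2), of "1 / \<eta>y"] eta by (simp add: diff_divide_distrib)
  show "1 / \<eta>x - \<gamma> \<le> \<alpha> * (1 / \<eta>x)"
    using mult_right_mono[OF alpha_ge(3), of "1 / \<eta>x"] eta by (simp add: diff_divide_distrib)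
  show "2 / \<eta>x * (1 - 1 / (4 * chi)) \<le> \<alpha> * (2 / \<eta>x)"
    using mult_left_mono[OF alpha_ge(6), of "2 / \<eta>x"] eta by (simp add: mult.commute)
  show "(1 - \<tau>) / (\<mu> / 4 * \<tau>) \<le> \<alpha> * (1 / (\<mu> / 4 * \<tau>))"
    using mult_right_mono[OF alpha_ge(5), of "1 / (\<mu> / 4 * \<tau>)"] mu tau_pos by simp
  show "1 / (4 * \<eta>y) + 2 * \<tau> / (\<mu> / 4) \<le> 3 / (4 * \<eta>y)"
    using etay_le(2) eta mu by (simp add: field_simps)
qed

text \<open>In the sum, \<open>inner Z' Y'\<close> cancels between primal and dual step,
  \<open>inner U Y'\<close> between dual and accelerated step, and \<open>inner U X\<close> together
  with the square of \<open>Q\<close> between accelerated and gossip step; the square of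
  \<open>X\<close> cancels between dual and gossip step. The three brackets left belong to the first
  batch, the second batch and the reset of \<open>w\<close>.\<close>

lemma potential_step:
  fixes Z :: "'a::real_inner"
  assumes prox: "0 \<le> inner (Z + p *\<^sub>R (W - Z) - \<eta>z *\<^sub>R D - Z') Z'"
    and D: "D = f + \<alpha> *\<^sub>R (f - fp) + \<xi> - (\<mu> / 4) *\<^sub>R Z - Y - \<alpha> *\<^sub>R (Y - Yp)"
    and mono: "\<mu> * (norm Z')\<^sup>2 \<le> inner f' Z'"
    and lip: "norm (f' - f) \<le> L * norm (Z' - Z)" "norm (f - fp) \<le> L * norm (Z - Zp)"
    and Y': "Y' = Y - \<eta>y *\<^sub>R (inverse (\<mu> / 4) *\<^sub>R U + Z' + \<gamma> *\<^sub>R (Y + X + (\<mu> / 4) *\<^sub>R Z))"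
    and U: "U = \<tau> *\<^sub>R (Y + X) + (1 - \<tau>) *\<^sub>R V"
    and V': "V' = U + \<tau> *\<^sub>R (Y' - Y) - (1/2) *\<^sub>R AU"
    and AU: "inverse chi / 2 * (norm Q)\<^sup>2 + (norm AU)\<^sup>2 / 2 \<le> inner U AU"
    and Q: "inner Q X = inner U X"
    and G: "G = inverse (\<mu> / 4) *\<^sub>R Q + (5 * \<gamma>) *\<^sub>R (X + \<Phi> + \<zeta>)"
    and X'': "X'' = X - n - \<eta>x *\<^sub>R G"
    and n': "(norm n')\<^sup>2 \<le> (1 - inverse chi) * (norm (\<eta>x *\<^sub>R G + n))\<^sup>2"
    and \<Phi>: "(norm \<Phi>)\<^sup>2 \<le> L\<^sup>2 * (norm Z')\<^sup>2"
  shows "potential Z' Z f' f W' W Y' Y V' X'' n' \<le> \<alpha> * potential Z Zp f fp W Wp Y Yp V (X - n) n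
     + (4 * \<eta>z * (norm \<xi>)\<^sup>2 - \<alpha> * (p / (2 * \<eta>z)) * (norm (Z - Wp))\<^sup>2 - \<alpha> / (8 * \<eta>z) * (norm (Z - Zp))\<^sup>2
        - 2 * inner \<xi> Z)
     + (6 / 5 * \<gamma> * (norm \<zeta>)\<^sup>2 - p / (2 * \<eta>z) * (norm (W - Z'))\<^sup>2 - 10 * \<gamma> * inner \<zeta> X)
     + lam / \<eta>z * ((norm W')\<^sup>2 - p * (norm Z)\<^sup>2 - (1 - p) * (norm W)\<^sup>2)"
proof -
  have s1: "(1 / \<eta>z + 5 * \<mu> / 4) * (norm Z')\<^sup>2 - 2 * inner (f' - f) Z' + 2 * inner (Y' - Y) Z' - 2 * inner Y' Z'
      + 3 / (8 * \<eta>z) * (norm (Z' - Z))\<^sup>2 + p / \<eta>z * (norm (W - Z'))\<^sup>2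
    \<le> (1 - p) / \<eta>z * (norm Z)\<^sup>2 + p / \<eta>z * (norm W)\<^sup>2 - 2 * \<alpha> * inner (f - fp) Z
      + 2 * \<alpha> * inner (Y - Yp) Z + \<alpha> / (8 * \<eta>z) * (norm (Z - Zp))\<^sup>2
      + \<alpha> / (4 * \<eta>y) * (norm (Y - Yp))\<^sup>2 + 4 * \<eta>z * (norm \<xi>)\<^sup>2 - 2 * inner \<xi> Z"
    using eta alpha_lt_1 alpha_ge_34 p L_pos etaz_le mu
    by (intro primal_step[OF prox D mono lip]) auto
  have s2: "1 / \<eta>y * (norm Y')\<^sup>2 + 3 / (4 * \<eta>y) * (norm (Y' - Y))\<^sup>2
    \<le> (1 / \<eta>y - \<gamma>) * (norm Y)\<^sup>2 - 2 / (\<mu> / 4) * inner U Y' - 2 * inner Z' Y' + 2 * \<gamma> * (norm X)\<^sup>2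
      + 4 * \<gamma> * (\<mu> / 4)\<^sup>2 * (norm Z)\<^sup>2"
    by (rule dual_step[OF Y' eta(2) gamma_pos etay_le(1)])
  have s3: "1 / (\<mu> / 4 * \<tau>) * (norm V')\<^sup>2 + inverse chi / (2 * (\<mu> / 4) * \<tau>) * (norm Q)\<^sup>2
    \<le> (1 - \<tau>) / (\<mu> / 4 * \<tau>) * (norm V)\<^sup>2 + 2 * \<tau> / (\<mu> / 4) * (norm (Y' - Y))\<^sup>2
      + 2 / (\<mu> / 4) * inner U Y' + 2 / (\<mu> / 4) * inner U X"
    using mu by (intro accelerated_step[OF U V' AU tau_pos tau_le_1]) simp
  have s4: "1 / \<eta>x * (norm X'')\<^sup>2 + 2 / \<eta>x * (norm n')\<^sup>2
    \<le> (1 / \<eta>x - \<gamma>) * (norm (X - n))\<^sup>2 + 2 / \<eta>x * (1 - 1 / (4 * chi)) * (norm n)\<^sup>2 - 2 / (\<mu> / 4) * inner Q X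
      + inverse chi / (2 * (\<mu> / 4) * \<tau>) * (norm Q)\<^sup>2 - 2 * \<gamma> * (norm X)\<^sup>2 + \<mu> / 2 * (norm Z')\<^sup>2
      + 6 / 5 * \<gamma> * (norm \<zeta>)\<^sup>2 - 10 * \<gamma> * inner \<zeta> X"
    using mu eta gamma_pos chi etax_le tau_pos gamma_le(1)
    by (intro gossip_step[OF G X'' n' \<Phi>]) auto
  note m = coefficients[THEN mult_right_mono, OF zero_le_power2]
  have c2: "3 / (8 * \<eta>z) * (norm (Z' - Z))\<^sup>2 \<ge> 1 / (4 * \<eta>z) * (norm (Z' - Z))\<^sup>2"
    using eta by (intro mult_right_mono) (auto simp: field_simps)
  \<comment> \<open>One half becomes the reserve in the new potential, the other pays for the second
    batch of the present step.\<close>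
  have hz: "p / \<eta>z * (norm (W - Z'))\<^sup>2 = p / (2 * \<eta>z) * (norm (W - Z'))\<^sup>2 + p / (2 * \<eta>z) * (norm (Z' - W))\<^sup>2"
    by (simp add: norm_minus_commute)
  \<comment> \<open>With reciprocals as variables, the four inequalities and the goal become linear
    in common monomials.\<close>
  define i j k r where "i = 1 / \<eta>z" "j = 1 / \<eta>y" "k = 1 / \<eta>x" "r = 1 / (\<mu> / 4 * \<tau>)"
  have q: "1 / \<eta>z = i" "p / \<eta>z = p * i" "(1 - p) / \<eta>z = (1 - p) * i" "3 / (8 * \<eta>z) = 3 / 8 * i"
    "1 / (4 * \<eta>z) = i / 4" "\<alpha> / (8 * \<eta>z) = \<alpha> * i / 8" "p / (2 * \<eta>z) = p * i / 2" "lam / \<eta>z = lam * i"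
    "1 / \<eta>y = j" "1 / (4 * \<eta>y) = j / 4" "3 / (4 * \<eta>y) = 3 / 4 * j" "\<alpha> / (4 * \<eta>y) = \<alpha> * j / 4"
    "1 / \<eta>x = k" "2 / \<eta>x = 2 * k" "1 / (\<mu> / 4 * \<tau>) = r" "(1 - \<tau>) / (\<mu> / 4 * \<tau>) = (1 - \<tau>) * r"
    by (simp_all add: i_j_k_r_def)
  show ?thesis
    unfolding potential_def q
    using s1 s2 s3 s4 m(1)[of "norm Z'"] m(2)[of "norm Z"] m(3)[of "norm W"] m(4)[of "norm Y"]
      m(5)[of "norm (X - n)"] m(6)[of "norm n"] m(7)[of "norm V"] m(8)[of "norm (Y' - Y)"] c2 hz
    unfolding Q inner_commute[of Z' Y'] q distrib_left distrib_right right_diff_distrib left_diff_distrib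
    by (simp only: mult_ac times_divide_eq_left times_divide_eq_right)
qed

end

section \<open>Sampling\<close>

text \<open>All distributions that occur have finite support, so iterated expectations need no
  integrability condition on \<open>h\<close>.\<close>

lemma expectation_bind_finite:
  fixes h :: "'b \<Rightarrow> real"
  assumes "finite (set_pmf p)" "\<And>x. x \<in> set_pmf p \<Longrightarrow> finite (set_pmf (f x))"
  shows "measure_pmf.expectation (p \<bind> f) h =
    measure_pmf.expectation p (\<lambda>x. measure_pmf.expectation (f x) h)"
  using assms
  by (subst pmf_expectation_bind[of "set_pmf p"])
    (auto simp: integral_measure_pmf_real[of "set_pmf p"] mult.commute)

lemma expectation_mono_finite:
  fixes f g :: "'a \<Rightarrow> real"
  assumes "finite (set_pmf p)" "\<And>x. x \<in> set_pmf p \<Longrightarrow> f x \<le> g x"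
  shows "measure_pmf.expectation p f \<le> measure_pmf.expectation p g"
  using assms by (intro integral_mono_AE integrable_measure_pmf_finite) (auto simp: AE_measure_pmf_iff)

text \<open>The batch distribution over an arbitrary index set, so that moments can be computed by
  induction on the set.\<close>

definition sampling :: "'c set \<Rightarrow> nat \<Rightarrow> ('c \<Rightarrow> nat) pmf" where
  "sampling S n = Pi_pmf S 0 (\<lambda>_. pmf_of_set {..<n})"

lemma finite_sampling: "finite S \<Longrightarrow> n \<ge> 1 \<Longrightarrow> finite (set_pmf (sampling S n))"
  unfolding sampling_def
  by (rule finite_subset[OF set_Pi_pmf_subset']) (auto simp: lessThan_empty_iff intro!: finite_PiE_dflt)

lemma expectation_sampling_insert:
  fixes h :: "('c \<Rightarrow> nat) \<Rightarrow> real"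
  assumes "finite S" "x \<notin> S" "n \<ge> 1"
  shows "measure_pmf.expectation (sampling (insert x S) n) h =
    measure_pmf.expectation (sampling S n) (\<lambda>J. (\<Sum>i<n. h (J(x := i))) / n)"
proof -
  have ne: "{..<n} \<noteq> {}" using assms(3) by (auto simp: lessThan_empty_iff)
  have "sampling (insert x S) n = sampling S n \<bind> (\<lambda>J. pmf_of_set {..<n} \<bind> (\<lambda>i. return_pmf (J(x := i))))"
    unfolding sampling_def by (subst Pi_pmf_insert'[OF assms(1,2)]) (rule bind_commute_pmf)
  then have "measure_pmf.expectation (sampling (insert x S) n) h =
    measure_pmf.expectation (sampling S n) (\<lambda>J. measure_pmf.expectation (pmf_of_set {..<n} \<bind> (\<lambda>i. return_pmf (J(x := i)))) h)"
    using finite_sampling[OF assms(1,3)] ne by (subst expectation_bind_finite[symmetric]) auto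
  also have "\<dots> = measure_pmf.expectation (sampling S n) (\<lambda>J. (\<Sum>i<n. h (J(x := i))) / n)"
    using ne by (simp add: expectation_bind_finite integral_pmf_of_set)
  finally show ?thesis .
qed

lemma expectation_sampling_inner:
  fixes v :: "'c \<Rightarrow> nat \<Rightarrow> 'a::real_inner"
  assumes "finite S" "n \<ge> 1" "\<And>x. x \<in> S \<Longrightarrow> (\<Sum>i<n. v x i) = 0"
  shows "measure_pmf.expectation (sampling S n) (\<lambda>J. inner (\<Sum>x\<in>S. v x (J x)) u) = 0"
  using assms
proof (induction S rule: finite_induct)
  case (insert x S)
  have "measure_pmf.expectation (sampling (insert x S) n) (\<lambda>J. inner (\<Sum>x\<in>insert x S. v x (J x)) u) =
    measure_pmf.expectation (sampling S n) (\<lambda>J. (\<Sum>i<n. inner (v x i + (\<Sum>y\<in>S. v y (J y))) u) / n)"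
    using insert.hyps insert.prems
    by (subst expectation_sampling_insert; (intro arg_cong[where f = "measure_pmf.expectation _"] ext sum.cong arg_cong2[where f = "(/)"] arg_cong2[where f = inner] refl)?)
      (auto intro!: sum.cong)
  also have "\<dots> = measure_pmf.expectation (sampling S n) (\<lambda>J. inner (\<Sum>y\<in>S. v y (J y)) u)"
  proof (intro arg_cong[where f = "measure_pmf.expectation _"] ext)
    fix J
    have "(\<Sum>i<n. inner (v x i + (\<Sum>y\<in>S. v y (J y))) u) = inner (\<Sum>i<n. v x i) u + n * inner (\<Sum>y\<in>S. v y (J y)) u"
      by (simp add: inner_simps sum.distrib inner_sum_left)
    then show "(\<Sum>i<n. inner (v x i + (\<Sum>y\<in>S. v y (J y))) u) / n = inner (\<Sum>y\<in>S. v y (J y)) u"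
      using insert.prems by simp
  qed
  finally show ?case using insert by simp
qed simp

text \<open>Variances of independent centred vectors add: averaging over the inserted index first
  kills its product with the sum of the others, which does not depend on it.\<close>

lemma expectation_sampling_norm:
  fixes v :: "'c \<Rightarrow> nat \<Rightarrow> 'a::real_inner"
  assumes "finite S" "n \<ge> 1" "\<And>x. x \<in> S \<Longrightarrow> (\<Sum>i<n. v x i) = 0"
  shows "measure_pmf.expectation (sampling S n) (\<lambda>J. (norm (\<Sum>x\<in>S. v x (J x)))\<^sup>2)
    = (\<Sum>x\<in>S. (\<Sum>i<n. (norm (v x i))\<^sup>2) / n)"
  using assms
proof (induction S rule: finite_induct)
  case (insert x S)
  have fin: "finite (set_pmf (sampling S n))" using insert finite_sampling by blast
  have "measure_pmf.expectation (sampling (insert x S) n) (\<lambda>J. (norm (\<Sum>x\<in>insert x S. v x (J x)))\<^sup>2) =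
    measure_pmf.expectation (sampling S n) (\<lambda>J. (\<Sum>i<n. (norm (v x i + (\<Sum>y\<in>S. v y (J y))))\<^sup>2) / n)"
    using insert.hyps insert.prems
    by (subst expectation_sampling_insert; (intro arg_cong[where f = "measure_pmf.expectation _"] ext sum.cong arg_cong2[where f = "(/)"] arg_cong2[where f = power] arg_cong[where f = norm] refl)?)
      (auto intro!: sum.cong)
  also have "\<dots> = measure_pmf.expectation (sampling S n) (\<lambda>J. (\<Sum>i<n. (norm (v x i))\<^sup>2) / n + (norm (\<Sum>y\<in>S. v y (J y)))\<^sup>2)"
  proof (intro arg_cong[where f = "measure_pmf.expectation _"] ext)
    fix J
    let ?s = "\<Sum>y\<in>S. v y (J y)"
    have "(\<Sum>i<n. (norm (v x i + ?s))\<^sup>2) = (\<Sum>i<n. (norm (v x i))\<^sup>2 + 2 * inner (v x i) ?s + (norm ?s)\<^sup>2)"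
      by (intro sum.cong refl) (simp only: power2_norm_eq_inner inner_add_left inner_add_right, simp add: inner_commute)
    also have "\<dots> = (\<Sum>i<n. (norm (v x i))\<^sup>2) + 2 * inner (\<Sum>i<n. v x i) ?s + n * (norm ?s)\<^sup>2"
      by (simp add: sum.distrib inner_sum_left sum_distrib_left)
    finally show "(\<Sum>i<n. (norm (v x i + ?s))\<^sup>2) / n = (\<Sum>i<n. (norm (v x i))\<^sup>2) / n + (norm ?s)\<^sup>2"
      using insert.prems by (simp add: add_divide_distrib)
  qed
  also have "\<dots> = (\<Sum>i<n. (norm (v x i))\<^sup>2) / n + measure_pmf.expectation (sampling S n) (\<lambda>J. (norm (\<Sum>y\<in>S. v y (J y)))\<^sup>2)"
    by (subst Bochner_Integration.integral_add) (auto intro: integrable_measure_pmf_finite fin)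
  finally show ?case using insert by simp
qed simp

section \<open>Gossip matrices\<close>

lemma coord_sum: "coord (\<Sum>x\<in>S. f x) i = (\<Sum>x\<in>S. coord (f x) i)"
  by (induction S rule: infinite_finite_induct) auto

lemma inner_tup: "inner (tup M f) y = (\<Sum>m<M. inner (f m) (coord y m))"
proof -
  have "{i. coord (tup M f) i \<noteq> 0 \<and> coord y i \<noteq> 0} \<subseteq> {..<M}" by auto
  then show ?thesis by (subst inner_fvec_superset[of "{..<M}"]) auto
qed

lemma norm_tup_sq: "(norm (tup M f))\<^sup>2 = (\<Sum>m<M. (norm (f m))\<^sup>2)"
  by (simp add: power2_norm_eq_inner inner_tup)

lemma tup_coord: "z \<in> Rtup M d \<Longrightarrow> tup M (coord z) = z"
  by (intro fvec_eqI) (auto simp: Rtup_def)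

lemma norm_Rtup_sq: "z \<in> Rtup M d \<Longrightarrow> (norm z)\<^sup>2 = (\<Sum>m<M. (norm (coord z m))\<^sup>2)"
  by (metis norm_tup_sq tup_coord)

lemma norm_Rn_sq: "x \<in> Rn d \<Longrightarrow> (norm x)\<^sup>2 = (\<Sum>i<d. (coord x i)\<^sup>2)"
  by (simp only: power2_norm_eq_inner inner_Rn) (simp add: power2_eq_square)

lemma subspace_Rn: "subspace (Rn d)"
  by (auto simp: subspace_def Rn_def)

lemma subspace_Rtup: "subspace (Rtup M d)"
  using subspace_Rn by (auto simp: subspace_def Rtup_def)

lemma tup_in_Rtup: "(\<And>m. m < M \<Longrightarrow> f m \<in> Rn d) \<Longrightarrow> tup M f \<in> Rtup M d"
  by (simp add: Rtup_def)

lemma coord_Rtup: "z \<in> Rtup M d \<Longrightarrow> m < M \<Longrightarrow> coord z m \<in> Rn d"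
  by (simp add: Rtup_def)

text \<open>On \<open>Rtup M d\<close> this is the projection \<open>P\<close> of the overview:
  orthogonality to the consensus subspace means that the entries sum to zero, so projecting is
  subtracting the mean.\<close>

definition cproj :: "nat \<Rightarrow> 'a::real_inner fvec \<Rightarrow> 'a fvec" where
  "cproj M z = tup M (\<lambda>m. coord z m - (1 / real M) *\<^sub>R (\<Sum>j<M. coord z j))"

lemma cproj_add: "cproj M (x + y) = cproj M x + cproj M y"
  by (intro fvec_eqI) (simp add: cproj_def sum.distrib algebra_simps)

lemma cproj_scaleR: "cproj M (c *\<^sub>R x) = c *\<^sub>R cproj M x"
  by (intro fvec_eqI) (simp add: cproj_def scaleR_right.sum[symmetric] algebra_simps)

lemma linear_cproj: "linear (cproj M)"
  by (intro linearI cproj_add cproj_scaleR)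

lemma sum_coord_cproj: "M \<ge> 1 \<Longrightarrow> (\<Sum>m<M. coord (cproj M z) m) = 0"
  by (simp add: cproj_def sum_subtractf scaleR_conv_of_real scaleR_right.sum[symmetric])
    (simp add: scaleR_sum_right sum_constant_scaleR)

lemma cproj_id: "(\<Sum>m<M. coord z m) = 0 \<Longrightarrow> z \<in> Rtup M d \<Longrightarrow> cproj M z = z"
  by (intro fvec_eqI) (auto simp: cproj_def Rtup_def)

lemma cproj_in: "z \<in> Rtup M d \<Longrightarrow> cproj M z \<in> Rtup M d"
  unfolding cproj_def using subspace_Rn[of d]
  by (intro tup_in_Rtup subspace_diff subspace_scale subspace_sum) (auto simp: coord_Rtup)

lemma cproj_idem: "M \<ge> 1 \<Longrightarrow> cproj M (cproj M z) = cproj M z"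
  by (subst (1) cproj_def, subst sum_coord_cproj) (auto intro!: fvec_eqI simp: cproj_def)

lemma inner_cproj:
  "inner (cproj M x) y = (\<Sum>m<M. inner (coord x m) (coord y m))
    - inner (\<Sum>m<M. coord x m) (\<Sum>m<M. coord y m) / real M"
proof -
  have "inner (cproj M x) y = (\<Sum>m<M. inner (coord x m) (coord y m))
    - (\<Sum>m<M. inner ((1 / real M) *\<^sub>R (\<Sum>j<M. coord x j)) (coord y m))"
    by (simp only: cproj_def inner_tup inner_diff_left sum_subtractf)
  also have "(\<Sum>m<M. inner ((1 / real M) *\<^sub>R (\<Sum>j<M. coord x j)) (coord y m))
    = inner ((1 / real M) *\<^sub>R (\<Sum>j<M. coord x j)) (\<Sum>m<M. coord y m)"
    by (rule inner_sum_right[symmetric])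
  finally show ?thesis by simp
qed

lemma cproj_commute: "inner (cproj M x) y = inner x (cproj M y)"
  unfolding inner_commute[of x] inner_cproj by (simp only: inner_commute)

lemma norm_cproj_le: "M \<ge> 1 \<Longrightarrow> norm (cproj M x) \<le> norm x"
proof -
  assume M: "M \<ge> 1"
  have "(norm (cproj M x))\<^sup>2 = inner (cproj M x) x"
    by (simp add: power2_norm_eq_inner cproj_commute cproj_idem[OF M] inner_commute)
  also have "\<dots> \<le> norm (cproj M x) * norm x" by (rule norm_cauchy_schwarz)
  finally have "norm (cproj M x) * norm (cproj M x) \<le> norm (cproj M x) * norm x"
    by (simp add: power2_eq_square)
  then show ?thesis by (cases "cproj M x = 0") auto
qed

lemma cproj_const: "M \<ge> 1 \<Longrightarrow> cproj M (tup M (\<lambda>_. x)) = 0"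
  by (intro fvec_eqI) (simp add: cproj_def scaleR_conv_of_real sum_constant_scaleR)

section \<open>Matrices acting on tuples\<close>

lemma coord_mat_act: "coord (mat_act A z) i = (if i < dim_row A then \<Sum>j<dim_col A. A $$ (i, j) *\<^sub>R coord z j else 0)"
  by (simp add: mat_act_def)

lemma linear_mat_act: "linear (mat_act A)"
  by (intro linearI fvec_eqI)
    (auto simp: coord_mat_act sum.distrib scaleR_add_right scaleR_sum_right mult.commute)

lemma mat_act_mult:
  assumes "A \<in> carrier_mat M M" "B \<in> carrier_mat M M"
  shows "mat_act (A * B) z = mat_act A (mat_act B z)"
proof (intro fvec_eqI)
  fix i
  have d: "dim_row A = M" "dim_col A = M" "dim_row B = M" "dim_col B = M" using assms by auto
  have "(\<Sum>j<M. (A * B) $$ (i, j) *\<^sub>R coord z j) = (\<Sum>k<M. A $$ (i, k) *\<^sub>R (\<Sum>j<M. B $$ (k, j) *\<^sub>R coord z j))" if "i < M"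
  proof -
    have "(\<Sum>j<M. (A * B) $$ (i, j) *\<^sub>R coord z j) = (\<Sum>j<M. \<Sum>k<M. (A $$ (i, k) * B $$ (k, j)) *\<^sub>R coord z j)"
      using that by (intro sum.cong refl)
        (simp add: d times_mat_def scalar_prod_def scaleR_sum_left atLeast0LessThan)
    also have "\<dots> = (\<Sum>k<M. \<Sum>j<M. (A $$ (i, k) * B $$ (k, j)) *\<^sub>R coord z j)" by (rule sum.swap)
    finally show ?thesis by (simp add: scaleR_sum_right)
  qed
  then show "coord (mat_act (A * B) z) i = coord (mat_act A (mat_act B z)) i"
    by (simp add: coord_mat_act d)
qed

lemma mat_act_one_minus:
  assumes "A \<in> carrier_mat M M"
  shows "mat_act (1\<^sub>m M - A) z = tup M (coord z) - mat_act A z"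
proof (intro fvec_eqI)
  fix i
  have d: "dim_row A = M" "dim_col A = M" using assms by auto
  have "(\<Sum>j<M. (1\<^sub>m M - A) $$ (i, j) *\<^sub>R coord z j) = (\<Sum>j<M. (if j = i then coord z j else 0) - A $$ (i, j) *\<^sub>R coord z j)"
    if "i < M" using that by (intro sum.cong refl) (auto simp: d scaleR_diff_left)
  then show "coord (mat_act (1\<^sub>m M - A) z) i = coord (tup M (coord z) - mat_act A z) i"
    by (simp add: coord_mat_act d sum_subtractf)
qed

lemma mix_carrier: "(\<And>t. W t \<in> carrier_mat M M) \<Longrightarrow> mix M W t T \<in> carrier_mat M M"
  by (induction T) (auto intro!: mult_carrier_mat[of _ M M] minus_carrier_mat)

lemma mat_act_in: "A \<in> carrier_mat M M \<Longrightarrow> z \<in> Rtup M d \<Longrightarrow> mat_act A z \<in> Rtup M d"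
  unfolding mat_act_def using subspace_Rn[of d]
  by (auto intro!: tup_in_Rtup subspace_sum subspace_scale simp: coord_Rtup)

section \<open>The multi-step gossip operator\<close>

locale gossip =
  fixes M B :: nat and E W T and chi :: real
  assumes M: "M \<ge> 1" and network: "time_varying_network M B E W"
    and contr: "contraction M W T chi"
begin

lemma W_carrier: "W t \<in> carrier_mat M M"
  using network by (simp add: time_varying_network_def)

definition A :: "nat \<Rightarrow> real fvec fvec \<Rightarrow> real fvec fvec" where
  "A t = mat_act (multi_gossip M W T t)"

lemma gossip_carrier: "multi_gossip M W T t \<in> carrier_mat M M"
  unfolding multi_gossip_def by (intro minus_carrier_mat mix_carrier W_carrier)

lemma row_sum: "i < M \<Longrightarrow> (\<Sum>j<M. W t $$ (i, j)) = 0"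
proof -
  assume i: "i < M"
  have "mat_act (W t) (tup M (\<lambda>_. 1 :: real)) = 0"
    using network by (simp add: time_varying_network_def)
  then have "coord (mat_act (W t) (tup M (\<lambda>_. 1 :: real))) i = 0" by simp
  then show ?thesis using i W_carrier[of t] by (simp add: coord_mat_act)
qed

text \<open>The range condition speaks of real vectors only. Testing it on unit vectors turns it
  into a statement about entries, which then applies to vector coefficients as well.\<close>

lemma column_sum: "j < M \<Longrightarrow> (\<Sum>i<M. W t $$ (i, j)) = 0"
proof -
  assume j: "j < M"
  define e where "e = tup M (\<lambda>k. if k = j then 1 else 0 :: real)"
  have "e \<in> Rn M" by (simp add: e_def Rn_def)
  then have "(\<Sum>m<M. coord (mat_act (W t) e) m) = 0"
    using network by (simp add: time_varying_network_def)
  moreover have "coord (mat_act (W t) e) m = W t $$ (m, j)" if "m < M" for m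
  proof -
    have "coord (mat_act (W t) e) m = (\<Sum>k<M. if k = j then W t $$ (m, k) else 0)"
      using that W_carrier[of t] by (simp add: coord_mat_act e_def if_distrib[of "\<lambda>x. _ * x"] cong: if_cong)
    then show ?thesis using j by simp
  qed
  ultimately show ?thesis by simp
qed

lemma sum_W: "(\<Sum>m<M. coord (mat_act (W t) z) m) = 0" for z :: "'a::real_inner fvec"
proof -
  have "(\<Sum>m<M. coord (mat_act (W t) z) m) = (\<Sum>m<M. \<Sum>j<M. W t $$ (m, j) *\<^sub>R coord z j)"
    using W_carrier[of t] by (simp add: coord_mat_act)
  also have "\<dots> = (\<Sum>j<M. (\<Sum>m<M. W t $$ (m, j)) *\<^sub>R coord z j)"
    by (subst sum.swap) (simp add: scaleR_sum_left)
  finally show ?thesis by (simp add: column_sum)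
qed

lemma W_const: "mat_act (W t) (tup M (\<lambda>_. x)) = 0" for x :: "'a::real_inner"
  using W_carrier[of t] row_sum by (intro fvec_eqI) (simp add: coord_mat_act scaleR_sum_left[symmetric])

lemma mix_Suc: "mat_act (mix M W t (Suc k)) z = mat_act (mix M W t k) z - mat_act (W (t + k)) (mat_act (mix M W t k) z)"
  for z :: "'a::real_inner fvec"
proof -
  have c: "mix M W t k \<in> carrier_mat M M" by (rule mix_carrier[OF W_carrier])
  have "mat_act (mix M W t (Suc k)) z = mat_act (1\<^sub>m M - W (t + k)) (mat_act (mix M W t k) z)"
    using W_carrier c by (simp only: mix.simps) (rule mat_act_mult, auto intro: minus_carrier_mat)
  also have "\<dots> = tup M (coord (mat_act (mix M W t k) z)) - mat_act (W (t + k)) (mat_act (mix M W t k) z)"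
    by (rule mat_act_one_minus[OF W_carrier])
  also have "tup M (coord (mat_act (mix M W t k) z)) = mat_act (mix M W t k) z"
    using c by (intro fvec_eqI) (auto simp: coord_mat_act)
  finally show ?thesis .
qed

lemma mix_0: "mat_act (1\<^sub>m M) z = tup M (coord z)" for z :: "'a::real_inner fvec"
proof (intro fvec_eqI)
  fix i
  have "(\<Sum>j<M. (1\<^sub>m M :: real mat) $$ (i, j) *\<^sub>R coord z j) = (\<Sum>j<M. if j = i then coord z j else 0)" if "i < M"
    using that by (intro sum.cong) auto
  then show "coord (mat_act (1\<^sub>m M) z) i = coord (tup M (coord z)) i"
    by (simp add: coord_mat_act)
qed

lemma A_eq: "A t z = tup M (coord z) - mat_act (mix M W t T) z"
  unfolding A_def multi_gossip_def by (rule mat_act_one_minus) (rule mix_carrier[OF W_carrier])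

lemma linear_A: "linear (A t)"
  unfolding A_def by (rule linear_mat_act)

lemma A_in: "z \<in> Rtup M d \<Longrightarrow> A t z \<in> Rtup M d"
  unfolding A_def by (rule mat_act_in[OF gossip_carrier])

lemma A_const: "A t (tup M (\<lambda>_. x)) = 0"
proof -
  have "mat_act (mix M W t k) (tup M (\<lambda>_. x)) = tup M (\<lambda>_. x)" for k
  proof (induction k)
    case 0
    show ?case by (simp add: mix_0) (rule fvec_eqI, simp)
  qed (simp add: mix_Suc W_const del: mix.simps)
  then show ?thesis by (simp add: A_eq) (rule fvec_eqI, simp)
qed

lemma sum_A: "(\<Sum>m<M. coord (A t z) m) = 0"
proof -
  have "(\<Sum>m<M. coord (mat_act (mix M W t k) z) m) = (\<Sum>m<M. coord z m)" for k
    by (induction k) (simp_all add: mix_0 mix_Suc sum_subtractf sum_W del: mix.simps(2))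
  then show ?thesis by (simp add: A_eq sum_subtractf)
qed

lemma cproj_A: "z \<in> Rtup M d \<Longrightarrow> cproj M (A t z) = A t z"
  by (rule cproj_id[OF sum_A A_in])

lemma A_cproj: "z \<in> Rtup M d \<Longrightarrow> A t (cproj M z) = A t z"
proof -
  assume z: "z \<in> Rtup M d"
  have "cproj M z = z - tup M (\<lambda>_. (1 / real M) *\<^sub>R (\<Sum>j<M. coord z j))"
    using z by (intro fvec_eqI) (auto simp: cproj_def Rtup_def)
  then show ?thesis by (simp add: linear_diff[OF linear_A] A_const)
qed

text \<open>The contraction is assumed on real vectors, one number per worker. Slicing a tuple by
  the coordinate \<open>i\<close> of its entries decomposes the Kronecker product with the identity
  into copies of the matrix.\<close>

definition slice :: "nat \<Rightarrow> real fvec fvec \<Rightarrow> real fvec" where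
  "slice i z = tup M (\<lambda>m. coord (coord z m) i)"

lemma norm_slices:
  assumes z: "z \<in> Rtup M d"
  shows "(norm z)\<^sup>2 = (\<Sum>i<d. (norm (slice i z))\<^sup>2)"
proof -
  have "(norm z)\<^sup>2 = (\<Sum>m<M. \<Sum>i<d. (coord (coord z m) i)\<^sup>2)"
    unfolding norm_Rtup_sq[OF z] using z by (intro sum.cong refl norm_Rn_sq) (auto simp: coord_Rtup)
  also have "\<dots> = (\<Sum>i<d. (norm (slice i z))\<^sup>2)"
    by (subst sum.swap) (simp add: slice_def norm_tup_sq)
  finally show ?thesis .
qed

lemma slice_A: "slice i (A t z) = mat_act (multi_gossip M W T t) (slice i z)"
proof -
  have d: "dim_row (multi_gossip M W T t) = M" "dim_col (multi_gossip M W T t) = M"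
    using gossip_carrier[of t] by auto
  show ?thesis
    by (intro fvec_eqI) (simp add: slice_def A_def coord_mat_act d coord_sum)
qed

lemma A_contraction:
  assumes z: "z \<in> Rtup M d" and s: "(\<Sum>m<M. coord z m) = 0"
  shows "(norm (z - A t z))\<^sup>2 \<le> (1 - inverse chi) * (norm z)\<^sup>2"
proof -
  have "(norm (z - A t z))\<^sup>2 = (\<Sum>i<d. (norm (slice i (z - A t z)))\<^sup>2)"
    using z by (intro norm_slices subspace_diff[OF subspace_Rtup] A_in)
  also have "\<dots> = (\<Sum>i<d. (norm (mat_act (multi_gossip M W T t) (slice i z) - slice i z))\<^sup>2)"
  proof (intro sum.cong refl)
    fix i
    have "slice i (z - A t z) = slice i z - slice i (A t z)"
      by (intro fvec_eqI) (simp add: slice_def)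
    then show "(norm (slice i (z - A t z)))\<^sup>2 = (norm (mat_act (multi_gossip M W T t) (slice i z) - slice i z))\<^sup>2"
      by (simp add: slice_A norm_minus_commute)
  qed
  also have "\<dots> \<le> (\<Sum>i<d. (1 - inverse chi) * (norm (slice i z))\<^sup>2)"
  proof (intro sum_mono)
    fix i
    have "(\<Sum>m<M. coord (slice i z) m) = coord (\<Sum>m<M. coord z m) i"
      by (simp add: slice_def coord_sum)
    then have "(\<Sum>m<M. coord (slice i z) m) = 0" using s by simp
    moreover have "slice i z \<in> Rn M" by (simp add: slice_def Rn_def)
    ultimately show "(norm (mat_act (multi_gossip M W T t) (slice i z) - slice i z))\<^sup>2 \<le> (1 - inverse chi) * (norm (slice i z))\<^sup>2"
      using contr by (simp add: contraction_def)
  qed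
  also have "\<dots> = (1 - inverse chi) * (norm z)\<^sup>2"
    using norm_slices[OF z] by (simp add: sum_distrib_left)
  finally show ?thesis .
qed

lemma A_inner_ge:
  assumes u: "u \<in> Rtup M d"
  shows "inverse chi / 2 * (norm (cproj M u))\<^sup>2 + (norm (A t u))\<^sup>2 / 2 \<le> inner u (A t u)"
proof -
  let ?v = "cproj M u"
  have "(norm (?v - A t ?v))\<^sup>2 \<le> (1 - inverse chi) * (norm ?v)\<^sup>2"
    by (rule A_contraction[OF cproj_in[OF u] sum_coord_cproj[OF M]])
  moreover have "(norm (?v - A t ?v))\<^sup>2 = (norm ?v)\<^sup>2 - 2 * inner ?v (A t ?v) + (norm (A t ?v))\<^sup>2"
    by (simp only: power2_norm_eq_inner) (simp add: inner_simps inner_commute)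
  moreover have "inner ?v (A t u) = inner u (A t u)"
    by (simp add: cproj_commute cproj_A[OF u])
  ultimately show ?thesis by (simp add: A_cproj[OF u] algebra_simps)
qed

end

lemma orthogonal_consensus_imp_cproj:
  assumes "M \<ge> 1" "x \<in> Rtup M d" "x \<in> orthogonal_comp (consensus M d)"
  shows "cproj M x = x"
proof (rule cproj_id[OF _ assms(2)])
  \<comment> \<open>Orthogonality is tested against the constant tuple whose entry is this sum
    itself.\<close>
  let ?s = "\<Sum>m<M. coord x m"
  have "?s \<in> Rn d" using assms(2) by (intro subspace_sum subspace_Rn) (auto simp: coord_Rtup)
  then have "tup M (\<lambda>_. ?s) \<in> consensus M d" by (simp add: consensus_def tup_in_Rtup)
  then have "inner (tup M (\<lambda>_. ?s)) x = 0"
    using assms(3) by (auto simp: orthogonal_comp_def real_inner_class.orthogonal_def)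
  then have "inner ?s ?s = 0" by (simp add: inner_tup inner_sum_right)
  then show "?s = 0" by simp
qed

section \<open>Proximal points\<close>

text \<open>The ambient space of finitely supported sequences is not complete, so limits of
  minimising sequences have to be found inside one fixed dimension.\<close>

lemma complete_Rn: "uniform_space_class.complete (Rn d)"
  unfolding metric_space_class.complete_def
proof (intro allI impI)
  fix X :: "nat \<Rightarrow> real fvec"
  assume "(\<forall>n. X n \<in> Rn d) \<and> Cauchy X"
  then have X: "\<And>n. X n \<in> Rn d" and C: "Cauchy X" by auto
  have le: "\<bar>coord x i\<bar> \<le> norm x" if "x \<in> Rn d" for x i
  proof (cases "i < d")
    case True
    then have "(coord x i)\<^sup>2 \<le> (norm x)\<^sup>2"
      unfolding norm_Rn_sq[OF that] by (intro member_le_sum) auto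
    then show ?thesis by (simp add: abs_le_square_iff[symmetric])
  qed (use that in \<open>simp add: Rn_def\<close>)
  have "Cauchy (\<lambda>n. coord (X n) i)" for i
    unfolding Cauchy_def
  proof (intro allI impI)
    fix e :: real assume "e > 0"
    then obtain N where N: "\<And>m n. m \<ge> N \<Longrightarrow> n \<ge> N \<Longrightarrow> norm (X m - X n) < e"
      using C unfolding Cauchy_def dist_norm by blast
    have "\<bar>coord (X m) i - coord (X n) i\<bar> \<le> norm (X m - X n)" for m n
      using le[of "X m - X n" i] X subspace_diff[OF subspace_Rn] by simp
    then show "\<exists>N. \<forall>m\<ge>N. \<forall>n\<ge>N. dist (coord (X m) i) (coord (X n) i) < e"
      unfolding dist_real_def using N by (meson le_less_trans)
  qed
  then have "\<exists>l. (\<lambda>n. coord (X n) i) \<longlonglongrightarrow> l" for i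
    using real_Cauchy_convergent convergent_def by blast
  then obtain l where l: "\<And>i. (\<lambda>n. coord (X n) i) \<longlonglongrightarrow> l i" by metis
  have L: "tup d l \<in> Rn d" by (simp add: Rn_def)
  have "(\<lambda>n. sqrt (\<Sum>i<d. (coord (X n) i - l i)\<^sup>2)) \<longlonglongrightarrow> sqrt (\<Sum>i<d. (l i - l i)\<^sup>2)"
    by (intro tendsto_intros l)
  moreover have "norm (X n - tup d l) = sqrt (\<Sum>i<d. (coord (X n) i - l i)\<^sup>2)" for n
  proof -
    have "(norm (X n - tup d l))\<^sup>2 = (\<Sum>i<d. (coord (X n) i - l i)\<^sup>2)"
      using X L by (subst norm_Rn_sq[of _ d]) (auto intro!: subspace_diff[OF subspace_Rn])
    then show ?thesis by (metis norm_ge_zero real_sqrt_unique)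
  qed
  ultimately have "X \<longlonglongrightarrow> tup d l"
    by (subst LIM_zero_iff[symmetric], subst tendsto_norm_zero_iff[symmetric]) simp
  then show "\<exists>l\<in>Rn d. X \<longlonglongrightarrow> l" using L by blast
qed

lemma convex_Rn: "convex (Rn d)"
  using subspace_Rn by (rule subspace_imp_convex)

lemma nonneg_of_small_perturbation:
  fixes a b :: real
  assumes "\<And>t. 0 < t \<Longrightarrow> t < 1 \<Longrightarrow> 0 \<le> a + t * b"
  shows "0 \<le> a"
proof (rule ccontr)
  assume a: "\<not> 0 \<le> a"
  define c where "c = \<bar>b\<bar> + 1"
  have c: "0 < c" "b \<le> c" by (auto simp: c_def)
  \<comment> \<open>Chosen so that \<open>t * b \<le> t * c \<le> - a / 2\<close>, while
    \<open>1/2\<close> keeps it below 1.\<close>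
  define t where "t = min (1/2) (- a / (2 * c))"
  have "0 < - a / (2 * c)" using a c by (intro divide_pos_pos) auto
  then have t0: "0 < t" unfolding t_def min_less_iff_conj by simp
  have t1: "t \<le> 1/2" unfolding t_def by (rule min.cobounded1)
  have "t * b \<le> t * c" using t0 c by (intro mult_left_mono) auto
  also have "\<dots> \<le> - a / (2 * c) * c" using c unfolding t_def by (intro mult_right_mono) auto
  also have "\<dots> = - a / 2" using c by simp
  finally show False using assms[OF t0] t1 a by linarith
qed

text \<open>Compare \<open>u\<close> with the point at parameter \<open>t\<close> on the segment to
  \<open>z\<close>: convexity bounds the change of \<open>H\<close> linearly in \<open>t\<close>,
  the square contributes a linear and a quadratic term, and dividing by \<open>t\<close> leaves the
  first-order condition.\<close>

lemma prox_variational: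
  fixes u v :: "'a::real_inner"
  assumes H: "convex_on D H" and u: "u \<in> D" and z: "z \<in> D" and \<kappa>: "\<kappa> \<ge> 0"
    and min: "\<And>y. y \<in> D \<Longrightarrow> \<kappa> * H u + 1/2 * (norm (u - v))\<^sup>2 \<le> \<kappa> * H y + 1/2 * (norm (y - v))\<^sup>2"
  shows "\<kappa> * H u + inner (v - u) (z - u) \<le> \<kappa> * H z"
proof -
  have "0 \<le> (\<kappa> * H z - \<kappa> * H u + inner (u - v) (z - u)) + t * (1/2 * (norm (z - u))\<^sup>2)" if t: "0 < t" "t < 1" for t
  proof -
    define y where "y = (1 - t) *\<^sub>R u + t *\<^sub>R z"
    have D: "convex D" using H by (rule convex_on_imp_convex)
    have y: "y \<in> D" using D u z t unfolding y_def by (intro convexD_alt) auto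
    have "H y \<le> (1 - t) * H u + t * H z"
      unfolding y_def using t by (intro convex_onD[OF H]) (auto simp: u z)
    then have "\<kappa> * H y \<le> \<kappa> * ((1 - t) * H u + t * H z)" using \<kappa> by (rule mult_left_mono)
    then have 1: "\<kappa> * H y \<le> \<kappa> * H u + t * (\<kappa> * H z - \<kappa> * H u)" by (simp add: algebra_simps)
    have yv: "y - v = (u - v) + t *\<^sub>R (z - u)" by (simp add: y_def algebra_simps)
    have 2: "(norm (y - v))\<^sup>2 = (norm (u - v))\<^sup>2 + 2 * t * inner (u - v) (z - u) + t\<^sup>2 * (norm (z - u))\<^sup>2"
      unfolding yv by (simp only: power2_norm_eq_inner inner_add_left inner_add_right)
        (simp add: inner_commute power2_eq_square power2_norm_eq_inner[symmetric])
    have "0 \<le> t * ((\<kappa> * H z - \<kappa> * H u + inner (u - v) (z - u)) + t * (1/2 * (norm (z - u))\<^sup>2))"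
      using min[OF y] 1 2 by (simp add: power2_eq_square algebra_simps)
    then show ?thesis using t by (simp add: zero_le_mult_iff)
  qed
  then have "0 \<le> \<kappa> * H z - \<kappa> * H u + inner (u - v) (z - u)" by (rule nonneg_of_small_perturbation)
  then show ?thesis by (simp add: inner_diff_left)
qed

text \<open>The effective domain, on which a proper function is finite and can be handled as a
  real-valued convex function.\<close>

definition edom :: "'a set \<Rightarrow> ('a \<Rightarrow> ereal) \<Rightarrow> 'a set" where
  "edom S h = {x \<in> S. h x < \<infinity>}"

lemma ereal_real_edom: "proper_on S h \<Longrightarrow> x \<in> edom S h \<Longrightarrow> h x = ereal (real_of_ereal (h x))"
  by (cases "h x") (auto simp: proper_on_def edom_def)

lemma convex_on_edom:
  assumes "convex S" "proper_on S h" "ereal_convex_on S h"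
  shows "convex_on (edom S h) (\<lambda>x. real_of_ereal (h x))"
proof -
  have le: "(1 - t) *\<^sub>R x + t *\<^sub>R y \<in> edom S h \<and>
     real_of_ereal (h ((1 - t) *\<^sub>R x + t *\<^sub>R y)) \<le> (1 - t) * real_of_ereal (h x) + t * real_of_ereal (h y)"
    if "0 < t" "t < 1" "x \<in> edom S h" "y \<in> edom S h" for t x y
  proof -
    let ?m = "(1 - t) *\<^sub>R x + t *\<^sub>R y"
    have S: "?m \<in> S" using that assms(1) by (intro convexD_alt) (auto simp: edom_def)
    have "h ?m \<le> ereal (1 - t) * h x + ereal t * h y"
      using assms(3) that by (auto simp: ereal_convex_on_def edom_def)
    also have "\<dots> = ereal ((1 - t) * real_of_ereal (h x) + t * real_of_ereal (h y))"
      by (subst (1 2) ereal_real_edom[OF assms(2)]) (use that in auto)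
    finally have *: "h ?m \<le> ereal ((1 - t) * real_of_ereal (h x) + t * real_of_ereal (h y))" .
    then have "?m \<in> edom S h" using S by (auto simp: edom_def intro: le_less_trans)
    then show ?thesis using * ereal_real_edom[OF assms(2), of ?m] by (metis ereal_less_eq(3))
  qed
  have "convex (edom S h)"
    unfolding convex_alt
  proof (intro ballI allI impI)
    fix x y u assume *: "x \<in> edom S h" "y \<in> edom S h" "0 \<le> u \<and> u \<le> (1::real)"
    consider "u = 0" | "u = 1" | "0 < u" "u < 1" using * by linarith
    then show "(1 - u) *\<^sub>R x + u *\<^sub>R y \<in> edom S h" using le * by cases auto
  qed
  then show ?thesis using le by (intro convex_onI) auto
qed

text \<open>The direct method with strong convexity in place of compactness: minimising sequences
  are Cauchy, completeness gives a limit, and lower semicontinuity makes it a minimiser. The affine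
  minorant, by completing the square, bounds the objective from below.\<close>

lemma prox_exists:
  fixes S :: "'a::real_inner set"
  assumes S: "uniform_space_class.complete S" "convex S" and h: "proper_on S h" "lsc_on S h" "ereal_convex_on S h"
    and minor: "\<And>x. x \<in> edom S h \<Longrightarrow> c + inner a x \<le> real_of_ereal (h x)" and \<kappa>: "\<kappa> > 0"
  shows "\<exists>u\<in>edom S h. \<forall>y\<in>edom S h. \<kappa> * real_of_ereal (h u) + 1/2 * (norm (u - v))\<^sup>2
     \<le> \<kappa> * real_of_ereal (h y) + 1/2 * (norm (y - v))\<^sup>2"
proof -
  define D where "D = edom S h"
  define H where "H x = real_of_ereal (h x)" for x
  define \<phi> where "\<phi> x = \<kappa> * H x + 1/2 * (norm (x - v))\<^sup>2" for x
  have hH: "h x = ereal (H x)" if "x \<in> D" for x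
    using ereal_real_edom[OF h(1)] that by (simp add: D_def H_def)
  have cH: "convex_on D H" unfolding D_def H_def by (rule convex_on_edom[OF S(2) h(1,3)])
  have cD: "convex D" using cH by (rule convex_on_imp_convex)
  have ne: "D \<noteq> {}" using h(1) by (auto simp: D_def edom_def proper_on_def)
  have bdd: "bdd_below (\<phi> ` D)"
  proof (rule bdd_belowI2)
    fix x assume x: "x \<in> D"
    have 1: "\<kappa> * (c + inner a x) \<le> \<kappa> * H x" using minor x \<kappa> by (intro mult_left_mono) (auto simp: D_def H_def)
    have "(norm (\<kappa> *\<^sub>R a + (x - v)))\<^sup>2 = \<kappa>\<^sup>2 * (norm a)\<^sup>2 + 2 * \<kappa> * inner a (x - v) + (norm (x - v))\<^sup>2"
      by (simp only: power2_norm_eq_inner inner_add_left inner_add_right)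
        (simp add: inner_commute power2_eq_square power2_norm_eq_inner[symmetric])
    then have 2: "0 \<le> \<kappa>\<^sup>2 * (norm a)\<^sup>2 + 2 * \<kappa> * inner a (x - v) + (norm (x - v))\<^sup>2"
      by (metis zero_le_power2)
    show "\<kappa> * c + \<kappa> * inner a v - 1/2 * (\<kappa>\<^sup>2 * (norm a)\<^sup>2) \<le> \<phi> x"
      using 1 2 by (simp add: \<phi>_def inner_diff_right distrib_left right_diff_distrib)
  qed
  define I where "I = Inf (\<phi> ` D)"
  have I: "I \<le> \<phi> x" if "x \<in> D" for x unfolding I_def using bdd that by (rule cINF_lower)
  \<comment> \<open>The parallelogram law at the midpoint, whose value is at least the infimum
    \<open>I\<close>.\<close>
  have mid: "(norm (x - y))\<^sup>2 \<le> 4 * (\<phi> x - I) + 4 * (\<phi> y - I)" if "x \<in> D" "y \<in> D" for x y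
  proof -
    define m where "m = (1 - 1/2) *\<^sub>R x + (1/2) *\<^sub>R y"
    have m: "m \<in> D" using cD that unfolding m_def by (intro convexD_alt) auto
    have "H m \<le> (1 - 1/2) * H x + 1/2 * H y" unfolding m_def using that by (intro convex_onD[OF cH]) auto
    then have "\<kappa> * H m \<le> \<kappa> * ((1 - 1/2) * H x + 1/2 * H y)" using \<kappa> by (intro mult_left_mono) auto
    moreover have "(norm (m - v))\<^sup>2 = 1/2 * (norm (x - v))\<^sup>2 + 1/2 * (norm (y - v))\<^sup>2 - 1/4 * (norm (x - y))\<^sup>2"
    proof -
      have mv: "m - v = (1/2) *\<^sub>R ((x - v) + (y - v))" and xy: "x - y = (x - v) - (y - v)"
        by (simp_all add: m_def algebra_simps flip: scaleR_add_left)
      show ?thesis unfolding mv xy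
        by (simp only: power2_norm_eq_inner inner_add_left inner_add_right inner_diff_left[of "x - v" "y - v"]
            inner_diff_right[of _ "x - v" "y - v"] inner_scaleR_left inner_scaleR_right)
          (simp add: inner_commute[of "y - v" "x - v"] power2_norm_eq_inner[symmetric] field_simps)
    qed
    ultimately show ?thesis using I[OF m] by (simp add: \<phi>_def algebra_simps)
  qed
  have "\<exists>x\<in>D. \<phi> x < I + inverse (real (Suc k))" for k
    using cInf_lessD[of "\<phi> ` D" "I + inverse (real (Suc k))"] ne by (auto simp: I_def)
  then obtain X where X: "\<And>k. X k \<in> D" "\<And>k. \<phi> (X k) < I + inverse (real (Suc k))" by metis
  have "Cauchy X"
  proof (rule metric_CauchyI)
    fix e :: real assume e: "e > 0"
    obtain N where "inverse (real (Suc N)) < e\<^sup>2 / 8" using reals_Archimedean[of "e\<^sup>2 / 8"] e by auto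
    then obtain r where r: "inverse (real (Suc N)) = r" "r < e\<^sup>2 / 8" by blast
    have le: "\<phi> (X k) < I + r" if "k \<ge> N" for k
    proof (rule less_le_trans[OF X(2)])
      have "inverse (real (Suc k)) \<le> inverse (real (Suc N))"
        using that by (intro le_imp_inverse_le) auto
      then show "I + inverse (real (Suc k)) \<le> I + r" unfolding r by simp
    qed
    have "dist (X m) (X n) < e" if "m \<ge> N" "n \<ge> N" for m n
    proof -
      have "(norm (X m - X n))\<^sup>2 < e\<^sup>2"
        using mid[OF X(1) X(1), of m n] le[OF that(1)] le[OF that(2)] r(2) by argo
      then show ?thesis using e by (simp add: dist_norm power_less_imp_less_base)
    qed
    then show "\<exists>N. \<forall>m\<ge>N. \<forall>n\<ge>N. dist (X m) (X n) < e" by blast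
  qed
  moreover have "X k \<in> S" for k using X(1) by (simp add: D_def edom_def)
  ultimately obtain u where u: "u \<in> S" "X \<longlonglongrightarrow> u" using S(1) unfolding metric_space_class.complete_def by blast
  \<comment> \<open>Whether \<open>h u\<close> is finite is still open, so semicontinuity is used
    through real levels \<open>r\<close> below it; finiteness then follows from the bound on all
    such levels.\<close>
  have lim: "r \<le> (I - 1/2 * (norm (u - v))\<^sup>2) / \<kappa>" if r: "ereal r < h u" for r
  proof -
    have "h u \<le> Liminf (at u within S) h" using h(2) u(1) by (simp add: lsc_on_def)
    then have "ereal r < Liminf (at u within S) h" using r by (rule less_le_trans[rotated])
    then have "eventually (\<lambda>y. ereal r < h y) (at u within S)" by (rule less_LiminfD)
    then obtain \<delta> where \<delta>: "\<delta> > 0" "\<And>y. y \<in> S \<Longrightarrow> y \<noteq> u \<Longrightarrow> dist y u < \<delta> \<Longrightarrow> ereal r < h y"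
      unfolding eventually_at by blast
    have "eventually (\<lambda>k. dist (X k) u < \<delta>) sequentially" using u(2) \<delta>(1) by (rule tendstoD)
    then have ev: "eventually (\<lambda>k. \<kappa> * r + 1/2 * (norm (X k - v))\<^sup>2 \<le> I + inverse (real (Suc k))) sequentially"
    proof eventually_elim
      case (elim k)
      have "X k \<in> S" using X(1) by (simp add: D_def edom_def)
      \<comment> \<open>The punctured neighbourhood filter says nothing at \<open>u\<close>, hence
        the case \<open>X k = u\<close>.\<close>
      then have "ereal r < h (X k)" using \<delta>(2)[OF _ _ elim] r by (cases "X k = u") auto
      then have "r < H (X k)" using hH[OF X(1)] by simp
      then have "\<kappa> * r \<le> \<kappa> * H (X k)" using \<kappa> by simp
      then show ?case using X(2)[of k] by (simp add: \<phi>_def)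
    qed
    have "(\<lambda>k. I + inverse (real (Suc k))) \<longlonglongrightarrow> I + 0"
      by (intro tendsto_add tendsto_const LIMSEQ_inverse_real_of_nat)
    moreover have "(\<lambda>k. \<kappa> * r + 1/2 * (norm (X k - v))\<^sup>2) \<longlonglongrightarrow> \<kappa> * r + 1/2 * (norm (u - v))\<^sup>2"
      by (intro tendsto_intros u(2))
    ultimately have "\<kappa> * r + 1/2 * (norm (u - v))\<^sup>2 \<le> I + 0"
      using ev by (rule tendsto_le[OF sequentially_bot])
    then show ?thesis using \<kappa> by (simp add: field_simps)
  qed
  have hu: "h u \<le> ereal ((I - 1/2 * (norm (u - v))\<^sup>2) / \<kappa>)"
  proof (rule ccontr)
    assume "\<not> ?thesis"
    then obtain r where "ereal ((I - 1/2 * (norm (u - v))\<^sup>2) / \<kappa>) < ereal r" "ereal r < h u"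
      using ereal_dense2 by (metis not_le)
    then show False using lim[of r] by simp
  qed
  then have uD: "u \<in> D" using u(1) by (auto simp: D_def edom_def intro: le_less_trans)
  then have "H u \<le> (I - 1/2 * (norm (u - v))\<^sup>2) / \<kappa>" using hu hH by simp
  then have "\<phi> u \<le> I" using \<kappa> by (simp add: \<phi>_def field_simps)
  then show ?thesis using uD I unfolding D_def \<phi>_def H_def by (meson order_trans)
qed

section \<open>The lifted problem\<close>

lemma sum_norm_centered:
  fixes a :: "nat \<Rightarrow> 'a::real_inner"
  assumes "n \<ge> 1"
  shows "(\<Sum>i<n. (norm (a i - (1 / real n) *\<^sub>R (\<Sum>j<n. a j)))\<^sup>2)
    = (\<Sum>i<n. (norm (a i))\<^sup>2) - n * (norm ((1 / real n) *\<^sub>R (\<Sum>j<n. a j)))\<^sup>2"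
proof -
  define m where "m = (1 / real n) *\<^sub>R (\<Sum>j<n. a j)"
  have s: "(\<Sum>j<n. a j) = real n *\<^sub>R m" using assms by (simp add: m_def)
  have "(\<Sum>i<n. (norm (a i - m))\<^sup>2) = (\<Sum>i<n. (norm (a i))\<^sup>2 - 2 * inner (a i) m + (norm m)\<^sup>2)"
    by (intro sum.cong refl) (simp only: power2_norm_eq_inner inner_diff_left inner_diff_right, simp add: inner_commute)
  also have "\<dots> = (\<Sum>i<n. (norm (a i))\<^sup>2) - 2 * inner (\<Sum>i<n. a i) m + n * (norm m)\<^sup>2"
    by (simp add: sum.distrib sum_subtractf inner_sum_left sum_distrib_left)
  finally show ?thesis unfolding s by (simp add: s power2_norm_eq_inner[symmetric] m_def[symmetric])
qed

lemma norm_mean_sq_le: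
  fixes a :: "nat \<Rightarrow> 'a::real_inner"
  assumes "n \<ge> 1"
  shows "(norm ((1 / real n) *\<^sub>R (\<Sum>j<n. a j)))\<^sup>2 \<le> (1 / real n) * (\<Sum>i<n. (norm (a i))\<^sup>2)"
proof -
  have "0 \<le> (\<Sum>i<n. (norm (a i - (1 / real n) *\<^sub>R (\<Sum>j<n. a j)))\<^sup>2)" by (intro sum_nonneg) auto
  then have "n * (norm ((1 / real n) *\<^sub>R (\<Sum>j<n. a j)))\<^sup>2 \<le> (\<Sum>i<n. (norm (a i))\<^sup>2)"
    unfolding sum_norm_centered[OF assms] by simp
  then show ?thesis using assms by (simp add: field_simps)
qed

lemma finite_batch_pmf: "n \<ge> 1 \<Longrightarrow> finite (set_pmf (batch_pmf M n b))"
  unfolding batch_pmf_def sampling_def[symmetric] by (intro finite_sampling) auto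

text \<open>The noise is a sum of independent centred tuples, one for each worker and batch
  position. There are \<open>b\<close> positions with weight \<open>1 / b\<close> each, so the
  squared weights sum to \<open>1 / b\<close>; centring only lowers the second moment.\<close>

lemma batch_noise:
  fixes h :: "nat \<Rightarrow> nat \<Rightarrow> real fvec" and M n b :: nat
  assumes n: "n \<ge> 1" and b: "b \<ge> 1"
  defines "noise \<equiv> \<lambda>J. (1 / real b) *\<^sub>R (\<Sum>l<b. tup M (\<lambda>m. h m (J (m, l))))
     - tup M (\<lambda>m. (1 / real n) *\<^sub>R (\<Sum>i<n. h m i))"
  shows "measure_pmf.expectation (batch_pmf M n b) (\<lambda>J. inner (noise J) u) = 0"
    and "measure_pmf.expectation (batch_pmf M n b) (\<lambda>J. (norm (noise J))\<^sup>2)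
      \<le> (1 / real b) * (\<Sum>m<M. (1 / real n) * (\<Sum>i<n. (norm (h m i))\<^sup>2))"
proof -
  define mean where "mean m = (1 / real n) *\<^sub>R (\<Sum>i<n. h m i)" for m
  \<comment> \<open>Each summand lives in the coordinate of its own worker, so that one independence
    argument over the pairs covers all workers.\<close>
  define v where "v x i = tup M (\<lambda>m. if m = fst x then (1 / real b) *\<^sub>R (h m i - mean m) else 0)"
    for x :: "nat \<times> nat" and i
  let ?S = "{..<M} \<times> {..<b}"
  have v0: "(\<Sum>i<n. v x i) = 0" for x
  proof (rule fvec_eqI)
    fix k
    have "(\<Sum>i<n. (1 / real b) *\<^sub>R (h m i - mean m)) = 0" for m
      using n by (simp add: scaleR_right.sum[symmetric] sum_subtractf mean_def sum_constant_scaleR)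
    then show "coord (\<Sum>i<n. v x i) k = coord 0 k"
      by (cases "k < M"; cases "k = fst x") (simp_all add: coord_sum v_def)
  qed
  have noise: "noise J = (\<Sum>x\<in>?S. v x (J x))" for J
  proof (rule fvec_eqI)
    fix k
    have "coord (\<Sum>x\<in>?S. v x (J x)) k = (\<Sum>m<M. \<Sum>l<b. coord (v (m, l) (J (m, l))) k)"
      by (simp add: coord_sum sum.cartesian_product)
    also have "\<dots> = (\<Sum>m<M. if m = k then \<Sum>l<b. (1 / real b) *\<^sub>R (h k (J (k, l)) - mean k) else 0)"
    proof (intro sum.cong refl)
      fix m
      show "(\<Sum>l<b. coord (v (m, l) (J (m, l))) k)
          = (if m = k then \<Sum>l<b. (1 / real b) *\<^sub>R (h k (J (k, l)) - mean k) else 0)" if "m \<in> {..<M}"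
        using that by (cases "m = k"; cases "k < M") (simp_all add: v_def)
    qed
    also have "\<dots> = (if k < M then \<Sum>l<b. (1 / real b) *\<^sub>R (h k (J (k, l)) - mean k) else 0)"
      by simp
    also have "\<dots> = coord (noise J) k"
      using b by (simp add: noise_def coord_sum mean_def scaleR_right.sum[symmetric] sum_subtractf sum_constant_scaleR
          scaleR_diff_right)
    finally show "coord (noise J) k = coord (\<Sum>x\<in>?S. v x (J x)) k" by (rule sym)
  qed
  have B: "batch_pmf M n b = sampling ?S n" by (simp add: batch_pmf_def sampling_def)
  show "measure_pmf.expectation (batch_pmf M n b) (\<lambda>J. inner (noise J) u) = 0"
    unfolding B noise using v0 n by (intro expectation_sampling_inner) auto
  have "measure_pmf.expectation (batch_pmf M n b) (\<lambda>J. (norm (noise J))\<^sup>2)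
     = (\<Sum>x\<in>?S. (\<Sum>i<n. (norm (v x i))\<^sup>2) / n)"
    unfolding B noise using v0 n by (intro expectation_sampling_norm) auto
  also have "\<dots> = (\<Sum>m<M. \<Sum>l<b. (\<Sum>i<n. (norm (v (m, l) i))\<^sup>2) / n)"
    by (simp add: sum.cartesian_product)
  also have "\<dots> \<le> (\<Sum>m<M. \<Sum>l<b. (1 / (real b)\<^sup>2) * ((1 / real n) * (\<Sum>i<n. (norm (h m i))\<^sup>2)))"
  proof (intro sum_mono)
    fix m l assume m: "m \<in> {..<M}"
    have "(norm (v (m, l) i))\<^sup>2 = (1 / (real b)\<^sup>2) * (norm (h m i - mean m))\<^sup>2" for i
    proof -
      have "(norm (v (m, l) i))\<^sup>2 = (\<Sum>k<M. if k = m then (norm ((1 / real b) *\<^sub>R (h k i - mean k)))\<^sup>2 else 0)"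
        unfolding v_def norm_tup_sq by (intro sum.cong) auto
      then show ?thesis using m by (simp add: power_divide)
    qed
    then have "(\<Sum>i<n. (norm (v (m, l) i))\<^sup>2) = (1 / (real b)\<^sup>2) * (\<Sum>i<n. (norm (h m i - mean m))\<^sup>2)"
      by (simp add: sum_distrib_left)
    also have "(\<Sum>i<n. (norm (h m i - mean m))\<^sup>2) \<le> (\<Sum>i<n. (norm (h m i))\<^sup>2)"
      unfolding mean_def sum_norm_centered[OF n] by simp
    finally have "(\<Sum>i<n. (norm (v (m, l) i))\<^sup>2) \<le> (1 / (real b)\<^sup>2) * (\<Sum>i<n. (norm (h m i))\<^sup>2)"
      by (simp add: divide_right_mono)
    then have "(\<Sum>i<n. (norm (v (m, l) i))\<^sup>2) / n \<le> (1 / (real b)\<^sup>2) * (\<Sum>i<n. (norm (h m i))\<^sup>2) / n"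
      by (rule divide_right_mono) simp
    then show "(\<Sum>i<n. (norm (v (m, l) i))\<^sup>2) / n \<le> (1 / (real b)\<^sup>2) * ((1 / real n) * (\<Sum>i<n. (norm (h m i))\<^sup>2))"
      by simp
  qed
  also have "\<dots> = (1 / real b) * (\<Sum>m<M. (1 / real n) * (\<Sum>i<n. (norm (h m i))\<^sup>2))"
    using b by (simp add: sum_distrib_left power2_eq_square)
  finally show "measure_pmf.expectation (batch_pmf M n b) (\<lambda>J. (norm (noise J))\<^sup>2)
      \<le> (1 / real b) * (\<Sum>m<M. (1 / real n) * (\<Sum>i<n. (norm (h m i))\<^sup>2))" .
qed

section \<open>Operators, regulariser and proximal step on the lifted space\<close>

locale variational_problem =
  fixes d M n :: nat and F :: "nat \<Rightarrow> nat \<Rightarrow> real fvec \<Rightarrow> real fvec" and g :: "real fvec \<Rightarrow> ereal"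
    and L L' \<mu> :: real and zs :: "real fvec fvec"
  assumes d: "d \<ge> 1" and M: "M \<ge> 1" and n: "n \<ge> 1"
    and F_in: "\<And>m i x. m < M \<Longrightarrow> i < n \<Longrightarrow> x \<in> Rn d \<Longrightarrow> F m i x \<in> Rn d"
    and g: "proper_on (Rn d) g" "lsc_on (Rn d) g" "ereal_convex_on (Rn d) g"
    and L: "L > 0" "L' > 0" "\<mu> > 0"
    and lip: "\<And>m. m < M \<Longrightarrow> L-lipschitz_on (Rn d) (mean_op n F m)"
    and avg: "\<And>m. m < M \<Longrightarrow> average_lipschitz n L' (Rn d) (F m)"
    and mono: "\<And>m. m < M \<Longrightarrow> strongly_monotone \<mu> (Rn d) (mean_op n F m)"
    and vi: "vi_solution (consensus M d) (lift_op M (mean_op n F)) (lift_reg M g) zs"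
begin

abbreviation "FF \<equiv> lift_op M (mean_op n F)"

lemma mean_op_in: "m < M \<Longrightarrow> x \<in> Rn d \<Longrightarrow> mean_op n F m x \<in> Rn d"
  unfolding mean_op_def by (intro subspace_scale subspace_sum subspace_Rn F_in) auto

lemma FF_in: "z \<in> Rtup M d \<Longrightarrow> FF z \<in> Rtup M d"
  unfolding lift_op_def by (intro tup_in_Rtup mean_op_in) (auto simp: coord_Rtup)

lemma norm_lift_diff:
  "(norm (lift_op M G u - lift_op M G v))\<^sup>2 = (\<Sum>m<M. (norm (G m (coord u m) - G m (coord v m)))\<^sup>2)"
proof -
  have "lift_op M G u - lift_op M G v = tup M (\<lambda>m. G m (coord u m) - G m (coord v m))"
    by (intro fvec_eqI) (simp add: lift_op_def)
  then show ?thesis by (simp add: norm_tup_sq)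
qed

lemma norm_Rtup_diff:
  assumes "u \<in> Rtup M d" "v \<in> Rtup M d"
  shows "(norm (u - v))\<^sup>2 = (\<Sum>m<M. (norm (coord u m - coord v m))\<^sup>2)"
  using norm_Rtup_sq[OF subspace_diff[OF subspace_Rtup assms]] by simp

lemma FF_lipschitz:
  assumes uv: "u \<in> Rtup M d" "v \<in> Rtup M d"
  shows "norm (FF u - FF v) \<le> L * norm (u - v)"
proof -
  have "(norm (FF u - FF v))\<^sup>2 \<le> (\<Sum>m<M. (L * norm (coord u m - coord v m))\<^sup>2)"
    unfolding norm_lift_diff
    using lipschitz_onD[OF lip coord_Rtup[OF uv(1)] coord_Rtup[OF uv(2)]]
    by (intro sum_mono power_mono) (auto simp: dist_norm)
  also have "\<dots> = (L * norm (u - v))\<^sup>2"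
    by (simp add: power_mult_distrib norm_Rtup_diff[OF uv] sum_distrib_left)
  finally show ?thesis by (rule power2_le_imp_le) (use L in simp)
qed

lemma FF_mono:
  assumes uv: "u \<in> Rtup M d" "v \<in> Rtup M d"
  shows "\<mu> * (norm (u - v))\<^sup>2 \<le> inner (FF u - FF v) (u - v)"
proof -
  have "\<mu> * (norm (u - v))\<^sup>2 = (\<Sum>m<M. \<mu> * (norm (coord u m - coord v m))\<^sup>2)"
    by (simp add: norm_Rtup_diff[OF uv] sum_distrib_left)
  also have "\<dots> \<le> (\<Sum>m<M. inner (mean_op n F m (coord u m) - mean_op n F m (coord v m)) (coord u m - coord v m))"
    using mono coord_Rtup[OF uv(1)] coord_Rtup[OF uv(2)] by (intro sum_mono) (auto simp: strongly_monotone_def)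
  also have "\<dots> = inner (tup M (\<lambda>m. mean_op n F m (coord u m) - mean_op n F m (coord v m))) (u - v)"
    by (simp add: inner_tup)
  also have "tup M (\<lambda>m. mean_op n F m (coord u m) - mean_op n F m (coord v m)) = FF u - FF v"
    by (intro fvec_eqI) (simp add: lift_op_def)
  finally show ?thesis .
qed

lemma avg_sum:
  assumes uv: "u \<in> Rtup M d" "v \<in> Rtup M d"
  shows "(\<Sum>m<M. (1 / real n) * (\<Sum>i<n. (norm (F m i (coord u m) - F m i (coord v m)))\<^sup>2)) \<le> L'\<^sup>2 * (norm (u - v))\<^sup>2"
  unfolding norm_Rtup_diff[OF uv] sum_distrib_left[of "L'\<^sup>2"]
  using avg coord_Rtup[OF uv(1)] coord_Rtup[OF uv(2)]
  by (intro sum_mono) (auto simp: average_lipschitz_def)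

text \<open>Compare the constants on a unit vector, which exists since \<open>d \<ge> 1\<close>. For
  \<open>L'\<close>, the squared norm of the mean is at most the mean of the squared norms.\<close>

lemma mu_le: "\<mu> \<le> L" "\<mu> \<le> L'"
proof -
  define u :: "real fvec" where "u = tup 1 (\<lambda>_. 1)"
  have u: "u \<in> Rn d" "0 \<in> Rn d" using d by (auto simp: u_def Rn_def)
  have "(norm u)\<^sup>2 = 1\<^sup>2" unfolding u_def norm_tup_sq by simp
  then have nu: "norm u = 1" by (rule power2_eq_imp_eq) auto
  have M0: "0 < M" using M by simp
  let ?D = "mean_op n F 0 u - mean_op n F 0 0"
  have "\<mu> * (norm (u - 0))\<^sup>2 \<le> inner ?D (u - 0)"
    using mono[OF M0] u unfolding strongly_monotone_def by blast
  also have "\<dots> \<le> norm ?D * norm (u - 0)" by (rule norm_cauchy_schwarz)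
  finally have \<mu>: "\<mu> \<le> norm ?D" using nu by simp
  show "\<mu> \<le> L" using \<mu> lipschitz_onD[OF lip[OF M0] u] nu by (simp add: dist_norm)
  have D: "?D = (1 / real n) *\<^sub>R (\<Sum>i<n. F 0 i u - F 0 i 0)"
    by (simp add: mean_op_def sum_subtractf scaleR_diff_right)
  have "(norm ?D)\<^sup>2 \<le> (1 / real n) * (\<Sum>i<n. (norm (F 0 i u - F 0 i 0))\<^sup>2)"
    unfolding D by (rule norm_mean_sq_le[OF n])
  also have "\<dots> \<le> L'\<^sup>2 * (norm (u - 0))\<^sup>2"
    using avg[OF M0] u unfolding average_lipschitz_def by blast
  also have "\<dots> = L'\<^sup>2" by (simp add: nu)
  finally have "norm ?D \<le> L'" by (rule power2_le_imp_le) (use L in simp)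
  then show "\<mu> \<le> L'" using \<mu> by linarith
qed

definition dom where "dom = edom (Rn d) g"
definition gr where "gr x = real_of_ereal (g x)"
definition ldom where "ldom = {z \<in> Rtup M d. \<forall>m<M. coord z m \<in> dom}"
definition hr where "hr z = (1 / real M) * (\<Sum>m<M. gr (coord z m))"

lemma g_dom: "x \<in> dom \<Longrightarrow> g x = ereal (gr x)"
  unfolding dom_def gr_def by (rule ereal_real_edom[OF g(1)])

lemma lift_reg_ldom: "z \<in> ldom \<Longrightarrow> lift_reg M g z = ereal (hr z)"
  by (simp add: lift_reg_def ldom_def hr_def g_dom)

lemma lift_reg_infinite: "z \<in> Rtup M d \<Longrightarrow> z \<notin> ldom \<Longrightarrow> lift_reg M g z = \<infinity>"
proof -
  assume z: "z \<in> Rtup M d" "z \<notin> ldom"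
  then obtain m where m: "m < M" "coord z m \<notin> dom" by (auto simp: ldom_def)
  have "g (coord z m) = \<infinity>" using m z by (auto simp: dom_def edom_def coord_Rtup)
  then have "(\<Sum>m<M. g (coord z m)) = \<infinity>"
    using m by (subst sum_Pinfty) auto
  then show ?thesis using M by (simp add: lift_reg_def)
qed

lemma convex_gr: "convex_on dom gr"
  using convex_on_edom[OF convex_Rn g(1,3)] unfolding dom_def gr_def by blast

lemma convex_hr: "convex_on ldom hr"
proof -
  have cd: "convex dom" using convex_gr by (rule convex_on_imp_convex)
  have c: "convex ldom"
    unfolding convex_alt
  proof (intro ballI allI impI)
    fix x y u assume *: "x \<in> ldom" "y \<in> ldom" "0 \<le> u \<and> u \<le> (1::real)"
    then have "coord ((1 - u) *\<^sub>R x + u *\<^sub>R y) m \<in> dom" if "m < M" for m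
      using cd that by (auto simp: ldom_def intro: convexD_alt)
    moreover have "(1 - u) *\<^sub>R x + u *\<^sub>R y \<in> Rtup M d"
      using * by (intro subspace_add[OF subspace_Rtup] subspace_scale[OF subspace_Rtup]) (auto simp: ldom_def)
    ultimately show "(1 - u) *\<^sub>R x + u *\<^sub>R y \<in> ldom" by (simp add: ldom_def)
  qed
  show ?thesis
  proof (rule convex_onI)
    fix t x y assume *: "(0::real) < t" "t < 1" "x \<in> ldom" "y \<in> ldom"
    have "(\<Sum>m<M. gr (coord ((1 - t) *\<^sub>R x + t *\<^sub>R y) m)) \<le> (\<Sum>m<M. (1 - t) * gr (coord x m) + t * gr (coord y m))"
      using * convex_onD[OF convex_gr] by (intro sum_mono) (auto simp: ldom_def)
    also have "\<dots> = (1 - t) * (\<Sum>m<M. gr (coord x m)) + t * (\<Sum>m<M. gr (coord y m))"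
      by (simp add: sum.distrib sum_distrib_left)
    finally have "hr ((1 - t) *\<^sub>R x + t *\<^sub>R y) \<le> (1 / real M) * ((1 - t) * (\<Sum>m<M. gr (coord x m)) + t * (\<Sum>m<M. gr (coord y m)))"
      unfolding hr_def by (intro mult_left_mono) auto
    also have "\<dots> = (1 - t) * hr x + t * hr y" 
      by (simp add: hr_def add_divide_distrib)
    finally show "hr ((1 - t) *\<^sub>R x + t *\<^sub>R y) \<le> (1 - t) * hr x + t * hr y" .
  qed (rule c)
qed

definition \<zeta> where "\<zeta> = coord zs 0"

lemma zs_in: "zs \<in> Rtup M d" and zs_tup: "zs = tup M (\<lambda>_. \<zeta>)"
proof -
  have c: "zs \<in> consensus M d" using vi by (simp add: vi_solution_def)
  then show 1: "zs \<in> Rtup M d" by (simp add: consensus_def)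
  have e: "\<forall>i<M. \<forall>j<M. coord zs i = coord zs j" using c unfolding consensus_def by blast
  have "coord zs i = \<zeta>" if "i < M" for i
    unfolding \<zeta>_def by (rule e[rule_format, OF that]) (use M in simp)
  moreover have "coord zs i = 0" if "i \<ge> M" for i
    using 1 that by (simp add: Rtup_def)
  ultimately show "zs = tup M (\<lambda>_. \<zeta>)" by (intro fvec_eqI) auto
qed

lemma tup_ldom: "x \<in> dom \<Longrightarrow> tup M (\<lambda>_. x) \<in> ldom"
  by (auto simp: ldom_def dom_def edom_def intro: tup_in_Rtup)

lemma hr_tup: "hr (tup M (\<lambda>_. x)) = gr x"
  using M by (simp add: hr_def)

lemma hr_zs: "hr zs = gr \<zeta>"
  by (subst zs_tup) (rule hr_tup)

lemma tup_consensus: "x \<in> dom \<Longrightarrow> tup M (\<lambda>_. x) \<in> consensus M d"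
  by (auto simp: consensus_def dom_def edom_def intro: tup_in_Rtup)

text \<open>Properness provides a constant tuple of finite value; against it, an infinite value at
  \<open>zs\<close> would turn the inequality into zero being at most minus infinity.\<close>

lemma zs_ldom: "zs \<in> ldom"
proof (rule ccontr)
  assume "zs \<notin> ldom"
  then have inf: "lift_reg M g zs = \<infinity>" using zs_in by (rule lift_reg_infinite[rotated])
  obtain x where x: "x \<in> dom" using g(1) by (auto simp: proper_on_def dom_def edom_def)
  have "0 \<le> ereal (inner (FF zs) (tup M (\<lambda>_. x) - zs)) + lift_reg M g (tup M (\<lambda>_. x)) - lift_reg M g zs"
    using vi tup_consensus[OF x] by (auto simp: vi_solution_def)
  then show False unfolding inf lift_reg_ldom[OF tup_ldom[OF x]] by simp
qed

text \<open>The inequality is tested on constant tuples, on which the factor \<open>1 / M\<close>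
  cancels the \<open>M\<close> copies of the regulariser.\<close>

lemma gr_subgradient:
  assumes "x \<in> dom"
  shows "gr \<zeta> - inner (\<Sum>m<M. coord (FF zs) m) (x - \<zeta>) \<le> gr x"
proof -
  let ?x = "tup M (\<lambda>_. x)"
  have "0 \<le> ereal (inner (FF zs) (?x - zs)) + lift_reg M g ?x - lift_reg M g zs"
    using vi tup_consensus[OF assms] by (auto simp: vi_solution_def)
  also have "\<dots> = ereal (inner (FF zs) (?x - zs) + gr x - gr \<zeta>)"
    unfolding lift_reg_ldom[OF tup_ldom[OF assms]] lift_reg_ldom[OF zs_ldom]
    by (simp add: hr_tup hr_zs)
  finally have "0 \<le> inner (FF zs) (?x - zs) + gr x - gr \<zeta>" by simp
  moreover have "inner (FF zs) (?x - zs) = inner (\<Sum>m<M. coord (FF zs) m) (x - \<zeta>)"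
  proof -
    have "coord (?x - zs) m = x - \<zeta>" if "m < M" for m using that by (subst zs_tup) simp
    then show ?thesis by (simp add: lift_op_def inner_tup inner_sum_left)
  qed
  ultimately show ?thesis by linarith
qed

text \<open>The lifted inequality concerns consensus points only, yet the primal iterates leave that
  subspace. Applying the subgradient of \<open>g\<close> at \<zeta> in every coordinate and
  averaging extends it to all tuples, with the mean of the operator values in each
  coordinate.\<close>

lemma hr_subgradient:
  assumes z: "z \<in> ldom"
  shows "hr zs - inner (FF zs - cproj M (FF zs)) (z - zs) \<le> hr z"
proof -
  let ?s = "\<Sum>m<M. coord (FF zs) m"
  have q: "FF zs - cproj M (FF zs) = tup M (\<lambda>_. (1 / real M) *\<^sub>R ?s)"
    by (intro fvec_eqI) (simp add: cproj_def lift_op_def)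
  have cz: "coord zs m = \<zeta>" if "m < M" for m using that by (subst zs_tup) simp
  have "(\<Sum>m<M. gr \<zeta> - inner ?s (coord z m - \<zeta>)) \<le> (\<Sum>m<M. gr (coord z m))"
    using z by (intro sum_mono gr_subgradient) (auto simp: ldom_def)
  then have "(1 / real M) * (\<Sum>m<M. gr \<zeta> - inner ?s (coord z m - \<zeta>)) \<le> hr z"
    unfolding hr_def by (intro mult_left_mono) auto
  moreover have "(1 / real M) * (\<Sum>m<M. gr \<zeta> - inner ?s (coord z m - \<zeta>)) = hr zs - inner (FF zs - cproj M (FF zs)) (z - zs)"
    unfolding q inner_tup using cz by (simp add: hr_def sum_subtractf right_diff_distrib sum_divide_distrib)
  ultimately show ?thesis by simp
qed

text \<open>The objective separates over the workers, so a minimiser is assembled from minimisers in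
  \<open>Rn d\<close> with weight \<open>\<kappa> / M\<close>; the minorant for their existence is
  \<open>gr_subgradient\<close>. Only then does the choice operator in \<open>prox\<close> have the
  stated properties.\<close>

lemma prox_ldom:
  fixes \<kappa> :: real and v :: "real fvec fvec"
  assumes \<kappa>: "\<kappa> > 0"
  defines "u \<equiv> prox (Rtup M d) \<kappa> (lift_reg M g) v"
  shows "u \<in> ldom" and "\<And>y. y \<in> ldom \<Longrightarrow> \<kappa> * hr u + 1/2 * (norm (u - v))\<^sup>2 \<le> \<kappa> * hr y + 1/2 * (norm (y - v))\<^sup>2"
proof -
  let ?P = "\<lambda>u. ereal \<kappa> * lift_reg M g u + ereal (1 / 2 * (norm (u - v))\<^sup>2)"
  have P: "?P z = ereal (\<kappa> * hr z + 1/2 * (norm (z - v))\<^sup>2)" if "z \<in> ldom" for z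
    using that by (simp add: lift_reg_ldom)
  have P_inf: "?P z = \<infinity>" if "z \<in> Rtup M d" "z \<notin> ldom" for z
    using that \<kappa> by (simp add: lift_reg_infinite)
  let ?s = "\<Sum>m<M. coord (FF zs) m"
  have "\<exists>w\<in>dom. \<forall>y\<in>dom. \<kappa> / M * gr w + 1/2 * (norm (w - coord v m))\<^sup>2 \<le> \<kappa> / M * gr y + 1/2 * (norm (y - coord v m))\<^sup>2" for m
    unfolding dom_def gr_def
  proof (rule prox_exists[OF complete_Rn convex_Rn g])
    show "(gr \<zeta> + inner ?s \<zeta>) + inner (- ?s) x \<le> real_of_ereal (g x)" if "x \<in> edom (Rn d) g" for x
      using gr_subgradient[of x] that by (simp add: dom_def gr_def inner_diff_right)
    show "\<kappa> / M > 0" using \<kappa> M by simp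
  qed
  then obtain w where w: "\<And>m. w m \<in> dom"
    "\<And>m y. y \<in> dom \<Longrightarrow> \<kappa> / M * gr (w m) + 1/2 * (norm (w m - coord v m))\<^sup>2 \<le> \<kappa> / M * gr y + 1/2 * (norm (y - coord v m))\<^sup>2"
    by metis
  define w' where "w' = tup M w"
  have w': "w' \<in> ldom" using w(1) by (auto simp: w'_def ldom_def dom_def edom_def intro: tup_in_Rtup)
  \<comment> \<open>As \<open>v\<close> is arbitrary, it may have coordinates beyond the first
    \<open>M\<close>; they are orthogonal to all competitors and add a constant.\<close>
  define r where "r = v - tup M (coord v)"
  have dec: "\<kappa> * hr z + 1/2 * (norm (z - v))\<^sup>2
      = (\<Sum>m<M. \<kappa> / M * gr (coord z m) + 1/2 * (norm (coord z m - coord v m))\<^sup>2) + 1/2 * (norm r)\<^sup>2" if "z \<in> ldom" for z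
  proof -
    have z: "z = tup M (coord z)" using that tup_coord by (metis (no_types, lifting) ldom_def mem_Collect_eq)
    have "z - v = tup M (\<lambda>m. coord z m - coord v m) - r"
      by (subst z) (intro fvec_eqI, simp add: r_def)
    moreover have "inner (tup M (\<lambda>m. coord z m - coord v m)) r = 0"
      by (simp add: inner_tup r_def)
    ultimately have "(norm (z - v))\<^sup>2 = (norm (tup M (\<lambda>m. coord z m - coord v m)))\<^sup>2 + (norm r)\<^sup>2"
      by (simp only: power2_norm_eq_inner inner_diff_left inner_diff_right) (simp add: inner_commute)
    then show ?thesis
      by (simp add: norm_tup_sq hr_def sum.distrib sum_distrib_left[symmetric] sum_divide_distrib[symmetric])
  qed
  have best: "\<kappa> * hr w' + 1/2 * (norm (w' - v))\<^sup>2 \<le> \<kappa> * hr y + 1/2 * (norm (y - v))\<^sup>2" if "y \<in> ldom" for y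
    unfolding dec[OF w'] dec[OF that] using w(2) that
    by (intro add_right_mono sum_mono) (auto simp: w'_def ldom_def)
  have sub: "z \<in> ldom \<Longrightarrow> z \<in> Rtup M d" for z by (simp add: ldom_def)
  have "is_arg_min ?P (\<lambda>z. z \<in> Rtup M d) w'"
    unfolding is_arg_min_def
  proof (intro conjI notI)
    show "w' \<in> Rtup M d" using w' by (rule sub)
    assume "\<exists>y. y \<in> Rtup M d \<and> ?P y < ?P w'"
    then obtain y where y: "y \<in> Rtup M d" "?P y < ?P w'" by blast
    show False
    proof (cases "y \<in> ldom")
      case True
      then show False using best[OF True] y(2) P[OF True] P[OF w'] by simp
    next
      case False
      show False using y(2) unfolding P_inf[OF y(1) False] by simp
    qed
  qed
  then have "is_arg_min ?P (\<lambda>z. z \<in> Rtup M d) u"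
    unfolding u_def prox_def arg_min_on_def arg_min_def by (rule someI)
  then have u: "u \<in> Rtup M d" "\<And>y. y \<in> Rtup M d \<Longrightarrow> ?P u \<le> ?P y"
    by (auto simp: is_arg_min_def not_less)
  show ul: "u \<in> ldom"
  proof (rule ccontr)
    assume "u \<notin> ldom"
    show False using u(2)[OF sub[OF w']] unfolding P_inf[OF u(1) \<open>u \<notin> ldom\<close>] P[OF w'] by simp
  qed
  show "\<kappa> * hr u + 1/2 * (norm (u - v))\<^sup>2 \<le> \<kappa> * hr y + 1/2 * (norm (y - v))\<^sup>2" if "y \<in> ldom" for y
    using u(2)[OF sub[OF that]] unfolding P[OF ul] P[OF that] by simp
qed

lemma prox_in: "\<kappa> > 0 \<Longrightarrow> prox (Rtup M d) \<kappa> (lift_reg M g) v \<in> Rtup M d"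
  using prox_ldom(1) by (auto simp: ldom_def)

text \<open>Monotonicity of the subdifferential of the lifted regulariser: add the optimality
  condition at \<open>u\<close>, tested at \<open>zs\<close>, to the subgradient inequality at
  \<open>zs\<close>, tested at \<open>u\<close>.\<close>

lemma prox_inner:
  fixes \<kappa> :: real and v :: "real fvec fvec"
  assumes \<kappa>: "\<kappa> > 0"
  defines "u \<equiv> prox (Rtup M d) \<kappa> (lift_reg M g) v"
  shows "0 \<le> inner (v - u + \<kappa> *\<^sub>R (FF zs - cproj M (FF zs))) (u - zs)"
proof -
  let ?q = "FF zs - cproj M (FF zs)"
  have u: "u \<in> ldom" unfolding u_def by (rule prox_ldom[OF \<kappa>])
  have "\<kappa> * hr u + inner (v - u) (zs - u) \<le> \<kappa> * hr zs"
    using \<kappa> prox_ldom(2)[OF \<kappa>, of _ v] by (intro prox_variational[OF convex_hr u zs_ldom]) (auto simp: u_def)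
  moreover have "\<kappa> * (hr zs - inner ?q (u - zs)) \<le> \<kappa> * hr u"
    using \<kappa> hr_subgradient[OF u] by (intro mult_left_mono) auto
  ultimately have "inner (v - u) (zs - u) \<le> \<kappa> * inner ?q (u - zs)" by (simp add: right_diff_distrib)
  moreover have "inner (v - u) (zs - u) = - inner (v - u) (u - zs)" by (simp add: inner_diff_right)
  ultimately show ?thesis by (simp add: inner_add_left del: inner_diff_left)
qed

end

section \<open>Contraction of the potential\<close>

lemma expectation_le_of_bound:
  fixes f h :: "'a \<Rightarrow> real"
  assumes fin: "finite (set_pmf p)" and le: "\<And>x. x \<in> set_pmf p \<Longrightarrow> f x \<le> c + h x"
    and h: "measure_pmf.expectation p h \<le> 0"
  shows "measure_pmf.expectation p f \<le> c"
proof -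
  have "measure_pmf.expectation p f \<le> measure_pmf.expectation p (\<lambda>x. c + h x)"
    by (rule expectation_mono_finite[OF fin le])
  also have "\<dots> = c + measure_pmf.expectation p h"
    by (subst Bochner_Integration.integral_add) (auto intro: integrable_measure_pmf_finite fin)
  finally show ?thesis using h by simp
qed

lemma expectation_quadratic:
  fixes N :: "'a \<Rightarrow> 'b::real_inner"
  assumes fin: "finite (set_pmf p)" and mean: "measure_pmf.expectation p (\<lambda>x. inner (N x) u) = 0"
    and var: "measure_pmf.expectation p (\<lambda>x. (norm (N x))\<^sup>2) \<le> v" and A: "A \<ge> 0"
  shows "measure_pmf.expectation p (\<lambda>x. A * (norm (N x))\<^sup>2 - B - C * inner (N x) u) \<le> A * v - B"
proof -
  have "measure_pmf.expectation p (\<lambda>x. A * (norm (N x))\<^sup>2 - B - C * inner (N x) u)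
     = A * measure_pmf.expectation p (\<lambda>x. (norm (N x))\<^sup>2) - B - C * measure_pmf.expectation p (\<lambda>x. inner (N x) u)"
    by (subst Bochner_Integration.integral_diff Bochner_Integration.integral_mult_right_zero | (auto intro: integrable_measure_pmf_finite fin)[1])+
  also have "\<dots> \<le> A * v - B" using mean mult_left_mono[OF var A] by simp
  finally show ?thesis .
qed

lemma batch_index_less:
  assumes "J \<in> set_pmf (batch_pmf M n b)" "n \<ge> 1" "m < M" "l < b"
  shows "J (m, l) < n"
proof -
  have "J \<in> PiE_dflt ({..<M} \<times> {..<b}) 0 (\<lambda>_. set_pmf (pmf_of_set {..<n}))"
    using assms(1) set_Pi_pmf_subset'[of "{..<M} \<times> {..<b}" 0 "\<lambda>_. pmf_of_set {..<n}"]
    by (auto simp: batch_pmf_def)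
  then have "J (m, l) \<in> set_pmf (pmf_of_set {..<n})" using assms(3,4) by (auto simp: PiE_dflt_def)
  then show ?thesis using assms(2) by (simp add: set_pmf_of_set lessThan_empty_iff)
qed

section \<open>The update expressed in deviations from the fixed point\<close>

locale algorithm =
  variational_problem d M n F g L L' \<mu> zs + gossip M B E W T chi +
  step_sizes L L' \<mu> chi p \<eta>z \<eta>y \<eta>x \<alpha> \<gamma> \<tau> b
  for d M n :: nat and F :: "nat \<Rightarrow> nat \<Rightarrow> real fvec \<Rightarrow> real fvec" and g :: "real fvec \<Rightarrow> ereal"
    and L L' \<mu> :: real and zs :: "real fvec fvec" and B :: nat and E :: "nat \<Rightarrow> (nat \<times> nat) set"
    and W :: "nat \<Rightarrow> real mat" and T :: nat and chi p \<eta>z \<eta>y \<eta>x \<alpha> \<gamma> \<tau> :: real and b :: nat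
begin

definition params :: alg_params where
  "params = \<lparr>p_eta_z = \<eta>z, p_eta_y = \<eta>y, p_eta_x = \<eta>x, p_theta = 1 / 2, p_alpha = \<alpha>, p_gamma = \<gamma>,
            p_omega = p, p_tau = \<tau>, p_nu = \<mu> / 4, p_beta = 5 * \<gamma>, p_batch = b, p_prob = p, p_period = T\<rparr>"

definition \<delta> where
  "\<delta> J s = (1 / real b) *\<^sub>R (\<Sum>l<b. lift_op M (\<lambda>m. F m (J (m, l))) (s_z s) - lift_op M (\<lambda>m. F m (J (m, l))) (s_w_prev s)
      + \<alpha> *\<^sub>R (lift_op M (\<lambda>m. F m (J (m, l))) (s_z s) - lift_op M (\<lambda>m. F m (J (m, l))) (s_z_prev s))) + FF (s_w_prev s)"

definition z_new where
  "z_new J s = prox (Rtup M d) \<eta>z (lift_reg M g) (s_z s + p *\<^sub>R (s_w s - s_z s)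
      - \<eta>z *\<^sub>R (\<delta> J s - (\<mu> / 4) *\<^sub>R s_z s - s_y s - \<alpha> *\<^sub>R (s_y s - s_y_prev s)))"

text \<open>The iterates \<open>y\<^sub>c\<close> and \<open>x\<^sub>c\<close> enter the algorithm only through their sum.\<close>

definition u_c where
  "u_c s = (\<tau> *\<^sub>R s_y s + (1 - \<tau>) *\<^sub>R s_y_f s) + (\<tau> *\<^sub>R s_x s + (1 - \<tau>) *\<^sub>R s_x_f s)"

definition y_new where
  "y_new J s = s_y s - \<eta>y *\<^sub>R (inverse (\<mu> / 4) *\<^sub>R u_c s + z_new J s + \<gamma> *\<^sub>R (s_y s + s_x s + (\<mu> / 4) *\<^sub>R s_z s))"

definition \<delta>' where
  "\<delta>' J J' s = (1 / real b) *\<^sub>R (\<Sum>l<b. lift_op M (\<lambda>m. F m (J' (m, l))) (z_new J s) - lift_op M (\<lambda>m. F m (J' (m, l))) (s_w s))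
      + FF (s_w s)"

definition r_new where
  "r_new J J' s = \<eta>x *\<^sub>R (inverse (\<mu> / 4) *\<^sub>R u_c s + (5 * \<gamma>) *\<^sub>R (s_x s + \<delta>' J J' s)) + s_m s"

definition update where "update k J J' c s = alg_update d M n F g W params k J J' c s"

lemma update_eq:
  "update k J J' c s = \<lparr>s_z = z_new J s, s_z_prev = s_z s, s_w = (if c then s_z s else s_w s), s_w_prev = s_w s,
     s_y = y_new J s, s_y_prev = s_y s,
     s_y_f = \<tau> *\<^sub>R s_y s + (1 - \<tau>) *\<^sub>R s_y_f s + \<tau> *\<^sub>R (y_new J s - s_y s),
     s_x = s_x s - A (T * k) (r_new J J' s),
     s_x_f = \<tau> *\<^sub>R s_x s + (1 - \<tau>) *\<^sub>R s_x_f s - (1 / 2) *\<^sub>R A (T * k) (u_c s),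
     s_m = r_new J J' s - A (T * k) (r_new J J' s)\<rparr>"
  by (simp add: update_def alg_update_def Let_def params_def A_def r_new_def u_c_def y_new_def z_new_def \<delta>_def \<delta>'_def)

text \<open>The iterate \<open>s_x\<close> stays centred, but the memory \<open>s_m\<close> may
  carry a consensus component. Gossip annihilates it, so \<psi> sees only the projection of the
  memory.\<close>

definition admissible where
  "admissible s \<longleftrightarrow> s_z s \<in> Rtup M d \<and> s_z_prev s \<in> Rtup M d \<and> s_w s \<in> Rtup M d \<and> s_w_prev s \<in> Rtup M d
     \<and> s_y s \<in> Rtup M d \<and> s_y_prev s \<in> Rtup M d \<and> s_y_f s \<in> Rtup M d
     \<and> s_x s \<in> Rtup M d \<and> s_x_f s \<in> Rtup M d \<and> s_m s \<in> Rtup M d \<and> cproj M (s_x s) = s_x s"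

lemmas Rtup_intros = subspace_add[OF subspace_Rtup] subspace_diff[OF subspace_Rtup]
  subspace_scale[OF subspace_Rtup] subspace_sum[OF subspace_Rtup] subspace_neg[OF subspace_Rtup]

definition valid where "valid J \<longleftrightarrow> (\<forall>m<M. \<forall>l<b. J (m, l) < n)"

lemma z_new_in: "z_new J s \<in> Rtup M d"
  unfolding z_new_def by (rule prox_in[OF eta(1)])

lemma lift_sample_in:
  assumes "valid J" "l < b" "z \<in> Rtup M d"
  shows "lift_op M (\<lambda>m. F m (J (m, l))) z \<in> Rtup M d"
  unfolding lift_op_def using assms by (intro tup_in_Rtup F_in) (auto simp: valid_def coord_Rtup)

lemma u_c_in: "admissible s \<Longrightarrow> u_c s \<in> Rtup M d"
  unfolding u_c_def admissible_def by (intro Rtup_intros) auto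

lemma r_new_in:
  assumes "admissible s" "valid J'"
  shows "r_new J J' s \<in> Rtup M d"
proof -
  have "\<delta>' J J' s \<in> Rtup M d"
    unfolding \<delta>'_def using assms
    by (intro Rtup_intros lift_sample_in FF_in z_new_in) (auto simp: admissible_def)
  then show ?thesis
    unfolding r_new_def using u_c_in[OF assms(1)] assms(1) by (intro Rtup_intros) (auto simp: admissible_def)
qed

lemma admissible_update:
  assumes s: "admissible s" and J': "valid J'"
  shows "admissible (update k J J' c s)"
proof -
  have i: "s_z s \<in> Rtup M d" "s_z_prev s \<in> Rtup M d" "s_w s \<in> Rtup M d" "s_w_prev s \<in> Rtup M d"
     "s_y s \<in> Rtup M d" "s_y_prev s \<in> Rtup M d" "s_y_f s \<in> Rtup M d"
     "s_x s \<in> Rtup M d" "s_x_f s \<in> Rtup M d" "s_m s \<in> Rtup M d" "cproj M (s_x s) = s_x s"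
    using s by (auto simp: admissible_def)
  have y: "y_new J s \<in> Rtup M d"
    unfolding y_new_def by (intro Rtup_intros i u_c_in[OF s] z_new_in)
  have p: "cproj M (s_x s - A (T * k) (r_new J J' s)) = s_x s - A (T * k) (r_new J J' s)"
    using i(11) cproj_A[OF r_new_in[OF s J']] by (simp add: linear_diff[OF linear_cproj])
  show ?thesis
    unfolding admissible_def update_eq
    by (simp add: p z_new_in y i r_new_in[OF s J'] Rtup_intros A_in u_c_in[OF s])
qed

definition xs where "xs = - cproj M (FF zs)"
definition ys where "ys = - ((\<mu> / 4) *\<^sub>R zs) - xs"

definition \<psi> :: "alg_state \<Rightarrow> real" where
  "\<psi> s = potential (s_z s - zs) (s_z_prev s - zs) (FF (s_z s) - FF zs) (FF (s_z_prev s) - FF zs)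
     (s_w s - zs) (s_w_prev s - zs) (s_y s - ys) (s_y_prev s - ys) (s_y_f s + s_x_f s - (ys + xs))
     (s_x s - xs - cproj M (s_m s)) (cproj M (s_m s))"

lemma sum_dual: "ys + xs = - ((\<mu> / 4) *\<^sub>R zs)" by (simp add: ys_def)

lemma cproj_zs: "cproj M zs = 0"
  by (subst zs_tup) (rule cproj_const[OF M])

lemma A_zs: "A t zs = 0"
  by (subst zs_tup) (rule A_const)

lemma cproj_xs: "cproj M xs = xs"
  by (simp add: xs_def linear_neg[OF linear_cproj] cproj_idem[OF M])

definition \<xi> where "\<xi> J s = \<delta> J s - (FF (s_z s) + \<alpha> *\<^sub>R (FF (s_z s) - FF (s_z_prev s)))"
definition \<xi>' where "\<xi>' J J' s = \<delta>' J J' s - FF (z_new J s)"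

lemma psi_update:
  assumes s: "admissible s" and J': "valid J'"
  shows "\<psi> (update k J J' c s) \<le> \<alpha> * \<psi> s
     + (4 * \<eta>z * (norm (\<xi> J s))\<^sup>2 - (\<alpha> * (p / (2 * \<eta>z)) * (norm (s_z s - s_w_prev s))\<^sup>2
          + \<alpha> / (8 * \<eta>z) * (norm (s_z s - s_z_prev s))\<^sup>2) - 2 * inner (\<xi> J s) (s_z s - zs))
     + (6 / 5 * \<gamma> * (norm (\<xi>' J J' s))\<^sup>2 - p / (2 * \<eta>z) * (norm (s_w s - z_new J s))\<^sup>2
        - 10 * \<gamma> * inner (\<xi>' J J' s) (s_x s - xs))
     + lam / \<eta>z * ((norm ((if c then s_z s else s_w s) - zs))\<^sup>2 - p * (norm (s_z s - zs))\<^sup>2 - (1 - p) * (norm (s_w s - zs))\<^sup>2)"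
proof -
  have i: "s_z s \<in> Rtup M d" "s_z_prev s \<in> Rtup M d" "cproj M (s_x s) = s_x s" "s_x s \<in> Rtup M d"
    using s by (auto simp: admissible_def)
  define U where "U = u_c s - (ys + xs)"
  define X where "X = s_x s - xs"
  define r where "r = r_new J J' s"
  define \<Phi> where "\<Phi> = cproj M (FF (z_new J s) - FF zs)"
  define \<zeta>' where "\<zeta>' = cproj M (\<xi>' J J' s)"
  define G where "G = inverse (\<mu> / 4) *\<^sub>R cproj M U + (5 * \<gamma>) *\<^sub>R (X + \<Phi> + \<zeta>')"
  define D where "D = (FF (s_z s) - FF zs) + \<alpha> *\<^sub>R ((FF (s_z s) - FF zs) - (FF (s_z_prev s) - FF zs)) + \<xi> J s
     - (\<mu> / 4) *\<^sub>R (s_z s - zs) - (s_y s - ys) - \<alpha> *\<^sub>R ((s_y s - ys) - (s_y_prev s - ys))"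
  note lin = linear_add[OF linear_cproj] linear_diff[OF linear_cproj] linear_scale[OF linear_cproj] linear_neg[OF linear_cproj]
  have X: "cproj M X = X" by (simp add: X_def lin i cproj_xs)
  have mu0: "\<mu> \<noteq> 0" using mu by simp
  have r_in: "r \<in> Rtup M d" unfolding r_def by (rule r_new_in[OF s J'])
  have U_in: "U \<in> Rtup M d" unfolding U_def sum_dual by (intro Rtup_intros u_c_in s zs_in)
  \<comment> \<open>\<open>ys + xs\<close> is a multiple of the consensus vector \<open>zs\<close>,
    which every gossip operator maps to zero.\<close>
  have AU: "A (T * k) (u_c s) = A (T * k) U"
    unfolding U_def sum_dual by (simp add: linear_add[OF linear_A] linear_scale[OF linear_A] A_zs)
  have cU: "cproj M U = cproj M (u_c s)"
    unfolding U_def sum_dual by (simp add: lin cproj_zs)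
  have R: "cproj M r = \<eta>x *\<^sub>R G + cproj M (s_m s)"
  proof -
    have "X + \<Phi> + \<zeta>' = s_x s + cproj M (\<delta>' J J' s)"
      by (simp add: X_def \<Phi>_def \<zeta>'_def \<xi>'_def lin xs_def)
    then show ?thesis by (simp add: r_def r_new_def G_def lin cU i)
  qed
  have m': "cproj M (r - A (T * k) r) = cproj M r - A (T * k) r"
    by (simp add: lin cproj_A[OF r_in])
  \<comment> \<open>The fixed-point values combine, by
    \<open>(\<mu> / 4) *\<^sub>R zs + ys = - xs\<close>, to minus the operator part that
    \<open>prox_inner\<close> adds.\<close>
  have D_eq: "D = \<delta> J s - (\<mu> / 4) *\<^sub>R s_z s - s_y s - \<alpha> *\<^sub>R (s_y s - s_y_prev s) - (FF zs - cproj M (FF zs))"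
    by (simp add: D_def \<xi>_def ys_def xs_def algebra_simps)
  have prox: "0 \<le> inner (s_z s - zs + p *\<^sub>R ((s_w s - zs) - (s_z s - zs)) - \<eta>z *\<^sub>R D - (z_new J s - zs)) (z_new J s - zs)"
  proof -
    have eq: "s_z s - zs + p *\<^sub>R ((s_w s - zs) - (s_z s - zs)) - \<eta>z *\<^sub>R D - (z_new J s - zs) =
      s_z s + p *\<^sub>R (s_w s - s_z s) - \<eta>z *\<^sub>R (\<delta> J s - (\<mu> / 4) *\<^sub>R s_z s - s_y s - \<alpha> *\<^sub>R (s_y s - s_y_prev s))
      - z_new J s + \<eta>z *\<^sub>R (FF zs - cproj M (FF zs))"
      unfolding D_eq by (simp add: scaleR_diff_right)
    show ?thesis unfolding eq unfolding z_new_def by (rule prox_inner[OF eta(1)])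
  qed
  have "potential (z_new J s - zs) (s_z s - zs) (FF (z_new J s) - FF zs) (FF (s_z s) - FF zs)
      ((if c then s_z s else s_w s) - zs) (s_w s - zs) (y_new J s - ys) (s_y s - ys)
      (U + \<tau> *\<^sub>R (y_new J s - ys - (s_y s - ys)) - (1/2) *\<^sub>R A (T * k) U)
      (X - cproj M (s_m s) - \<eta>x *\<^sub>R G) (cproj M r - A (T * k) r)
    \<le> \<alpha> * potential (s_z s - zs) (s_z_prev s - zs) (FF (s_z s) - FF zs) (FF (s_z_prev s) - FF zs)
      (s_w s - zs) (s_w_prev s - zs) (s_y s - ys) (s_y_prev s - ys) (s_y_f s + s_x_f s - (ys + xs))
      (X - cproj M (s_m s)) (cproj M (s_m s))
     + (4 * \<eta>z * (norm (\<xi> J s))\<^sup>2 - \<alpha> * (p / (2 * \<eta>z)) * (norm (s_z s - zs - (s_w_prev s - zs)))\<^sup>2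
        - \<alpha> / (8 * \<eta>z) * (norm (s_z s - zs - (s_z_prev s - zs)))\<^sup>2 - 2 * inner (\<xi> J s) (s_z s - zs))
     + (6 / 5 * \<gamma> * (norm \<zeta>')\<^sup>2 - p / (2 * \<eta>z) * (norm (s_w s - zs - (z_new J s - zs)))\<^sup>2 - 10 * \<gamma> * inner \<zeta>' X)
     + lam / \<eta>z * ((norm ((if c then s_z s else s_w s) - zs))\<^sup>2 - p * (norm (s_z s - zs))\<^sup>2 - (1 - p) * (norm (s_w s - zs))\<^sup>2)"
  proof (rule potential_step[OF prox D_def _ _ _ _ _ refl _ _ G_def refl])
    show "\<mu> * (norm (z_new J s - zs))\<^sup>2 \<le> inner (FF (z_new J s) - FF zs) (z_new J s - zs)"
      by (rule FF_mono[OF z_new_in zs_in])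
    show "norm (FF (z_new J s) - FF zs - (FF (s_z s) - FF zs)) \<le> L * norm (z_new J s - zs - (s_z s - zs))"
      using FF_lipschitz[OF z_new_in i(1)] by simp
    show "norm (FF (s_z s) - FF zs - (FF (s_z_prev s) - FF zs)) \<le> L * norm (s_z s - zs - (s_z_prev s - zs))"
      using FF_lipschitz[OF i(1,2)] by simp
    have e1: "inverse (\<mu> / 4) *\<^sub>R u_c s + z_new J s = inverse (\<mu> / 4) *\<^sub>R U + (z_new J s - zs)"
      using mu0 by (simp add: U_def sum_dual scaleR_add_right)
    have e2: "s_y s + s_x s + (\<mu> / 4) *\<^sub>R s_z s = s_y s - ys + X + (\<mu> / 4) *\<^sub>R (s_z s - zs)"
      by (simp add: X_def ys_def algebra_simps)
    show "y_new J s - ys = s_y s - ys - \<eta>y *\<^sub>R (inverse (\<mu> / 4) *\<^sub>R U + (z_new J s - zs)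
        + \<gamma> *\<^sub>R (s_y s - ys + X + (\<mu> / 4) *\<^sub>R (s_z s - zs)))"
      unfolding e1[symmetric] e2[symmetric] y_new_def by simp
    show "U = \<tau> *\<^sub>R (s_y s - ys + X) + (1 - \<tau>) *\<^sub>R (s_y_f s + s_x_f s - (ys + xs))"
      by (simp add: U_def X_def u_c_def algebra_simps)
    show "inverse chi / 2 * (norm (cproj M U))\<^sup>2 + (norm (A (T * k) U))\<^sup>2 / 2 \<le> inner U (A (T * k) U)"
      by (rule A_inner_ge[OF U_in])
    show "inner (cproj M U) X = inner U X" by (simp add: cproj_commute X)
    have "(norm (cproj M r - A (T * k) (cproj M r)))\<^sup>2 \<le> (1 - inverse chi) * (norm (cproj M r))\<^sup>2"
      by (rule A_contraction[OF cproj_in[OF r_in] sum_coord_cproj[OF M]])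
    then show "(norm (cproj M r - A (T * k) r))\<^sup>2 \<le> (1 - inverse chi) * (norm (\<eta>x *\<^sub>R G + cproj M (s_m s)))\<^sup>2"
      unfolding A_cproj[OF r_in] unfolding R .
    have "norm \<Phi> \<le> norm (FF (z_new J s) - FF zs)" unfolding \<Phi>_def by (rule norm_cproj_le[OF M])
    also have "\<dots> \<le> L * norm (z_new J s - zs)" by (rule FF_lipschitz[OF z_new_in zs_in])
    finally have "(norm \<Phi>)\<^sup>2 \<le> (L * norm (z_new J s - zs))\<^sup>2" by (intro power_mono) auto
    then show "(norm \<Phi>)\<^sup>2 \<le> L\<^sup>2 * (norm (z_new J s - zs))\<^sup>2" by (simp add: power_mult_distrib)
  qed
  \<comment> \<open>The projected noise can be replaced by the full one: projecting shrinks the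
    norm, and \<open>X\<close> is centred, so the inner product is unchanged.\<close>
  moreover have "6 / 5 * \<gamma> * (norm \<zeta>')\<^sup>2 \<le> 6 / 5 * \<gamma> * (norm (\<xi>' J J' s))\<^sup>2"
    unfolding \<zeta>'_def using gamma_pos norm_cproj_le[OF M] by (intro mult_left_mono power_mono) auto
  moreover have "inner \<zeta>' X = inner (\<xi>' J J' s) (s_x s - xs)"
    unfolding \<zeta>'_def cproj_commute X by (simp add: X_def)
  moreover have "\<psi> (update k J J' c s) = potential (z_new J s - zs) (s_z s - zs) (FF (z_new J s) - FF zs) (FF (s_z s) - FF zs)
      ((if c then s_z s else s_w s) - zs) (s_w s - zs) (y_new J s - ys) (s_y s - ys)
      (U + \<tau> *\<^sub>R (y_new J s - ys - (s_y s - ys)) - (1/2) *\<^sub>R A (T * k) U)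
      (X - cproj M (s_m s) - \<eta>x *\<^sub>R G) (cproj M r - A (T * k) r)"
  proof -
    have 1: "\<tau> *\<^sub>R s_y s + (1 - \<tau>) *\<^sub>R s_y_f s + \<tau> *\<^sub>R (y_new J s - s_y s)
        + (\<tau> *\<^sub>R s_x s + (1 - \<tau>) *\<^sub>R s_x_f s - (1 / 2) *\<^sub>R A (T * k) (u_c s)) - (ys + xs)
      = U + \<tau> *\<^sub>R (y_new J s - ys - (s_y s - ys)) - (1/2) *\<^sub>R A (T * k) U"
      unfolding AU by (simp add: U_def u_c_def)
    \<comment> \<open>The effect of the error feedback: the gossiped vector enters the iterate and
      the projected memory alike and drops out of their difference.\<close>
    have 2: "s_x s - A (T * k) r - xs - (cproj M r - A (T * k) r) = X - cproj M (s_m s) - \<eta>x *\<^sub>R G"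
      by (simp add: X_def R)
    show ?thesis unfolding \<psi>_def update_eq alg_state.simps r_def[symmetric] m' 1 2 ..
  qed
  moreover have "\<psi> s = potential (s_z s - zs) (s_z_prev s - zs) (FF (s_z s) - FF zs) (FF (s_z_prev s) - FF zs)
      (s_w s - zs) (s_w_prev s - zs) (s_y s - ys) (s_y_prev s - ys) (s_y_f s + s_x_f s - (ys + xs))
      (X - cproj M (s_m s)) (cproj M (s_m s))"
    by (simp add: \<psi>_def X_def)
  ultimately show ?thesis by simp
qed


text \<open>The cap of \<open>\<eta>z\<close> by \<open>L'\<close>, in the form
  \<open>64 * \<eta>z\<^sup>2 * L'\<^sup>2 \<le> \<alpha> * b * p\<close>, lets the reserves kept in
  the potential cover the variance. The extrapolated part has its own reserve, the remaining half of
  the square of \<open>z - z_prev\<close>.\<close>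

lemma sample_variance:
  assumes s: "admissible s"
  shows "measure_pmf.expectation (batch_pmf M n b) (\<lambda>J. 4 * \<eta>z * (norm (\<xi> J s))\<^sup>2
      - (\<alpha> * (p / (2 * \<eta>z)) * (norm (s_z s - s_w_prev s))\<^sup>2 + \<alpha> / (8 * \<eta>z) * (norm (s_z s - s_z_prev s))\<^sup>2)
      - 2 * inner (\<xi> J s) (s_z s - zs)) \<le> 0"
proof -
  have i: "s_z s \<in> Rtup M d" "s_z_prev s \<in> Rtup M d" "s_w_prev s \<in> Rtup M d"
    using s by (auto simp: admissible_def)
  define h where "h m i = F m i (coord (s_z s) m) - F m i (coord (s_w_prev s) m)
    + \<alpha> *\<^sub>R (F m i (coord (s_z s) m) - F m i (coord (s_z_prev s) m))" for m i
  let ?N = "\<lambda>J. (1 / real b) *\<^sub>R (\<Sum>l<b. tup M (\<lambda>m. h m (J (m, l)))) - tup M (\<lambda>m. (1 / real n) *\<^sub>R (\<Sum>i<n. h m i))"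
  have 1: "tup M (\<lambda>m. (1 / real n) *\<^sub>R (\<Sum>i<n. h m i)) = FF (s_z s) - FF (s_w_prev s) + \<alpha> *\<^sub>R (FF (s_z s) - FF (s_z_prev s))"
    by (rule fvec_eqI)
      (simp add: lift_op_def mean_op_def h_def sum.distrib sum_subtractf scaleR_right.sum[symmetric] algebra_simps)
  have 2: "tup M (\<lambda>m. h m (J (m, l))) = lift_op M (\<lambda>m. F m (J (m, l))) (s_z s) - lift_op M (\<lambda>m. F m (J (m, l))) (s_w_prev s)
      + \<alpha> *\<^sub>R (lift_op M (\<lambda>m. F m (J (m, l))) (s_z s) - lift_op M (\<lambda>m. F m (J (m, l))) (s_z_prev s))" for J l
    by (rule fvec_eqI) (simp add: lift_op_def h_def)
  have \<xi>: "\<xi> J s = ?N J" for J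
    unfolding 1 2 \<xi>_def \<delta>_def by simp
  define a where "a = (norm (s_z s - s_w_prev s))\<^sup>2"
  define c where "c = (norm (s_z s - s_z_prev s))\<^sup>2"
  have ac: "a \<ge> 0" "c \<ge> 0" by (auto simp: a_def c_def)
  have \<alpha>0: "0 \<le> \<alpha>" "\<alpha> \<le> 1" using alpha_ge_34 alpha_lt_1 by auto
  have "(\<Sum>m<M. (1 / real n) * (\<Sum>i<n. (norm (h m i))\<^sup>2))
    \<le> (\<Sum>m<M. (1 / real n) * (\<Sum>i<n. 2 * (norm (F m i (coord (s_z s) m) - F m i (coord (s_w_prev s) m)))\<^sup>2
       + 2 * \<alpha>\<^sup>2 * (norm (F m i (coord (s_z s) m) - F m i (coord (s_z_prev s) m)))\<^sup>2))"
  proof (intro sum_mono mult_left_mono)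
    fix m i
    show "(norm (h m i))\<^sup>2 \<le> 2 * (norm (F m i (coord (s_z s) m) - F m i (coord (s_w_prev s) m)))\<^sup>2
       + 2 * \<alpha>\<^sup>2 * (norm (F m i (coord (s_z s) m) - F m i (coord (s_z_prev s) m)))\<^sup>2"
      unfolding h_def by (rule order_trans[OF norm_add_sq_le]) (simp add: power_mult_distrib)
  qed auto
  also have "\<dots> = 2 * (\<Sum>m<M. (1 / real n) * (\<Sum>i<n. (norm (F m i (coord (s_z s) m) - F m i (coord (s_w_prev s) m)))\<^sup>2))
     + 2 * \<alpha>\<^sup>2 * (\<Sum>m<M. (1 / real n) * (\<Sum>i<n. (norm (F m i (coord (s_z s) m) - F m i (coord (s_z_prev s) m)))\<^sup>2))"
    by (simp only: sum.distrib sum_distrib_left distrib_left mult_ac)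
  also have "\<dots> \<le> 2 * (L'\<^sup>2 * a) + 2 * \<alpha>\<^sup>2 * (L'\<^sup>2 * c)"
    unfolding a_def c_def by (intro add_mono mult_left_mono avg_sum i) auto
  finally have V: "(1 / real b) * (\<Sum>m<M. (1 / real n) * (\<Sum>i<n. (norm (h m i))\<^sup>2))
      \<le> (1 / real b) * (2 * (L'\<^sup>2 * a) + 2 * \<alpha>\<^sup>2 * (L'\<^sup>2 * c))"
    by (intro mult_left_mono) auto
  have var: "measure_pmf.expectation (batch_pmf M n b) (\<lambda>J. (norm (?N J))\<^sup>2)
      \<le> (1 / real b) * (2 * (L'\<^sup>2 * a) + 2 * \<alpha>\<^sup>2 * (L'\<^sup>2 * c))"
    by (rule order_trans[OF batch_noise(2)[OF n b] V])
  have "4 * \<eta>z * ((1 / real b) * (2 * (L'\<^sup>2 * a) + 2 * \<alpha>\<^sup>2 * (L'\<^sup>2 * c)))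
     \<le> \<alpha> * (p / (2 * \<eta>z)) * a + \<alpha> / (8 * \<eta>z) * c"
  proof -
    have k: "8 * \<eta>z * L'\<^sup>2 / real b \<le> \<alpha> * p / (8 * \<eta>z)"
      using etaz_le(4) eta b by (simp add: field_simps power2_eq_square)
    have "8 * \<eta>z * L'\<^sup>2 / real b * a \<le> \<alpha> * p / (8 * \<eta>z) * a" using k ac by (intro mult_right_mono) auto
    also have "\<dots> \<le> \<alpha> * (p / (2 * \<eta>z)) * a"
      using ac \<alpha>0 p eta by (intro mult_right_mono) (auto simp: field_simps)
    finally have 1: "8 * \<eta>z * L'\<^sup>2 / real b * a \<le> \<alpha> * (p / (2 * \<eta>z)) * a" .
    have "\<alpha>\<^sup>2 \<le> 1" using \<alpha>0 by (simp add: power_le_one)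
    then have "8 * \<eta>z * L'\<^sup>2 / real b * (\<alpha>\<^sup>2 * c) \<le> 8 * \<eta>z * L'\<^sup>2 / real b * (1 * c)"
      using ac eta b by (intro mult_left_mono mult_right_mono) auto
    also have "\<dots> \<le> \<alpha> * p / (8 * \<eta>z) * c" unfolding mult_1_left by (rule mult_right_mono[OF k ac(2)])
    also have "\<dots> \<le> \<alpha> * 1 / (8 * \<eta>z) * c"
      using ac \<alpha>0 p eta by (intro mult_right_mono divide_right_mono mult_left_mono) auto
    finally have 2: "8 * \<eta>z * L'\<^sup>2 / real b * (\<alpha>\<^sup>2 * c) \<le> \<alpha> / (8 * \<eta>z) * c" by simp
    have "4 * \<eta>z * ((1 / real b) * (2 * (L'\<^sup>2 * a) + 2 * \<alpha>\<^sup>2 * (L'\<^sup>2 * c)))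
      = 8 * \<eta>z * L'\<^sup>2 / real b * a + 8 * \<eta>z * L'\<^sup>2 / real b * (\<alpha>\<^sup>2 * c)"
      by (simp add: distrib_left add_divide_distrib mult_ac)
    then show ?thesis using 1 2 by linarith
  qed
  then show ?thesis
    using expectation_quadratic[OF finite_batch_pmf[OF n] batch_noise(1)[OF n b] var, of "4 * \<eta>z"
        "\<alpha> * (p / (2 * \<eta>z)) * a + \<alpha> / (8 * \<eta>z) * c" 2 "s_z s - zs"] eta
    unfolding \<xi> a_def[symmetric] c_def[symmetric] by simp
qed

text \<open>Conditionally on the first batch, \<open>z_new\<close> is fixed and the noise is
  centred. The second bound in \<gamma> makes its weighted variance at most the reserved half of the
  square of \<open>w - z_new\<close>.\<close>

lemma resample_variance:
  assumes s: "admissible s"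
  shows "measure_pmf.expectation (batch_pmf M n b) (\<lambda>J'. 6 / 5 * \<gamma> * (norm (\<xi>' J J' s))\<^sup>2
      - p / (2 * \<eta>z) * (norm (s_w s - z_new J s))\<^sup>2 - 10 * \<gamma> * inner (\<xi>' J J' s) (s_x s - xs)) \<le> 0"
proof -
  have i: "s_w s \<in> Rtup M d" using s by (auto simp: admissible_def)
  define h where "h m i = F m i (coord (z_new J s) m) - F m i (coord (s_w s) m)" for m i
  let ?N = "\<lambda>J'. (1 / real b) *\<^sub>R (\<Sum>l<b. tup M (\<lambda>m. h m (J' (m, l)))) - tup M (\<lambda>m. (1 / real n) *\<^sub>R (\<Sum>i<n. h m i))"
  have 1: "tup M (\<lambda>m. (1 / real n) *\<^sub>R (\<Sum>i<n. h m i)) = FF (z_new J s) - FF (s_w s)"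
    by (rule fvec_eqI) (simp add: lift_op_def mean_op_def h_def sum_subtractf scaleR_diff_right)
  have 2: "tup M (\<lambda>m. h m (J' (m, l))) = lift_op M (\<lambda>m. F m (J' (m, l))) (z_new J s) - lift_op M (\<lambda>m. F m (J' (m, l))) (s_w s)"
    for J' l
    by (rule fvec_eqI) (simp add: lift_op_def h_def)
  have \<xi>': "\<xi>' J J' s = ?N J'" for J'
    unfolding 1 2 \<xi>'_def \<delta>'_def by simp
  define a where "a = (norm (s_w s - z_new J s))\<^sup>2"
  have a: "a \<ge> 0" by (simp add: a_def)
  have "(1 / real b) * (\<Sum>m<M. (1 / real n) * (\<Sum>i<n. (norm (h m i))\<^sup>2)) \<le> (1 / real b) * (L'\<^sup>2 * a)"
    unfolding h_def a_def norm_minus_commute[of "s_w s"] by (intro mult_left_mono avg_sum z_new_in i) auto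
  then have var: "measure_pmf.expectation (batch_pmf M n b) (\<lambda>J'. (norm (?N J'))\<^sup>2) \<le> (1 / real b) * (L'\<^sup>2 * a)"
    by (rule order_trans[OF batch_noise(2)[OF n b]])
  have "\<gamma> * L'\<^sup>2 / real b \<le> p / (24 * \<eta>z)"
    using gamma_le(2) eta b by (simp add: field_simps)
  then have "\<gamma> * L'\<^sup>2 / real b * a \<le> p / (24 * \<eta>z) * a" using a by (intro mult_right_mono) auto
  moreover have "0 \<le> p / (24 * \<eta>z) * a" using a p eta by simp
  moreover have "6 / 5 * \<gamma> * ((1 / real b) * (L'\<^sup>2 * a)) = 6 / 5 * (\<gamma> * L'\<^sup>2 / real b * a)"
    "p / (2 * \<eta>z) * a = 12 * (p / (24 * \<eta>z) * a)" by simp_all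
  ultimately have "6 / 5 * \<gamma> * ((1 / real b) * (L'\<^sup>2 * a)) \<le> p / (2 * \<eta>z) * a" by linarith
  then show ?thesis
    using expectation_quadratic[OF finite_batch_pmf[OF n] batch_noise(1)[OF n b] var, of "6 / 5 * \<gamma>"
        "p / (2 * \<eta>z) * a" "10 * \<gamma>" "s_x s - xs"] gamma_pos
    unfolding \<xi>' a_def[symmetric] by simp
qed

lemma valid_batch: "J \<in> set_pmf (batch_pmf M n b) \<Longrightarrow> valid J"
  using batch_index_less[OF _ n] by (auto simp: valid_def)

text \<open>The sources are integrated from the inside out, reset, second batch, first batch: each
  bracket of \<open>psi_update\<close> does not depend on the sources integrated before it and is
  removed by its own mean.\<close>

lemma expected_psi_update:
  assumes s: "admissible s"
  shows "measure_pmf.expectation (batch_pmf M n b) (\<lambda>J. measure_pmf.expectation (batch_pmf M n b)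
     (\<lambda>J'. measure_pmf.expectation (bernoulli_pmf p) (\<lambda>c. \<psi> (update k J J' c s)))) \<le> \<alpha> * \<psi> s"
proof (rule expectation_le_of_bound[OF finite_batch_pmf[OF n] _ sample_variance[OF s]],
    rule expectation_le_of_bound[OF finite_batch_pmf[OF n] _ resample_variance[OF s]])
  fix J J' assume J': "J' \<in> set_pmf (batch_pmf M n b)"
  have p01: "0 \<le> p" "p \<le> 1" using p by auto
  let ?w = "\<lambda>c. (norm ((if c then s_z s else s_w s) - zs))\<^sup>2 - p * (norm (s_z s - zs))\<^sup>2 - (1 - p) * (norm (s_w s - zs))\<^sup>2"
  show "measure_pmf.expectation (bernoulli_pmf p) (\<lambda>c. \<psi> (update k J J' c s)) \<le> \<alpha> * \<psi> s
     + (4 * \<eta>z * (norm (\<xi> J s))\<^sup>2 - (\<alpha> * (p / (2 * \<eta>z)) * (norm (s_z s - s_w_prev s))\<^sup>2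
          + \<alpha> / (8 * \<eta>z) * (norm (s_z s - s_z_prev s))\<^sup>2) - 2 * inner (\<xi> J s) (s_z s - zs))
     + (6 / 5 * \<gamma> * (norm (\<xi>' J J' s))\<^sup>2 - p / (2 * \<eta>z) * (norm (s_w s - z_new J s))\<^sup>2
        - 10 * \<gamma> * inner (\<xi>' J J' s) (s_x s - xs))"
  proof (rule expectation_le_of_bound[OF _ psi_update[OF s valid_batch[OF J']]])
    \<comment> \<open>The reset bracket is centred by construction, so its mean is exactly
      zero.\<close>
    have "lam / \<eta>z * ?w True * p + lam / \<eta>z * ?w False * (1 - p) = lam / \<eta>z * (p * ?w True + (1 - p) * ?w False)"
      by (simp only: distrib_left mult_ac)
    also have "p * ?w True + (1 - p) * ?w False = 0" by (simp add: algebra_simps)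
    finally show "measure_pmf.expectation (bernoulli_pmf p) (\<lambda>c. lam / \<eta>z * ?w c) \<le> 0"
      using p01 by (simp only: integral_bernoulli_pmf mult_zero_right order_refl)
  qed simp
qed

section \<open>Iteration and the final complexity bound\<close>

lemma finite_bernoulli: "finite (set_pmf (bernoulli_pmf q))" by (rule finite_subset[OF subset_UNIV]) simp

abbreviation "run \<equiv> alg_pmf d M n F g W params"

lemma finite_run: "finite (set_pmf (run s0 k))"
  by (induction k) (auto simp: params_def finite_batch_pmf[OF n] finite_bernoulli)

lemma run_Suc:
  "run s0 (Suc k) = run s0 k \<bind> (\<lambda>s. batch_pmf M n b \<bind> (\<lambda>J. batch_pmf M n b \<bind> (\<lambda>J'.
     bernoulli_pmf p \<bind> (\<lambda>c. return_pmf (update k J J' c s)))))"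
  by (simp add: update_def) (simp add: params_def)

lemma admissible_run: "admissible s0 \<Longrightarrow> s \<in> set_pmf (run s0 k) \<Longrightarrow> admissible s"
proof (induction k arbitrary: s)
  case (Suc k)
  then obtain s' J J' c where "s' \<in> set_pmf (run s0 k)" "J' \<in> set_pmf (batch_pmf M n b)" "s = update k J J' c s'"
    unfolding run_Suc by auto
  then show ?case using Suc admissible_update valid_batch by blast
qed simp

lemma expected_psi: "admissible s0 \<Longrightarrow> measure_pmf.expectation (run s0 k) \<psi> \<le> \<alpha> ^ k * \<psi> s0"
proof (induction k)
  case (Suc k)
  have "measure_pmf.expectation (run s0 (Suc k)) \<psi> = measure_pmf.expectation (run s0 k) (\<lambda>s.
     measure_pmf.expectation (batch_pmf M n b) (\<lambda>J. measure_pmf.expectation (batch_pmf M n b)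
       (\<lambda>J'. measure_pmf.expectation (bernoulli_pmf p) (\<lambda>c. \<psi> (update k J J' c s)))))"
    unfolding run_Suc
    by (subst expectation_bind_finite; (simp add: finite_run finite_batch_pmf[OF n] finite_bernoulli)?)+
  also have "\<dots> \<le> measure_pmf.expectation (run s0 k) (\<lambda>s. \<alpha> * \<psi> s)"
    by (intro expectation_mono_finite finite_run expected_psi_update admissible_run[OF Suc.prems])
  also have "\<dots> = \<alpha> * measure_pmf.expectation (run s0 k) \<psi>" by simp
  also have "\<dots> \<le> \<alpha> * (\<alpha> ^ k * \<psi> s0)"
    using Suc alpha_ge_34 by (intro mult_left_mono) auto
  finally show ?case by simp
qed simp

lemma psi_ge:
  assumes "admissible s"
  shows "(norm (s_z s - zs))\<^sup>2 \<le> 2 * \<eta>z * \<psi> s"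
proof -
  have "norm (FF (s_z s) - FF zs - (FF (s_z_prev s) - FF zs)) \<le> L * norm (s_z s - zs - (s_z_prev s - zs))"
    using assms FF_lipschitz[of "s_z s" "s_z_prev s"] by (simp add: admissible_def)
  then have "1 / (2 * \<eta>z) * (norm (s_z s - zs))\<^sup>2 \<le> \<psi> s" unfolding \<psi>_def by (rule potential_ge)
  then show ?thesis using eta by (simp add: field_simps)
qed

lemma expected_error:
  assumes "admissible s0"
  shows "measure_pmf.expectation (run s0 k) (\<lambda>s. (norm (s_z s - zs))\<^sup>2) \<le> \<alpha> ^ k * (2 * \<eta>z * \<psi> s0)"
proof -
  have "measure_pmf.expectation (run s0 k) (\<lambda>s. (norm (s_z s - zs))\<^sup>2)
     \<le> measure_pmf.expectation (run s0 k) (\<lambda>s. 2 * \<eta>z * \<psi> s)"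
    by (intro expectation_mono_finite finite_run psi_ge admissible_run[OF assms])
  also have "\<dots> = 2 * \<eta>z * measure_pmf.expectation (run s0 k) \<psi>" by simp
  also have "\<dots> \<le> 2 * \<eta>z * (\<alpha> ^ k * \<psi> s0)"
    using eta expected_psi[OF assms] by (intro mult_left_mono) auto
  finally show ?thesis by (simp add: mult_ac)
qed

lemma iteration_complexity:
  assumes s0: "admissible s0"
  shows "\<exists>C0>0. \<forall>\<epsilon>>0. \<forall>k::nat. real k \<ge> 900 * complexity * ln (C0 / \<epsilon>) \<longrightarrow>
    measure_pmf.expectation (run s0 k) (\<lambda>s. (norm (s_z s - zs))\<^sup>2) \<le> \<epsilon>"
proof -
  \<comment> \<open>The maximum with 1 keeps the constant positive when the initial potential
    vanishes.\<close>
  define C0 where "C0 = max 1 (2 * \<eta>z * \<psi> s0)"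
  have C0: "C0 > 0" by (simp add: C0_def)
  have \<alpha>: "0 < \<alpha>" "\<alpha> < 1" using alpha_ge_34 alpha_lt_1 by auto
  have "measure_pmf.expectation (run s0 k) (\<lambda>s. (norm (s_z s - zs))\<^sup>2) \<le> \<epsilon>"
    if \<epsilon>: "\<epsilon> > 0" and k: "real k \<ge> 900 * complexity * ln (C0 / \<epsilon>)" for \<epsilon> :: real and k :: nat
  proof -
    have "measure_pmf.expectation (run s0 k) (\<lambda>s. (norm (s_z s - zs))\<^sup>2) \<le> \<alpha> ^ k * (2 * \<eta>z * \<psi> s0)"
      by (rule expected_error[OF s0])
    also have "\<dots> \<le> \<alpha> ^ k * C0" using \<alpha> by (intro mult_left_mono) (auto simp: C0_def)
    also have "\<dots> \<le> \<epsilon>"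
    \<comment> \<open>For \<open>C0 \<le> \<epsilon>\<close> the logarithm is not positive and the
      bound on \<open>k\<close> gives nothing, but every \<open>k\<close> works; otherwise
      \<open>rate\<close> can be multiplied by it.\<close>
    proof (cases "C0 \<le> \<epsilon>")
      case True
      have "\<alpha> ^ k * C0 \<le> 1 * C0" using \<alpha> C0 by (intro mult_right_mono) (auto simp: power_le_one)
      then show ?thesis using True by simp
    next
      case False
      then have l: "0 \<le> ln (C0 / \<epsilon>)" using \<epsilon> C0 by (simp add: field_simps)
      have "1 / (1 - \<alpha>) * ln (C0 / \<epsilon>) \<le> 900 * complexity * ln (C0 / \<epsilon>)"
        using rate l by (rule mult_right_mono)
      also have "\<dots> \<le> real k" by (rule k)
      finally have lk: "ln (C0 / \<epsilon>) \<le> real k * (1 - \<alpha>)" using \<alpha> by (simp add: field_simps)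
      have "\<alpha> \<le> exp (\<alpha> - 1)" using exp_ge_add_one_self[of "\<alpha> - 1"] by simp
      then have "\<alpha> ^ k \<le> exp (\<alpha> - 1) ^ k" using \<alpha> by (intro power_mono) auto
      also have "\<dots> = exp (real k * (\<alpha> - 1))" by (rule exp_of_nat_mult[symmetric])
      also have "\<dots> \<le> exp (- ln (C0 / \<epsilon>))" using lk by (simp add: algebra_simps)
      also have "\<dots> = \<epsilon> / C0" using C0 \<epsilon> by (simp add: exp_minus)
      finally show ?thesis using C0 by (simp add: field_simps)
    qed
    finally show ?thesis .
  qed
  then show ?thesis using C0 by blast
qed

lemma admissible_init:
  assumes "z0 \<in> Rtup M d" "y0 \<in> Rtup M d" "x0 \<in> Rtup M d" "x0 \<in> orthogonal_comp (consensus M d)"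
  shows "admissible (init_state z0 y0 x0)"
  using assms orthogonal_consensus_imp_cproj[OF M] subspace_0[OF subspace_Rtup]
  by (simp add: admissible_def init_state_def)

end

theorem theorem4p3:
  shows "\<exists>C>0. \<forall>(d::nat) (M::nat) (n::nat) (F :: nat \<Rightarrow> nat \<Rightarrow> real fvec \<Rightarrow> real fvec)
      (g :: real fvec \<Rightarrow> ereal) (L::real) (L'::real) (\<mu>::real)
      (B::nat) (E :: nat \<Rightarrow> (nat \<times> nat) set) (W :: nat \<Rightarrow> real mat) (T::nat) (chi::real)
      (\<eta>z::real) (\<eta>y::real) (\<eta>x::real) (\<theta>::real) (\<alpha>::real) (\<gamma>::real) (\<omega>::real) (\<tau>::real)
      (\<nu>::real) (\<beta>::real) (b::nat) (p::real)
      (z0 :: real fvec fvec) (y0 :: real fvec fvec) (x0 :: real fvec fvec) (zs :: real fvec fvec).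
    \<comment> \<open>the problem\<close>
    d \<ge> 1 \<and> M \<ge> 1 \<and> n \<ge> 1 \<and>
    (\<forall>m<M. \<forall>i<n. \<forall>x\<in>Rn d. F m i x \<in> Rn d) \<and>
    proper_on (Rn d) g \<and> lsc_on (Rn d) g \<and> ereal_convex_on (Rn d) g \<and>
    L > 0 \<and> L' > 0 \<and> \<mu> > 0 \<and>
    (\<forall>m<M. L-lipschitz_on (Rn d) (mean_op n F m)) \<and>
    (\<forall>m<M. average_lipschitz n L' (Rn d) (F m)) \<and>
    (\<forall>m<M. strongly_monotone \<mu> (Rn d) (mean_op n F m)) \<and>
    vi_solution (consensus M d) (lift_op M (mean_op n F)) (lift_reg M g) zs \<and>
    \<comment> \<open>the network\<close>
    time_varying_network M B E W \<and> T \<ge> B \<and> chi \<ge> 1 \<and> contraction M W T chi \<and>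
    \<comment> \<open>the parameters\<close>
    b \<in> {1..n} \<and> 0 < p \<and> p < 1 \<and>
    \<eta>z > 0 \<and> \<eta>y > 0 \<and> \<eta>x > 0 \<and> \<theta> > 0 \<and>
    \<omega> = p \<and> p \<le> 1 / 16 \<and> \<theta> = 1 / 2 \<and> \<beta> = 5 * \<gamma> \<and> \<nu> = \<mu> / 4 \<and>
    \<tau> = min (\<mu> / (32 * L * chi)) (\<mu> * sqrt (real b * p) / (32 * L')) \<and>
    \<eta>z = Min {1 / (8 * L * chi), 1 / (32 * \<eta>y), sqrt (\<alpha> * real b * \<omega>) / (8 * L')} \<and>
    \<eta>y = min (1 / (4 * \<gamma>)) (\<nu> / (8 * \<tau>)) \<and>
    \<eta>x = min (1 / (900 * chi * \<gamma>)) (\<nu> / (36 * \<tau> * chi\<^sup>2)) \<and>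
    \<gamma> = min (\<mu> / (16 * L\<^sup>2)) (real b * \<omega> / (24 * L'\<^sup>2 * \<eta>z)) \<and>
    \<alpha> = Max {1 - p * \<eta>z * \<nu> / (p + \<eta>z * \<nu>), 1 - \<eta>y * \<gamma>, 1 - \<eta>x * \<gamma>,
             1 - \<mu> * \<eta>z / 8, 1 - \<tau>, 1 - 1 / (4 * chi)} \<and>
    \<comment> \<open>the initial point\<close>
    z0 \<in> Rtup M d \<and> (\<forall>m<M. g (coord z0 m) < \<infinity>) \<and>
    y0 \<in> Rtup M d \<and> x0 \<in> Rtup M d \<and> x0 \<in> orthogonal_comp (consensus M d)
    \<longrightarrow>
    (\<exists>C0>0. \<forall>\<epsilon>>0. \<forall>k::nat.
       real k \<ge> C * (chi\<^sup>2 + 1 / p + chi * (L / \<mu>) + 1 / sqrt (real b * p) * (L' / \<mu>)) * ln (C0 / \<epsilon>) \<longrightarrow>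
       measure_pmf.expectation
         (alg_pmf d M n F g W
           \<lparr>p_eta_z = \<eta>z, p_eta_y = \<eta>y, p_eta_x = \<eta>x, p_theta = \<theta>, p_alpha = \<alpha>, p_gamma = \<gamma>,
            p_omega = \<omega>, p_tau = \<tau>, p_nu = \<nu>, p_beta = \<beta>, p_batch = b, p_prob = p, p_period = T\<rparr>
           (init_state z0 y0 x0) k)
         (\<lambda>s. (norm (s_z s - zs))\<^sup>2) \<le> \<epsilon>)"
proof (rule exI[of _ "900::real"], intro conjI allI impI, goal_cases)
  case (2 d M n F g L L' \<mu> B E W T chi \<eta>z \<eta>y \<eta>x \<theta> \<alpha> \<gamma> \<omega> \<tau> \<nu> \<beta> b p z0 y0 x0 zs)
  note H = 2
  have "\<omega> = p" by (insert H, elim conjE, assumption)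
  moreover have "\<theta> = 1 / 2" by (insert H, elim conjE, assumption)
  moreover have "\<beta> = 5 * \<gamma>" by (insert H, elim conjE, assumption)
  moreover have "\<nu> = \<mu> / 4" by (insert H, elim conjE, assumption)
  ultimately have eqs: "\<omega> = p" "\<theta> = 1 / 2" "\<beta> = 5 * \<gamma>" "\<nu> = \<mu> / 4" .
  \<comment> \<open>The locales have no parameters for \<omega>, \<theta>, \<beta> and \<nu>, so
    these are replaced by their values before the step-size equations are matched.\<close>
  note H' = H[unfolded eqs]
  interpret variational_problem d M n F g L L' \<mu> zs
    by unfold_locales (insert H, elim conjE, (assumption | (drule spec, drule (1) mp)+, (assumption | drule (1) bspec, assumption)))+
  interpret gossip M B E W T chi
    by unfold_locales (insert H, elim conjE, assumption)+
  interpret step_sizes L L' \<mu> chi p \<eta>z \<eta>y \<eta>x \<alpha> \<gamma> \<tau> b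
  proof unfold_locales
    show "\<mu> \<le> L" "\<mu> \<le> L'" by (rule mu_le)+
    have "b \<in> {1..n}" by (insert H, elim conjE, assumption)
    then show "1 \<le> b" by simp
  qed (insert H', elim conjE, assumption)+
  interpret algorithm d M n F g L L' \<mu> zs B E W T chi p \<eta>z \<eta>y \<eta>x \<alpha> \<gamma> \<tau> b ..
  have "z0 \<in> Rtup M d" by (insert H, elim conjE, assumption)
  moreover have "y0 \<in> Rtup M d" by (insert H, elim conjE, assumption)
  moreover have "x0 \<in> Rtup M d" by (insert H, elim conjE, assumption)
  moreover have "x0 \<in> orthogonal_comp (consensus M d)" by (insert H, elim conjE, assumption)
  ultimately have "admissible (init_state z0 y0 x0)" by (rule admissible_init)
  from iteration_complexity[OF this] show ?case
    unfolding eqs params_def complexity_def .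
qed simp

end
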